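(* Let $R>1$ and let $J$ be a Jacobi matrix with Jost function $u$. Suppose $u$ is analytic in $\{z:|z|<R\}$ and nonvanishing on $\overline{\mathbb{D}}\setminus\{1,-1\}$, with at most simple zeros at $\pm1$. Then for every $n\ge1$, the Jost function $u^{(n)}$ of the stripped Jacobi matrix $J^{(n)}$ is also analytic in $\{z:|z|<R\}$ and nonvanishing on $\overline{\mathbb{D}}\setminus\{1,-1\}$, with at most simple zeros at $\pm1$.
   Context: A Jacobi matrix $J$ is the tridiagonal matrix on $\ell^2(\{1,2,\dots\})$ with diagonal entries $b_1,b_2,\dots\in\mathbb{R}$ and off-diagonal entries $a_1,a_2,\dots>0$ (bounded). $J^{(n)}$ denotes the Jacobi matrix with parameters $a^{(n)}_k=a_{n+k}$, $b^{(n)}_k=b_{n+k}$, $k\ge1$. The spectral measure $\gamma$ satisfies $\langle\delta_1,(J-E)^{-1}\delta_1\rangle=\int\frac{d\gamma(x)}{x-E}$; $m(E)=\int\frac{d\gamma(x)}{x-E}$, $M(z)=-m(z+z^{-1})$ for $z\in\mathbb{D}=\{|z|<1\}$. The Jacobi matrices considered have $d\gamma=f(x)dx+d\gamma_{\mathrm s}$ with $\operatorname{supp}f\subset[-2,2]$, $\gamma_{\mathrm s}([-2,2])=0$, $\gamma_{\mathrm s}$ finitely supported. The Jost function is the analytic function on $\mathbb{D}$ given by $u(z)=\prod_j\frac{z-z_j}{1-\bar z_jz}\exp\bigl(\int_0^{2\pi}\frac{e^{i\theta}+z}{e^{i\theta}-z}\log\bigl(\frac{\sin\theta}{\operatorname{Im}M(e^{i\theta})}\bigr)\frac{d\theta}{4\pi}\bigr)$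 (with $M(e^{i\theta})$ a.e. boundary values and $z_j$ the points of $\mathbb{D}$ with $z_j+z_j^{-1}$ a point mass of $\gamma$); equivalently it is determined by $|u(e^{i\theta})|^2\operatorname{Im}M(e^{i\theta})=\sin\theta$ a.e. and $u(z)=0\iff z+z^{-1}$ is a point mass of $\gamma$ ($z\in\mathbb D$). Analyticity in a larger disk refers to analytic continuation. *)

theory Defs
  imports "HOL-Complex_Analysis.Complex_Analysis"
begin

text \<open>Jacobi parameters are sequences a, b indexed from 1 (the values at index 0 are irrelevant).\<close>

definition jacobi :: "(nat \<Rightarrow> real) \<Rightarrow> (nat \<Rightarrow> real) \<Rightarrow> bool" where
  "jacobi a b \<longleftrightarrow> (\<forall>k\<ge>1. a k > 0) \<and> bounded (range a) \<and> bounded (range b)"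

definition strip :: "nat \<Rightarrow> (nat \<Rightarrow> real) \<Rightarrow> (nat \<Rightarrow> real)" where
  "strip n a = (\<lambda>k. a (n + k))"

text \<open>Action of the Jacobi matrix on sequences indexed by 1,2,... (coordinate 0 unused).\<close>
definition Jop :: "(nat \<Rightarrow> real) \<Rightarrow> (nat \<Rightarrow> real) \<Rightarrow> (nat \<Rightarrow> real) \<Rightarrow> (nat \<Rightarrow> real)" where
  "Jop a b v = (\<lambda>n. if n = 0 then 0 else
      (if n \<ge> 2 then a (n - 1) * v (n - 1) else 0) + b n * v n + a n * v (Suc n))"

definition delta1 :: "nat \<Rightarrow> real" where
  "delta1 = (\<lambda>n. if n = 1 then 1 else 0)"

definition jmoment :: "(nat \<Rightarrow> real) \<Rightarrow> (nat \<Rightarrow> real) \<Rightarrow> nat \<Rightarrow> real" where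
  "jmoment a b k = ((Jop a b ^^ k) delta1) 1"

text \<open>Spectral measure: the resolvent matrix element, given for large |E| by the Neumann series
  (J - E)^{-1} = - sum_k J^k / E^(k+1), equals the Stieltjes transform of gamma.\<close>
definition spectral_measure :: "(nat \<Rightarrow> real) \<Rightarrow> (nat \<Rightarrow> real) \<Rightarrow> real measure \<Rightarrow> bool" where
  "spectral_measure a b \<gamma> \<longleftrightarrow> sets \<gamma> = sets borel \<and> finite_measure \<gamma> \<and>
     (\<exists>K. \<forall>E::complex. cmod E > K \<longrightarrow>
        (\<lambda>k. - complex_of_real (jmoment a b k) / E ^ Suc k) sums
          (integral\<^sup>L \<gamma> (\<lambda>x. 1 / (complex_of_real x - E))))"

definition standing_form :: "real measure \<Rightarrow> bool" where
  "standing_form \<gamma> \<longleftrightarrow> (\<exists>f S (w :: real \<Rightarrow> ennreal).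
     f \<in> borel_measurable borel \<and> (\<forall>x. f x \<ge> 0) \<and> (\<forall>x. x \<notin> {-2..2} \<longrightarrow> f x = 0) \<and>
     finite S \<and> S \<inter> {-2..2} = {} \<and>
     (\<forall>A \<in> sets borel. emeasure \<gamma> A =
        (\<integral>\<^sup>+ x. ennreal (f x) * indicator A x \<partial>lborel) + (\<Sum>x\<in>S \<inter> A. w x)))"

definition m_fun :: "real measure \<Rightarrow> complex \<Rightarrow> complex" where
  "m_fun \<gamma> E = integral\<^sup>L \<gamma> (\<lambda>x. 1 / (complex_of_real x - E))"

definition M_fun :: "real measure \<Rightarrow> complex \<Rightarrow> complex" where
  "M_fun \<gamma> z = - m_fun \<gamma> (z + inverse z)"

definition ImM_bdry :: "real measure \<Rightarrow> real \<Rightarrow> real" where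
  "ImM_bdry \<gamma> \<theta> = Im (Lim (at_left 1) (\<lambda>r::real. M_fun \<gamma> (complex_of_real r * cis \<theta>)))"

definition jost_zeros :: "real measure \<Rightarrow> complex set" where
  "jost_zeros \<gamma> = {z \<in> ball 0 1. z \<noteq> 0 \<and>
      (\<exists>x. z + inverse z = complex_of_real x \<and> emeasure \<gamma> {x} > 0)}"

definition jost_function :: "(nat \<Rightarrow> real) \<Rightarrow> (nat \<Rightarrow> real) \<Rightarrow> (complex \<Rightarrow> complex) \<Rightarrow> bool" where
  "jost_function a b u \<longleftrightarrow> (\<exists>\<gamma>. spectral_measure a b \<gamma> \<and> standing_form \<gamma> \<and>
     set_integrable lborel {0..2*pi} (\<lambda>\<theta>. ln (sin \<theta> / ImM_bdry \<gamma> \<theta>)) \<and>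
     (\<forall>z \<in> ball 0 1. u z =
        (\<Prod>\<zeta>\<in>jost_zeros \<gamma>. (z - \<zeta>) / (1 - cnj \<zeta> * z)) *
        exp (set_lebesgue_integral lborel {0..2*pi}
               (\<lambda>\<theta>. (cis \<theta> + z) / (cis \<theta> - z) *
                     complex_of_real (ln (sin \<theta> / ImM_bdry \<gamma> \<theta>) / (4 * pi))))))"

definition good_jost :: "real \<Rightarrow> (complex \<Rightarrow> complex) \<Rightarrow> bool" where
  "good_jost R u \<longleftrightarrow> (\<exists>g. g holomorphic_on ball 0 R \<and> (\<forall>z \<in> ball 0 1. g z = u z) \<and>
     (\<forall>z \<in> cball 0 1 - {1, -1}. g z \<noteq> 0) \<and>
     (g 1 = 0 \<longrightarrow> deriv g 1 \<noteq> 0) \<and> (g (-1) = 0 \<longrightarrow> deriv g (-1) \<noteq> 0))"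

end

theory Submission
  imports Defs
begin

text \<open>
  Let \<open>g\<close> continue the Jost function.  As \<open>g\<close> has no zeros in the disc, the spectral measure has no point
  masses, and \<open>K = (1/z - z) M\<close> is the Herglotz integral of a nonnegative density on the circle, which
  by Fatou's theorem equals \<open>|N|^2 / 2\<close> almost everywhere, where \<open>N = (1 - z^2) / g\<close> is holomorphic across the
  circle.  Hence \<open>K\<close> continues across the circle and \<open>K(z) + K(1/z) = N(z) N(1/z)\<close>.  The stripped Jost
  function is \<open>a_1 M g / z = a_1 K g / (1 - z^2)\<close>; this identity continues it to \<open>|z| < R\<close> and
  shows that its zeros at \<open>1\<close> and \<open>-1\<close> are at most simple.

  That the stripped matrix has this Jost function follows from \<open>M (z + 1/z - b_1 - a_1^2 M_1) = 1\<close>: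
  the function \<open>(1/z - z) M_1\<close> is holomorphic near the closed disc, so it is the Herglotz integral of its real part,
  which defines the stripped spectral measure.
\<close>

section \<open>Poisson and Herglotz integrals\<close>

text \<open>The boundary value \<open>ImM_bdry\<close> applies \<open>Lim\<close> to the complex
  function M and only then takes the imaginary part. Convergence of Im M is therefore not enough:
  the conjugate Poisson integral has to converge as well, which is why radial limits are proved for
  Herglotz integrals. The density is merely in L^1, and this brings in the maximal function. A
  second obstacle is that |N|^2 is not holomorphic. The weight in the Jost integral depends on cos
  theta and |sin theta| almost everywhere, so g is real on the real axis; then |N|^2 = N(z) N(1/z)
  on the circle, and this product is holomorphic in an annulus. The spectral measure is encoded by
  moments, so the relation between M and M_1 is known only for large |z + 1/z|, that is near z = 0,
  while the new density lives on the circle. A formula holomorphic in a neighbourhood of the closed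
  disc has to join the two regions. Finally, boundary values fix an outer function only up to a
  unimodular constant. The constant is settled by positivity at 0, where the stripped function has
  the value a_1 g(0).\<close>

abbreviation circle :: "real measure" where
  "circle \<equiv> restrict_space lborel {0..2*pi}"

lemma finite_measure_circle: "finite_measure circle"
  by (intro finite_measureI) (simp add: emeasure_restrict_space space_restrict_space)

interpretation circle: finite_measure circle
  by (rule finite_measure_circle)

lemma measurable_circleI: "f \<in> borel_measurable borel \<Longrightarrow> f \<in> borel_measurable circle"
  by (simp add: measurable_restrict_space1)

lemma measure_circle: "measure circle {0..2*pi} = 2*pi"
  by (simp add: measure_restrict_space)

lemma integrable_circle_iff: 
  fixes f :: "real \<Rightarrow> 'a::{banach, second_countable_topology}"
  shows "integrable circle f \<longleftrightarrow> set_integrable lborel {0..2*pi} f"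
  by (simp add: set_integrable_def integrable_restrict_space)

lemma integral_circle_eq:
  fixes f :: "real \<Rightarrow> 'a::{banach, second_countable_topology}"
  shows "integral\<^sup>L circle f = set_lebesgue_integral lborel {0..2*pi} f"
  by (simp add: set_lebesgue_integral_def integral_restrict_space)

lemma integrable_circle_continuous:
  fixes f :: "real \<Rightarrow> 'a::euclidean_space"
  assumes "continuous_on {0..2*pi} f" shows "integrable circle f"
  unfolding integrable_circle_iff by (rule borel_integrable_atLeastAtMost') fact

lemma AE_circle_iff: "(AE x in circle. P x) \<longleftrightarrow> (AE x in lborel. x \<in> {0..2*pi} \<longrightarrow> P x)"
  by (simp add: AE_restrict_space_iff)

lemma integrable_circle_mult:
  fixes G k :: "real \<Rightarrow> complex"
  assumes "continuous_on {0..2*pi} G" "integrable circle k"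
  shows "integrable circle (\<lambda>x. G x * k x)"
proof -
  have "bounded (G ` {0..2*pi})" using assms(1) by (intro compact_imp_bounded compact_continuous_image) auto
  then obtain C where C: "\<And>x. x \<in> {0..2*pi} \<Longrightarrow> norm (G x) \<le> C" unfolding bounded_iff by blast
  show ?thesis
  proof (rule Bochner_Integration.integrable_bound)
    show "integrable circle (\<lambda>x. C * norm (k x))" using assms by auto
    have "G \<in> borel_measurable circle"
      using integrable_circle_continuous[OF assms(1)] by (rule borel_measurable_integrable)
    then show "(\<lambda>x. G x * k x) \<in> borel_measurable circle" using assms(2) by auto
    show "AE x in circle. norm (G x * k x) \<le> norm (C * norm (k x))"
    proof (rule AE_I2)
      fix x assume "x \<in> space circle"
      then have x: "x \<in> {0..2*pi}" by (simp add: space_restrict_space)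
      have "norm (G x) * norm (k x) \<le> C * norm (k x)" using C[OF x] by (intro mult_right_mono) auto
      also have "\<dots> \<le> \<bar>C * norm (k x)\<bar>" by simp
      finally show "norm (G x * k x) \<le> norm (C * norm (k x))" by (simp add: norm_mult)
    qed
  qed
qed

lemma integrable_circle_mult_real:
  fixes G k :: "real \<Rightarrow> real"
  assumes "continuous_on {0..2*pi} G" "integrable circle k"
  shows "integrable circle (\<lambda>x. G x * k x)"
proof -
  have "integrable circle (\<lambda>x. complex_of_real (G x) * complex_of_real (k x))"
    using assms by (intro integrable_circle_mult continuous_intros) auto
  then have "integrable circle (\<lambda>x. complex_of_real (G x * k x))" by simp
  then show ?thesis by (rule complex_of_real_integrable_eq[THEN iffD1])
qed

section \<open>The Poisson kernel and Cauchy's formula in the angular variable\<close>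

definition poisson_kernel :: "complex \<Rightarrow> real \<Rightarrow> real" where
  "poisson_kernel z \<phi> = (1 - (cmod z)\<^sup>2) / (cmod (cis \<phi> - z))\<^sup>2"

definition poisson :: "(real \<Rightarrow> real) \<Rightarrow> complex \<Rightarrow> real" where
  "poisson k z = (\<integral>\<phi>. poisson_kernel z \<phi> * k \<phi> \<partial>circle) / (2*pi)"

lemma cis_neq: "cmod z < 1 \<Longrightarrow> cis \<phi> \<noteq> z"
  by (metis norm_cis less_irrefl)

lemma poisson_kernel_nonneg: "cmod z < 1 \<Longrightarrow> 0 \<le> poisson_kernel z \<phi>"
  by (auto simp: poisson_kernel_def power_le_one intro!: divide_nonneg_nonneg)

lemma continuous_on_poisson_kernel: "cmod z < 1 \<Longrightarrow> continuous_on A (poisson_kernel z)"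
  unfolding poisson_kernel_def using cis_neq
  by (intro continuous_intros) (auto simp: cis_neq)


text \<open>On the circle dw = i w d phi. Since \<open>circlepath\<close> is parametrised over
  [0,1], the substitution phi = 2 pi x accounts for the remaining factor.\<close>

lemma integral_circle_contour:
  assumes "continuous_on (sphere 0 1) f"
  shows "contour_integral (circlepath 0 1) f = \<i> * (\<integral>\<phi>. cis \<phi> * f (cis \<phi>) \<partial>circle)"
proof -
  have cont: "continuous_on A (\<lambda>\<phi>. f (cis \<phi>))" for A
    using assms by (rule continuous_on_compose2) (auto intro!: continuous_intros)
  have "(\<integral>\<phi>. cis \<phi> * f (cis \<phi>) \<partial>circle) = integral {0..2*pi} (\<lambda>\<phi>. cis \<phi> * f (cis \<phi>))"
    unfolding integral_circle_eq
    by (intro set_borel_integral_eq_integral borel_integrable_atLeastAtMost' continuous_intros cont)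
  moreover have "((\<lambda>\<phi>. cis \<phi> * f (cis \<phi>)) has_integral integral {0..2*pi} (\<lambda>\<phi>. cis \<phi> * f (cis \<phi>))) (cbox 0 (2*pi))"
    by (simp, intro integrable_integral integrable_continuous_real continuous_intros cont)
  from has_integral_affinity[OF this, of "2*pi" 0]
  have "((\<lambda>x. cis (2*pi*x) * f (cis (2*pi*x))) has_integral (1/(2*pi)) *\<^sub>R integral {0..2*pi} (\<lambda>\<phi>. cis \<phi> * f (cis \<phi>))) {0..1}"
    by (simp add: scaleR_conv_of_real)
  from has_integral_mult_right[OF this, of "2*pi*\<i>"]
  have "((\<lambda>x. f (circlepath 0 1 x) * vector_derivative (circlepath 0 1) (at x)) has_integral \<i> * integral {0..2*pi} (\<lambda>\<phi>. cis \<phi> * f (cis \<phi>))) {0..1}"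
    unfolding vector_derivative_circlepath by (simp add: circlepath cis_conv_exp mult_ac scaleR_conv_of_real)
  then have "contour_integral (circlepath 0 1) f = \<i> * integral {0..2*pi} (\<lambda>\<phi>. cis \<phi> * f (cis \<phi>))"
    unfolding contour_integral_integral by (rule integral_unique)
  ultimately show ?thesis by simp
qed

lemma cauchy_circle:
  fixes F :: "complex \<Rightarrow> complex"
  assumes F: "F holomorphic_on ball 0 \<rho>" and "\<rho> > 1" and z: "cmod z < 1"
  shows "(\<integral>\<phi>. cis \<phi> / (cis \<phi> - z) * F (cis \<phi>) \<partial>circle) = 2 * pi * F z"
proof -
  have sub: "cball 0 1 \<subseteq> ball (0::complex) \<rho>" using assms by auto
  have cF: "continuous_on (sphere 0 1) F"
    using F sub holomorphic_on_imp_continuous_on continuous_on_subset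
    by (metis sphere_cball subset_trans)
  have "((\<lambda>u. F u / (u - z)) has_contour_integral (2 * of_real pi * \<i> * F z)) (circlepath 0 1)"
  proof (rule Cauchy_integral_circlepath)
    show "continuous_on (cball 0 1) F"
      using F sub holomorphic_on_imp_continuous_on continuous_on_subset by blast
    show "F holomorphic_on ball 0 1" using F assms(2) by (auto intro: holomorphic_on_subset)
  qed (use z in auto)
  then have "contour_integral (circlepath 0 1) (\<lambda>u. F u / (u - z)) = 2 * of_real pi * \<i> * F z"
    by (rule contour_integral_unique)
  moreover have "contour_integral (circlepath 0 1) (\<lambda>u. F u / (u - z))
     = \<i> * (\<integral>\<phi>. cis \<phi> * (F (cis \<phi>) / (cis \<phi> - z)) \<partial>circle)"
    using z by (intro integral_circle_contour continuous_intros cF) auto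
  ultimately show ?thesis by (simp add: mult_ac)
qed

lemma mean_value_circle:
  fixes F :: "complex \<Rightarrow> complex"
  assumes "F holomorphic_on ball 0 \<rho>" and "\<rho> > 1"
  shows "(\<integral>\<phi>. F (cis \<phi>) \<partial>circle) = 2 * pi * F 0"
  using cauchy_circle[OF assms, of 0] by simp

text \<open>As cnj w = 1/w on the circle, conjugation turns the Cauchy kernel into 1 / (1 - cnj z *
  w). The integrand is thus the conjugate of a function holomorphic beyond the closed disc, and the
  mean value property leaves only its value at 0.\<close>

lemma conj_cauchy_circle:
  assumes F: "F holomorphic_on ball 0 \<rho>" and "\<rho> > 1" and z: "cmod z < 1"
  shows "(\<integral>\<phi>. cis \<phi> / (cis \<phi> - z) * cnj (F (cis \<phi>)) \<partial>circle) = 2 * pi * cnj (F 0)"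
proof -
  \<comment> \<open>The reflected pole 1 / cnj z lies outside the closed disc, and \<sigma> stops
    before it. For z = 0 there is no such pole, and \<open>1 / cmod z\<close> would be 0.\<close>
  define \<sigma> where "\<sigma> = (if z = 0 then \<rho> else min \<rho> (1 / cmod z))"
  have \<sigma>: "\<sigma> > 1" "\<sigma> \<le> \<rho>" using assms by (auto simp: \<sigma>_def)
  have nz: "1 - cnj z * w \<noteq> 0" if "w \<in> ball 0 \<sigma>" for w
  proof
    assume "1 - cnj z * w = 0"
    then have "cnj z * w = 1" by simp
    then have e: "cmod z * cmod w = 1" by (metis complex_mod_cnj norm_mult norm_one)
    then have "z \<noteq> 0" by auto
    then have "cmod w < 1 / cmod z" using that by (auto simp: \<sigma>_def)
    then show False using e \<open>z \<noteq> 0\<close> by (simp add: field_simps)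
  qed
  have "(\<lambda>w. F w / (1 - cnj z * w)) holomorphic_on ball 0 \<sigma>"
    using F \<sigma> nz by (intro holomorphic_intros) (auto intro: holomorphic_on_subset)
  from mean_value_circle[OF this \<sigma>(1)]
  have "(\<integral>\<phi>. F (cis \<phi>) / (1 - cnj z * cis \<phi>) \<partial>circle) = 2 * pi * F 0" by simp
  then have "cnj (\<integral>\<phi>. F (cis \<phi>) / (1 - cnj z * cis \<phi>) \<partial>circle) = 2 * pi * cnj (F 0)" by simp
  moreover have "cnj (\<integral>\<phi>. F (cis \<phi>) / (1 - cnj z * cis \<phi>) \<partial>circle)
     = (\<integral>\<phi>. cnj (F (cis \<phi>) / (1 - cnj z * cis \<phi>)) \<partial>circle)"
    by (rule Bochner_Integration.integral_cnj[symmetric])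
  moreover have "cnj (F (cis \<phi>) / (1 - cnj z * cis \<phi>)) = cis \<phi> / (cis \<phi> - z) * cnj (F (cis \<phi>))" for \<phi>
  proof -
    have "cis \<phi> - z = cis \<phi> * (1 - z * cnj (cis \<phi>))"
      by (simp add: right_diff_distrib cis_cnj cis_mult)
    then show ?thesis by simp
  qed
  ultimately show ?thesis by simp
qed

section \<open>Herglotz integrals and the Schwarz formula\<close>

definition herglotz :: "(real \<Rightarrow> real) \<Rightarrow> complex \<Rightarrow> complex" where
  "herglotz k z = (\<integral>\<phi>. (cis \<phi> + z) / (cis \<phi> - z) * complex_of_real (k \<phi>) \<partial>circle) / (2*pi)"

lemma continuous_on_herglotz_kernel:
  "cmod z < 1 \<Longrightarrow> continuous_on A (\<lambda>\<phi>. (cis \<phi> + z) / (cis \<phi> - z))"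
  by (intro continuous_intros) (auto simp: cis_neq)

lemma Re_herglotz_kernel: 
  assumes "cmod z < 1" shows "Re ((cis \<phi> + z) / (cis \<phi> - z)) = poisson_kernel z \<phi>"
proof -
  have "Re ((cis \<phi> + z) / (cis \<phi> - z)) = Re ((cis \<phi> + z) * cnj (cis \<phi> - z)) / (cmod (cis \<phi> - z))\<^sup>2"
    by (metis Re_divide_of_real complex_div_cnj of_real_power)
  also have "Re ((cis \<phi> + z) * cnj (cis \<phi> - z)) = (cmod (cis \<phi>))\<^sup>2 - (cmod z)\<^sup>2"
    unfolding cmod_power2 by (simp add: power2_eq_square algebra_simps)
  finally show ?thesis by (simp add: poisson_kernel_def)
qed

lemma Re_herglotz:
  assumes z: "cmod z < 1" and k: "integrable circle k"
  shows "Re (herglotz k z) = poisson k z"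
proof -
  have "integrable circle (\<lambda>\<phi>. (cis \<phi> + z) / (cis \<phi> - z) * complex_of_real (k \<phi>))"
    using k by (intro integrable_circle_mult continuous_on_herglotz_kernel[OF z]) auto
  then have "Re (\<integral>\<phi>. (cis \<phi> + z) / (cis \<phi> - z) * complex_of_real (k \<phi>) \<partial>circle)
    = (\<integral>\<phi>. Re ((cis \<phi> + z) / (cis \<phi> - z) * complex_of_real (k \<phi>)) \<partial>circle)"
    by (rule integral_Re[symmetric])
  also have "\<dots> = (\<integral>\<phi>. poisson_kernel z \<phi> * k \<phi> \<partial>circle)"
    by (intro Bochner_Integration.integral_cong refl)
       (simp only: Re_herglotz_kernel[OF z, symmetric] Re_complex_of_real Im_complex_of_real times_complex.sel mult_zero_right diff_zero)
  finally show ?thesis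
    unfolding herglotz_def poisson_def
    by (metis Re_divide_of_real of_real_mult of_real_numeral)
qed

text \<open>Schwarz formula. Write Re F = (F + cnj F) / 2 and the kernel as 2 w / (w - z) - 1: the
  part with F is Cauchy's formula, the part with cnj F yields only the constant cnj (F 0), and the
  -1 yields the mean value. The imaginary part of F at 0 is the one thing that boundary values of Re
  F cannot see.\<close>

lemma herglotz_Re:
  assumes F: "F holomorphic_on ball 0 \<rho>" and \<rho>: "\<rho> > 1" and z: "cmod z < 1"
  shows "herglotz (\<lambda>\<phi>. Re (F (cis \<phi>))) z = F z - \<i> * Im (F 0)"
proof -
  have cF: "continuous_on A (\<lambda>\<phi>. F (cis \<phi>))" for A
    using holomorphic_on_imp_continuous_on[OF F]
    by (rule continuous_on_compose2) (use \<rho> in \<open>auto intro!: continuous_intros\<close>)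
  have i1: "integrable circle (\<lambda>\<phi>. cis \<phi> / (cis \<phi> - z) * F (cis \<phi>))"
    using z by (intro integrable_circle_continuous continuous_intros cF) (auto simp: cis_neq)
  have i2: "integrable circle (\<lambda>\<phi>. cis \<phi> / (cis \<phi> - z) * cnj (F (cis \<phi>)))"
    using z by (intro integrable_circle_continuous continuous_intros cF) (auto simp: cis_neq)
  have i3: "integrable circle (\<lambda>\<phi>. F (cis \<phi>))" "integrable circle (\<lambda>\<phi>. cnj (F (cis \<phi>)))"
    by (intro integrable_circle_continuous continuous_intros cF)+
  have "(\<integral>\<phi>. (cis \<phi> + z) / (cis \<phi> - z) * complex_of_real (Re (F (cis \<phi>))) \<partial>circle)
    = (\<integral>\<phi>. cis \<phi> / (cis \<phi> - z) * F (cis \<phi>) + cis \<phi> / (cis \<phi> - z) * cnj (F (cis \<phi>))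
         - (F (cis \<phi>) + cnj (F (cis \<phi>))) / 2 \<partial>circle)"
  proof (intro Bochner_Integration.integral_cong refl)
    fix \<phi>
    have nz: "cis \<phi> - z \<noteq> 0" using cis_neq[OF z, of \<phi>] by simp
    have 1: "complex_of_real (Re (F (cis \<phi>))) = (F (cis \<phi>) + cnj (F (cis \<phi>))) / 2"
      by (simp add: complex_add_cnj)
    have 2: "(cis \<phi> + z) / (cis \<phi> - z) = 2 * (cis \<phi> / (cis \<phi> - z)) - 1"
      using nz by (simp add: field_simps)
    have "(2 * q - 1) * ((x + y) / 2) = q * x + q * y - (x + y) / 2" for q x y :: complex
      by (simp add: field_simps)
    then show "(cis \<phi> + z) / (cis \<phi> - z) * complex_of_real (Re (F (cis \<phi>)))
       = cis \<phi> / (cis \<phi> - z) * F (cis \<phi>) + cis \<phi> / (cis \<phi> - z) * cnj (F (cis \<phi>))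
         - (F (cis \<phi>) + cnj (F (cis \<phi>))) / 2"
      unfolding 1 2 .
  qed
  also have "\<dots> = 2*pi*F z + 2*pi*cnj (F 0) - (2*pi*F 0 + cnj (2*pi*F 0)) / 2"
    using i1 i2 i3 cauchy_circle[OF F \<rho> z] conj_cauchy_circle[OF F \<rho> z] mean_value_circle[OF F \<rho>] by simp
  also have "\<dots> = 2*pi*(F z - (F 0 - cnj (F 0)) / 2)" by (simp add: field_simps)
  also have "(F 0 - cnj (F 0)) / 2 = \<i> * Im (F 0)" by (simp add: complex_diff_cnj)
  finally show ?thesis by (simp add: herglotz_def)
qed

lemma poisson_holomorphic:
  assumes F: "F holomorphic_on ball 0 \<rho>" and \<rho>: "\<rho> > 1" and z: "cmod z < 1"
  shows "poisson (\<lambda>\<phi>. Re (F (cis \<phi>))) z = Re (F z)"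
proof -
  have "continuous_on {0..2*pi} (\<lambda>\<phi>. F (cis \<phi>))"
    using holomorphic_on_imp_continuous_on[OF F]
    by (rule continuous_on_compose2) (use \<rho> in \<open>auto intro!: continuous_intros\<close>)
  then have "integrable circle (\<lambda>\<phi>. Re (F (cis \<phi>)))"
    by (intro integrable_circle_continuous continuous_intros)
  from Re_herglotz[OF z this] show ?thesis
    unfolding herglotz_Re[OF F \<rho> z] by simp
qed

lemma poisson_const:
  assumes "cmod z < 1" shows "poisson (\<lambda>_. c) z = c"
  using poisson_holomorphic[of "\<lambda>_. complex_of_real c" 2 z] assms by simp

section \<open>A maximal inequality\<close>

text \<open>Weak type (1,1) bound for the centred Hardy-Littlewood maximal function. Every point of
  \<open>U\<close> owns an interval of large mass; Vitali selects disjoint ones whose fivefold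
  enlargements cover \<open>U\<close>, which is the origin of the constant 5.\<close>

lemma maximal_weak_type:
  fixes w :: "real \<Rightarrow> ennreal" and c :: real
  assumes [measurable]: "w \<in> borel_measurable borel" and fin: "(\<integral>\<^sup>+y. w y \<partial>lborel) < \<infinity>" and c: "c > 0"
  defines "U \<equiv> {x. \<exists>e>0. ennreal (2 * e * c) < (\<integral>\<^sup>+y\<in>cball x e. w y \<partial>lborel)}"
  shows "open U" and "ennreal c * emeasure lborel U \<le> 5 * (\<integral>\<^sup>+y. w y \<partial>lborel)"
proof -
  show op: "open U"
  proof (unfold open_contains_ball, rule ballI)
    fix x assume "x \<in> U"
    then obtain e where e: "e > 0" "ennreal (2 * e * c) < (\<integral>\<^sup>+y\<in>cball x e. w y \<partial>lborel)"
      by (auto simp: U_def)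
    \<comment> \<open>The strict inequality leaves room: the radius may grow by \<open>d\<close>,
      with 2 (e + d) c = q', before the room is used up. The larger interval around any nearby
      centre contains the original one, so that centre is admissible too.\<close>
    obtain q :: ennreal where q: "ennreal (2 * e * c) < q" "q < (\<integral>\<^sup>+y\<in>cball x e. w y \<partial>lborel)"
      using dense[OF e(2)] by auto
    have "q < top" using q(2) by (metis dual_order.strict_trans1 top.extremum linorder_not_le order_top_class.top.not_eq_extremum)
    then obtain q' where q': "q = ennreal q'" "q' \<ge> 0"
      by (cases q) auto
    have lt: "2 * e * c < q'" using q(1) q' e c by (simp add: ennreal_less_iff)
    define d where "d = (q' / (2*c) - e)"
    have d: "d > 0" using lt c by (simp add: d_def field_simps)
    have "ball x d \<subseteq> U"
    proof
      fix y assume y: "y \<in> ball x d"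
      have sub: "cball x e \<subseteq> cball y (e + d)"
      proof
        fix t assume "t \<in> cball x e"
        then show "t \<in> cball y (e + d)" using y dist_triangle[of y t x] by (auto simp: dist_commute)
      qed
      have "ennreal (2 * (e + d) * c) = q" using c q' by (simp add: d_def)
      also have "\<dots> < (\<integral>\<^sup>+t\<in>cball x e. w t \<partial>lborel)" by fact
      also have "\<dots> \<le> (\<integral>\<^sup>+t\<in>cball y (e+d). w t \<partial>lborel)"
        using sub by (intro nn_integral_mono) (auto split: split_indicator)
      finally show "y \<in> U" using e d by (auto simp: U_def intro!: exI[of _ "e + d"])
    qed
    then show "\<exists>d>0. ball x d \<subseteq> U" using d by blast
  qed
  define W where "W = (\<integral>\<^sup>+y. w y \<partial>lborel)"
  define r where "r x = (SOME e. e > 0 \<and> ennreal (2 * e * c) < (\<integral>\<^sup>+y\<in>cball x e. w y \<partial>lborel))" for x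
  have r: "r x > 0" "ennreal (2 * r x * c) < (\<integral>\<^sup>+y\<in>cball x (r x). w y \<partial>lborel)" if "x \<in> U" for x
    using someI_ex[of "\<lambda>e. e > 0 \<and> ennreal (2 * e * c) < (\<integral>\<^sup>+y\<in>cball x e. w y \<partial>lborel)"] that
    by (auto simp: U_def r_def)
  \<comment> \<open>Vitali's lemma asks for bounded radii; the finite total mass bounds
    them.\<close>
  have bnd: "r x \<le> enn2real W / (2 * c)" if "x \<in> U" for x
  proof -
    have "ennreal (2 * r x * c) \<le> (\<integral>\<^sup>+y\<in>cball x (r x). w y \<partial>lborel)" using r(2)[OF that] by simp
    also have "\<dots> \<le> W" unfolding W_def by (intro nn_integral_mono) (auto split: split_indicator)
    also have "W = ennreal (enn2real W)" using fin by (simp add: W_def)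
    finally have "2 * r x * c \<le> enn2real W" by (simp add: ennreal_le_iff)
    then show ?thesis using c by (simp add: field_simps)
  qed
  obtain C where C: "countable C" "C \<subseteq> U"
     "pairwise (\<lambda>i j. disjnt (cball i (r i)) (cball j (r j))) C"
     "U \<subseteq> (\<Union>i\<in>C. cball i (5 * r i))"
    by (rule Vitali_covering_lemma_cballs[where S=U and K=U and a="\<lambda>x. x" and r=r and B="enn2real W / (2 * c)"])
       (use r(1) bnd in \<open>auto simp: less_imp_le intro!: bexI\<close>)
  \<comment> \<open>The countable family is indexed by naturals and padded with empty sets:
    \<open>A\<close> holds the enlarged balls that cover, \<open>D\<close> the disjoint balls whose
    masses add up.\<close>
  define A where "A n = (if n \<in> to_nat_on C ` C then cball (from_nat_into C n) (5 * r (from_nat_into C n)) else {})" for n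
  define D where "D n = (if n \<in> to_nat_on C ` C then cball (from_nat_into C n) (r (from_nat_into C n)) else {})" for n
  have UA: "U \<subseteq> (\<Union>n. A n)"
  proof
    fix x assume "x \<in> U"
    then obtain i where "i \<in> C" "x \<in> cball i (5 * r i)" using C(4) by blast
    then have "x \<in> A (to_nat_on C i)" using C(1) by (auto simp: A_def)
    then show "x \<in> (\<Union>n. A n)" by blast
  qed
  have dis: "disjoint_family D"
  unfolding disjoint_family_on_def
  proof (intro ballI impI)
    fix m n :: nat assume mn: "m \<noteq> n"
    show "D m \<inter> D n = {}"
    proof (cases "m \<in> to_nat_on C ` C \<and> n \<in> to_nat_on C ` C")
      case True
      then obtain i j where "i \<in> C" "j \<in> C" "m = to_nat_on C i" "n = to_nat_on C j" by blast
      then show ?thesis using C(1,3) mn by (auto simp: D_def pairwise_def disjnt_def)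
    qed (auto simp: D_def)
  qed
  have [measurable, simp]: "A n \<in> sets borel" "D n \<in> sets borel" for n by (auto simp: A_def D_def)
  have AD: "ennreal c * emeasure lborel (A n) \<le> 5 * emeasure (density lborel w) (D n)" for n
  proof (cases "n \<in> to_nat_on C ` C")
    case True
    then obtain i where i: "i \<in> C" "n = to_nat_on C i" by blast
    then have iU: "i \<in> U" using C by auto
    have "ennreal c * emeasure lborel (A n) = 5 * ennreal (2 * r i * c)"
      using r(1)[OF iU] c True i C(1)
      by (simp add: A_def cball_eq_atLeastAtMost flip: ennreal_mult ennreal_numeral)
    also have "\<dots> \<le> 5 * (\<integral>\<^sup>+y\<in>cball i (r i). w y \<partial>lborel)"
      using r(2)[OF iU] by (intro mult_left_mono) auto
    also have "\<dots> = 5 * emeasure (density lborel w) (D n)"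
      using True i C(1) by (simp add: D_def emeasure_density)
    finally show ?thesis .
  qed (simp add: A_def)
  have "ennreal c * emeasure lborel U \<le> ennreal c * emeasure lborel (\<Union>n. A n)"
    using UA by (intro mult_left_mono emeasure_mono) auto
  also have "\<dots> \<le> ennreal c * (\<Sum>n. emeasure lborel (A n))"
    by (intro mult_left_mono emeasure_subadditive_countably) auto
  also have "\<dots> = (\<Sum>n. ennreal c * emeasure lborel (A n))" by simp
  also have "\<dots> \<le> (\<Sum>n. 5 * emeasure (density lborel w) (D n))"
    using AD by (intro suminf_le) auto
  also have "\<dots> = 5 * (\<Sum>n. emeasure (density lborel w) (D n))" by simp
  also have "(\<Sum>n. emeasure (density lborel w) (D n)) = emeasure (density lborel w) (\<Union>n. D n)"
    using dis by (intro suminf_emeasure) auto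
  also have "\<dots> = (\<integral>\<^sup>+y\<in>(\<Union>n. D n). w y \<partial>lborel)"
    by (intro emeasure_density) auto
  also have "\<dots> \<le> W" unfolding W_def by (intro nn_integral_mono) (auto split: split_indicator)
  finally show "ennreal c * emeasure lborel U \<le> 5 * (\<integral>\<^sup>+y. w y \<partial>lborel)"
    by (simp add: W_def mult_left_mono)
qed

text \<open>Layer-cake formula: the integrand is minus the derivative of s -> eta / (eta^2 + s^2),
  so the Cauchy kernel becomes a superposition of indicators of the intervals |x - y| \<le>
  s.\<close>

lemma nn_integral_cauchy_kernel_tail:
  fixes \<eta> t :: real assumes "\<eta> > 0" "t \<ge> 0"
  shows "(\<integral>\<^sup>+s\<in>{t..}. ennreal (2*\<eta>* s/(\<eta>^2+s^2)^2) \<partial>lborel) = ennreal (\<eta>/(\<eta>^2+t^2))"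
proof -
  have pos: "\<eta>^2+s^2 > 0" for s using assms by (simp add: add_pos_nonneg)
  have "(\<integral>\<^sup>+s. ennreal (2*\<eta>* s/(\<eta>^2+s^2)^2) * indicator {t..} s \<partial>lborel) = ennreal (0 - (- \<eta>/(\<eta>^2+t^2)))"
  proof (rule nn_integral_FTC_atLeast)
    show "((\<lambda>s. - \<eta>/(\<eta>^2+s^2)) has_real_derivative 2*\<eta>* s/(\<eta>^2+s^2)^2) (at s)" for s
      using pos[of s] by (auto intro!: derivative_eq_intros simp: power2_eq_square field_simps)
    show "0 \<le> 2*\<eta>* s/(\<eta>^2+s^2)^2" if "t \<le> s" for s using that assms by auto
    have "filterlim (\<lambda>s::real. \<eta>^2+s^2) at_top at_top"
      by (intro filterlim_tendsto_add_at_top[OF tendsto_const] filterlim_pow_at_top filterlim_ident) auto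
    then show "((\<lambda>s. - \<eta>/(\<eta>^2+s^2)) \<longlongrightarrow> 0) at_top"
      by (intro real_tendsto_divide_at_top[OF tendsto_const])
  qed auto
  then show ?thesis by simp
qed

text \<open>The weight 2 s is the length of the interval of radius s. Bounding s^2 by eta^2 + s^2
  reduces the integral to an arctangent, and the bound is uniform in eta.\<close>

lemma nn_integral_cauchy_kernel_le:
  fixes \<eta> :: real assumes "\<eta> > 0"
  shows "(\<integral>\<^sup>+s\<in>{0..}. ennreal (2*\<eta>* s/(\<eta>^2+s^2)^2) * ennreal (2* s) \<partial>lborel) \<le> ennreal (2*pi)"
proof -
  have pos: "\<eta>^2+s^2 > 0" for s using assms by (simp add: add_pos_nonneg)
  have le: "2*\<eta>* s/(\<eta>^2+s^2)^2 * (2* s) \<le> 4*(\<eta>/(\<eta>^2+s^2))" for s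
  proof -
    have "2*\<eta>* s/(\<eta>^2+s^2)^2 * (2* s) = 4*\<eta>* s^2/(\<eta>^2+s^2)^2" by (simp add: power2_eq_square)
    also have "\<dots> \<le> 4*\<eta>* (\<eta>^2+s^2)/(\<eta>^2+s^2)^2"
      using assms by (intro divide_right_mono mult_left_mono) auto
    also have "\<dots> = 4*(\<eta>/(\<eta>^2+s^2))" using pos[of s] by (simp add: power2_eq_square)
    finally show ?thesis .
  qed
  have "(\<integral>\<^sup>+s\<in>{0..}. ennreal (2*\<eta>* s/(\<eta>^2+s^2)^2) * ennreal (2* s) \<partial>lborel)
    \<le> (\<integral>\<^sup>+s. ennreal (4*(\<eta>/(\<eta>^2+s^2))) * indicator {0..} s \<partial>lborel)"
    using le assms by (intro nn_integral_mono) (auto split: split_indicator simp flip: ennreal_mult intro!: ennreal_leI)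
  also have "\<dots> = ennreal (4*(pi/2) - 4*arctan (0/\<eta>))"
  proof (rule nn_integral_FTC_atLeast)
    show "((\<lambda>s. 4*arctan (s/\<eta>)) has_real_derivative 4*(\<eta>/(\<eta>^2+s^2))) (at s)" for s
      using pos[of s] assms by (auto intro!: derivative_eq_intros simp: power2_eq_square field_simps)
    show "((\<lambda>s. 4*arctan (s/\<eta>)) \<longlongrightarrow> 4*(pi/2)) at_top"
      using assms
      by (intro tendsto_mult tendsto_const filterlim_compose[OF tendsto_arctan_at_top])
         (auto simp: divide_inverse intro!: filterlim_at_top_mult_tendsto_pos[OF tendsto_const] filterlim_ident)
  qed (use assms in auto)
  finally show ?thesis by simp
qed

text \<open>A radially decreasing kernel is controlled by averages over centred intervals: after the
  layer-cake formula and Tonelli, the inner integral over |x - y| \<le> s is at most 2 s c.\<close>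

lemma cauchy_kernel_maximal:
  fixes w :: "real \<Rightarrow> ennreal" and c \<eta> x :: real
  assumes [measurable]: "w \<in> borel_measurable borel" and \<eta>: "\<eta> > 0" and c: "c \<ge> 0"
    and av: "\<And>e. e > 0 \<Longrightarrow> (\<integral>\<^sup>+y\<in>cball x e. w y \<partial>lborel) \<le> ennreal (2 * e * c)"
  shows "(\<integral>\<^sup>+y. w y * ennreal (\<eta>/(\<eta>^2+(x-y)^2)) \<partial>lborel) \<le> ennreal (2*pi*c)"
proof -
  let ?k = "\<lambda>s. ennreal (2*\<eta>* s/(\<eta>^2+s^2)^2)"
  have "(\<integral>\<^sup>+y. w y * ennreal (\<eta>/(\<eta>^2+(x-y)^2)) \<partial>lborel)
    = (\<integral>\<^sup>+y. w y * (\<integral>\<^sup>+s\<in>{\<bar>x-y\<bar>..}. ?k s \<partial>lborel) \<partial>lborel)"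
    using \<eta> by (simp add: nn_integral_cauchy_kernel_tail)
  also have "\<dots> = (\<integral>\<^sup>+y. (\<integral>\<^sup>+s. w y * (?k s * indicator {\<bar>x-y\<bar>..} s) \<partial>lborel) \<partial>lborel)"
    by (simp add: nn_integral_cmult)
  also have "\<dots> = (\<integral>\<^sup>+y. (\<integral>\<^sup>+s. w y * (?k s * (if \<bar>x-y\<bar> \<le> s then 1 else 0)) \<partial>lborel) \<partial>lborel)"
    by (intro nn_integral_cong) (auto split: split_indicator)
  also have "\<dots> = (\<integral>\<^sup>+s. (\<integral>\<^sup>+y. w y * (?k s * (if \<bar>x-y\<bar> \<le> s then 1 else 0)) \<partial>lborel) \<partial>lborel)"
    by (rule lborel_pair.Fubini') measurable
  also have "\<dots> = (\<integral>\<^sup>+s. ?k s * (\<integral>\<^sup>+y. w y * (if \<bar>x-y\<bar> \<le> s then 1 else 0) \<partial>lborel) \<partial>lborel)"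
    by (subst nn_integral_cmult[symmetric]) (auto intro!: nn_integral_cong simp: mult_ac)
  also have "\<dots> \<le> (\<integral>\<^sup>+s. ennreal c * (?k s * ennreal (2* s) * indicator {0..} s) \<partial>lborel)"
  proof (intro nn_integral_mono)
    fix s :: real
    consider "s < 0" | "s = 0" | "s > 0" by linarith
    then show "?k s * (\<integral>\<^sup>+y. w y * (if \<bar>x-y\<bar> \<le> s then 1 else 0) \<partial>lborel)
      \<le> ennreal c * (?k s * ennreal (2* s) * indicator {0..} s)"
    proof cases
      case 1
      \<comment> \<open>For negative s the weight is nonpositive, so \<open>ennreal\<close> sends it
        to 0 and the half-line s < 0 contributes nothing.\<close>
      then have "2*\<eta>* s/(\<eta>^2+s^2)^2 \<le> 0" using \<eta> by (intro divide_nonpos_nonneg) (auto simp: mult_le_0_iff)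
      then show ?thesis by (simp add: ennreal_neg)
    next
      case 3
      have "(\<integral>\<^sup>+y. w y * (if \<bar>x-y\<bar> \<le> s then 1 else 0) \<partial>lborel) = (\<integral>\<^sup>+y\<in>cball x s. w y \<partial>lborel)"
        by (intro nn_integral_cong) (auto split: split_indicator simp: dist_real_def)
      also have "\<dots> \<le> ennreal (2* s*c)" using av 3 by simp
      also have "\<dots> = ennreal c * ennreal (2* s)" using 3 c by (simp add: mult_ac flip: ennreal_mult)
      finally have "?k s * (\<integral>\<^sup>+y. w y * (if \<bar>x-y\<bar> \<le> s then 1 else 0) \<partial>lborel) \<le> ?k s * (ennreal c * ennreal (2* s))"
        by (intro mult_left_mono) auto
      then show ?thesis using 3 by (simp add: mult_ac)
    qed auto
  qed
  also have "\<dots> = ennreal c * (\<integral>\<^sup>+s\<in>{0..}. ?k s * ennreal (2* s) \<partial>lborel)"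
    by (subst nn_integral_cmult) auto
  also have "\<dots> \<le> ennreal c * ennreal (2*pi)"
    using nn_integral_cauchy_kernel_le[OF \<eta>] by (intro mult_left_mono) auto
  also have "\<dots> = ennreal (2*pi*c)" using c by (simp add: mult_ac flip: ennreal_mult)
  finally show ?thesis .
qed

section \<open>Fatou's theorem for Poisson integrals\<close>

text \<open>The notion \<open>measurable_on\<close> supplies continuous functions converging almost
  everywhere, but no dominating function. So h is truncated at a height m, the approximants are
  truncated at the same height, and dominated convergence gives convergence in L^1.\<close>

lemma continuous_dense_L1_circle:
  fixes h :: "real \<Rightarrow> real"
  assumes h: "integrable circle h" and e: "e > 0"
  obtains g where "continuous_on UNIV g" "(\<integral>x. \<bar>h x - g x\<bar> \<partial>circle) < e"
proof -
  define clip where "clip m x = max (- real m) (min (real m) x)" for m and x :: real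
  have clip_le: "\<bar>clip m x\<bar> \<le> real m" for m x by (auto simp: clip_def)
  have [measurable]: "h \<in> borel_measurable circle" using h by auto
  have "(\<lambda>m. \<integral>x. \<bar>h x - clip m (h x)\<bar> \<partial>circle) \<longlonglongrightarrow> (\<integral>x. 0 \<partial>circle)"
  proof (rule integral_dominated_convergence)
    show "integrable circle (\<lambda>x. 2 * \<bar>h x\<bar>)" using h by auto
    show "(\<lambda>x. \<bar>h x - clip m (h x)\<bar>) \<in> borel_measurable circle" for m unfolding clip_def by measurable
    show "AE x in circle. norm \<bar>h x - clip m (h x)\<bar> \<le> 2 * \<bar>h x\<bar>" for m
      by (intro AE_I2) (auto simp: clip_def)
    show "AE x in circle. (\<lambda>m. \<bar>h x - clip m (h x)\<bar>) \<longlonglongrightarrow> 0"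
    proof (rule AE_I2)
      fix x
      obtain m0 :: nat where "\<bar>h x\<bar> \<le> real m0" using real_arch_simple by blast
      then have "\<forall>m\<ge>m0. \<bar>h x - clip m (h x)\<bar> = 0" by (auto simp: clip_def)
      then show "(\<lambda>m. \<bar>h x - clip m (h x)\<bar>) \<longlonglongrightarrow> 0"
        by (intro tendsto_eventually) (auto simp: eventually_sequentially)
    qed
  qed auto
  then have "\<forall>\<^sub>F m in sequentially. (\<integral>x. \<bar>h x - clip m (h x)\<bar> \<partial>circle) < e/2"
    using e by (intro order_tendstoD(2)) auto
  then obtain m where m: "(\<integral>x. \<bar>h x - clip m (h x)\<bar> \<partial>circle) < e/2"
    using eventually_happens'[OF sequentially_bot] by blast
  define H where "H x = indicator {0..2*pi} x * h x" for x
  have H[measurable]: "H \<in> borel_measurable borel"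
    using h unfolding H_def integrable_circle_iff set_integrable_def by (auto dest: borel_measurable_integrable)
  then have "H measurable_on UNIV"
    by (intro lebesgue_measurable_imp_measurable_on) (auto simp: measurable_completion)
  then obtain N g where N: "negligible N" and g: "\<And>n. continuous_on UNIV (g n)"
    and lim: "\<And>x. x \<notin> N \<Longrightarrow> (\<lambda>n. g n x) \<longlonglongrightarrow> H x"
    unfolding measurable_on_def by auto
  have [measurable]: "g n \<in> borel_measurable borel" for n using g by (rule borel_measurable_continuous_onI)
  have AElim: "AE x in circle. (\<lambda>n. g n x) \<longlonglongrightarrow> h x"
  proof -
    have "AE x in lebesgue. x \<notin> N" using N by (simp add: negligible_iff_null_sets AE_not_in)
    then have "AE x in lborel. x \<notin> N" by (simp add: AE_completion_iff)
    then show ?thesis unfolding AE_circle_iff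
      by eventually_elim (use lim in \<open>force simp: H_def\<close>)
  qed
  have "(\<lambda>n. \<integral>x. \<bar>clip m (h x) - clip m (g n x)\<bar> \<partial>circle) \<longlonglongrightarrow> (\<integral>x. 0 \<partial>circle)"
  proof (rule integral_dominated_convergence)
    show "integrable circle (\<lambda>x. 2 * real m)" by auto
    show "(\<lambda>x. \<bar>clip m (h x) - clip m (g n x)\<bar>) \<in> borel_measurable circle" for n
    proof -
      have [measurable]: "g n \<in> borel_measurable circle" by (intro measurable_circleI) auto
      show ?thesis unfolding clip_def by measurable
    qed
    show "AE x in circle. norm \<bar>clip m (h x) - clip m (g n x)\<bar> \<le> 2 * real m" for n
      by (intro AE_I2) (use clip_le[of m] in \<open>smt (verit) real_norm_def\<close>)
    show "AE x in circle. (\<lambda>n. \<bar>clip m (h x) - clip m (g n x)\<bar>) \<longlonglongrightarrow> 0"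
      using AElim
    proof eventually_elim
      case (elim x)
      then have "(\<lambda>n. \<bar>clip m (h x) - clip m (g n x)\<bar>) \<longlonglongrightarrow> \<bar>clip m (h x) - clip m (h x)\<bar>"
        unfolding clip_def by (intro tendsto_intros tendsto_max tendsto_min)
      then show ?case by simp
    qed
  qed auto
  then have "\<forall>\<^sub>F n in sequentially. (\<integral>x. \<bar>clip m (h x) - clip m (g n x)\<bar> \<partial>circle) < e/2"
    using e by (intro order_tendstoD(2)) auto
  then obtain n where n: "(\<integral>x. \<bar>clip m (h x) - clip m (g n x)\<bar> \<partial>circle) < e/2"
    using eventually_happens'[OF sequentially_bot] by blast
  have cont: "continuous_on UNIV (\<lambda>x. clip m (g n x))"
    unfolding clip_def using g by (intro continuous_intros)
  have i1: "integrable circle (\<lambda>x. clip m (h x))"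
    by (rule circle.integrable_const_bound[of _ "real m"]) (use clip_le[of m] in \<open>auto simp: clip_def\<close>)
  have i2: "integrable circle (\<lambda>x. clip m (g n x))"
    using cont by (intro integrable_circle_continuous) (auto intro: continuous_on_subset)
  have "(\<integral>x. \<bar>h x - clip m (g n x)\<bar> \<partial>circle)
     \<le> (\<integral>x. \<bar>h x - clip m (h x)\<bar> + \<bar>clip m (h x) - clip m (g n x)\<bar> \<partial>circle)"
    using h i1 i2 by (intro integral_mono) auto
  also have "\<dots> = (\<integral>x. \<bar>h x - clip m (h x)\<bar> \<partial>circle) + (\<integral>x. \<bar>clip m (h x) - clip m (g n x)\<bar> \<partial>circle)"
    using h i1 i2 by (intro Bochner_Integration.integral_add) auto
  also have "\<dots> < e" using m n by simp
  finally show ?thesis using cont that by blast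
qed

section \<open>Estimates for the Poisson kernel near the boundary\<close>

lemma norm_cis_diff_sq:
  "(cmod (cis \<phi> - of_real r * cis \<theta>))\<^sup>2 = (1-r)\<^sup>2 + 4 * r * (sin ((\<theta>-\<phi>)/2))\<^sup>2"
proof -
  have "(cmod (cis \<phi> - of_real r * cis \<theta>))\<^sup>2 = (cos \<phi> - r * cos \<theta>)\<^sup>2 + (sin \<phi> - r * sin \<theta>)\<^sup>2"
    by (simp add: cmod_power2)
  also have "\<dots> = ((cos \<phi>)\<^sup>2 + (sin \<phi>)\<^sup>2) + r\<^sup>2 * ((cos \<theta>)\<^sup>2 + (sin \<theta>)\<^sup>2) - 2 * r * (cos \<theta> * cos \<phi> + sin \<theta> * sin \<phi>)"
    unfolding power2_eq_square by (simp only: algebra_simps)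
  also have "\<dots> = 1 + r\<^sup>2 - 2 * r * cos (\<theta> - \<phi>)" by (simp add: cos_diff)
  also have "cos (\<theta> - \<phi>) = 1 - 2 * (sin ((\<theta>-\<phi>)/2))\<^sup>2"
    using cos_double_sin[of "(\<theta>-\<phi>)/2"] by (metis field_sum_of_halves mult_2)
  finally show ?thesis by (simp add: power2_eq_square algebra_simps)
qed

text \<open>The quotient sin (t/2) / t extends continuously to 0 and has no zero for |t| \<le> 2 pi
  - \<delta>, so compactness bounds its square from below. The margin \<delta> keeps t away from the
  zeros of sin (t/2) at 2 pi and -2 pi.\<close>

lemma sin_half_lower_bound:
  fixes \<delta> :: real assumes "0 < \<delta>" "\<delta> \<le> pi"
  obtains c where "c > 0" "c \<le> 1" "\<And>t. \<bar>t\<bar> \<le> 2*pi - \<delta> \<Longrightarrow> c * t\<^sup>2 \<le> (sin (t/2))\<^sup>2"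
proof -
  define f where "f t = (if t = 0 then 1/2 else sin (t/2) / t)" for t :: real
  have cf: "continuous_on UNIV f"
  proof -
    have "isCont f t" for t
    proof (cases "t = 0")
      case True
      have "((\<lambda>t::real. sin (t/2)) has_real_derivative 1/2) (at 0)"
        by (auto intro!: derivative_eq_intros)
      then have "((\<lambda>t::real. sin (t/2) / t) \<longlongrightarrow> 1/2) (at 0)"
        by (simp add: DERIV_def)
      then have "(f \<longlongrightarrow> 1/2) (at 0)"
        by (rule Lim_transform_eventually) (auto simp: f_def eventually_at intro!: exI[of _ 1])
      then show ?thesis using True by (simp add: isCont_def f_def)
    next
      case False
      have "\<forall>\<^sub>F s in nhds t. f s = sin (s/2) / s"
        using False by (auto simp: f_def intro!: eventually_mono[OF t1_space_nhds[of t 0]])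
      moreover have "isCont (\<lambda>s. sin (s/2) / s) t" using False by (intro continuous_intros) auto
      ultimately show ?thesis by (simp add: isCont_cong)
    qed
    then show ?thesis by (simp add: continuous_on_eq_continuous_at)
  qed
  have f0: "f t \<noteq> 0" if "\<bar>t\<bar> \<le> 2*pi - \<delta>" for t
  proof (cases "t = 0")
    case False
    have "sin (\<bar>t\<bar>/2) > 0" using False that assms by (intro sin_gt_zero) auto
    then have "sin (t/2) \<noteq> 0" by (cases "t \<ge> 0") auto
    then show ?thesis using False by (simp add: f_def)
  qed (simp add: f_def)
  have "\<exists>x\<in>cball 0 (2*pi-\<delta>). \<forall>y\<in>cball 0 (2*pi-\<delta>). (f x)\<^sup>2 \<le> (f y)\<^sup>2"
    using assms cf by (intro continuous_attains_inf continuous_intros) (auto intro: continuous_on_subset)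
  then obtain x where x: "\<bar>x\<bar> \<le> 2*pi - \<delta>" "\<And>y. \<bar>y\<bar> \<le> 2*pi-\<delta> \<Longrightarrow> (f x)\<^sup>2 \<le> (f y)\<^sup>2"
    by auto
  show ?thesis
  proof
    show "(f x)\<^sup>2 > 0" using f0[OF x(1)] by simp
    have "(f x)\<^sup>2 \<le> (f 0)\<^sup>2" using assms by (intro x) (use pi_gt_zero in linarith)
    then show "(f x)\<^sup>2 \<le> 1" by (simp add: f_def power2_eq_square)
    fix t :: real assume t: "\<bar>t\<bar> \<le> 2*pi - \<delta>"
    show "(f x)\<^sup>2 * t\<^sup>2 \<le> (sin (t/2))\<^sup>2"
      using mult_right_mono[OF x(2)[OF t], of "t\<^sup>2"] by (auto simp: f_def power_divide split: if_splits)
  qed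
qed

text \<open>For an angle strictly inside the interval, \<theta> - \<phi> stays away from the
  wrap-around values 2 pi and -2 pi. There the periodic kernel is dominated by the Cauchy kernel on
  the line at height 1 - r, with a constant depending on \<theta>.\<close>

lemma poisson_kernel_bound:
  assumes "0 < \<theta>" "\<theta> < 2*pi"
  obtains C where "C > 0" "\<And>r \<phi>. 1/2 \<le> r \<Longrightarrow> r < 1 \<Longrightarrow> \<phi> \<in> {0..2*pi} \<Longrightarrow>
     poisson_kernel (of_real r * cis \<theta>) \<phi> \<le> C * ((1-r) / ((1-r)\<^sup>2 + (\<theta>-\<phi>)\<^sup>2))"
proof -
  define \<delta> where "\<delta> = min \<theta> (2*pi-\<theta>)"
  have \<delta>: "0 < \<delta>" "\<delta> \<le> pi" using assms by (auto simp: \<delta>_def min_def)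
  obtain c where c: "c > 0" "c \<le> 1" "\<And>t. \<bar>t\<bar> \<le> 2*pi - \<delta> \<Longrightarrow> c * t\<^sup>2 \<le> (sin (t/2))\<^sup>2"
    using sin_half_lower_bound[OF \<delta>] by blast
  show ?thesis
  proof
    show "2/c > 0" using c by simp
    fix r \<phi> :: real assume r: "1/2 \<le> r" "r < 1" and \<phi>: "\<phi> \<in> {0..2*pi}"
    have "\<bar>\<theta>-\<phi>\<bar> \<le> 2*pi - \<delta>" using \<phi> assms by (auto simp: \<delta>_def min_def)
    then have s: "c * (\<theta>-\<phi>)\<^sup>2 \<le> (sin ((\<theta>-\<phi>)/2))\<^sup>2" by (rule c)
    have "c * ((1-r)\<^sup>2 + (\<theta>-\<phi>)\<^sup>2) \<le> (1-r)\<^sup>2 + 1 * (sin ((\<theta>-\<phi>)/2))\<^sup>2"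
      using s c by (simp add: algebra_simps mult_left_le_one_le add_mono)
    also have "\<dots> \<le> (1-r)\<^sup>2 + (4*r) * (sin ((\<theta>-\<phi>)/2))\<^sup>2"
      using r by (intro add_left_mono mult_right_mono) auto
    also have "\<dots> = (cmod (cis \<phi> - of_real r * cis \<theta>))\<^sup>2" by (simp add: norm_cis_diff_sq)
    finally have d: "c * ((1-r)\<^sup>2 + (\<theta>-\<phi>)\<^sup>2) \<le> (cmod (cis \<phi> - of_real r * cis \<theta>))\<^sup>2" .
    have p: "(1-r)\<^sup>2 + (\<theta>-\<phi>)\<^sup>2 > 0" using r by (intro add_pos_nonneg) auto
    have "poisson_kernel (of_real r * cis \<theta>) \<phi> = (1-r)*(1+r) / (cmod (cis \<phi> - of_real r * cis \<theta>))\<^sup>2"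
      by (simp add: poisson_kernel_def norm_mult power2_eq_square algebra_simps)
    also have "\<dots> \<le> (1-r)*2 / (c * ((1-r)\<^sup>2 + (\<theta>-\<phi>)\<^sup>2))"
      using d p c r by (intro frac_le mult_left_mono mult_nonneg_nonneg) auto
    finally show "poisson_kernel (of_real r * cis \<theta>) \<phi> \<le> 2/c * ((1-r) / ((1-r)\<^sup>2 + (\<theta>-\<phi>)\<^sup>2))"
      by (simp add: field_simps)
  qed
qed

text \<open>Approximate-identity argument. The function g is continuous on the line and may take
  different values at 0 and 2 pi, which is why the angle is interior.\<close>

lemma poisson_tendsto_continuous:
  assumes g: "continuous_on UNIV g" and \<theta>: "0 < \<theta>" "\<theta> < 2*pi"
  shows "((\<lambda>r. poisson g (of_real r * cis \<theta>)) \<longlongrightarrow> g \<theta>) (at_left 1)"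
proof (rule tendstoI)
  fix e :: real assume e: "e > 0"
  obtain C where C: "C > 0" "\<And>r \<phi>. 1/2 \<le> r \<Longrightarrow> r < 1 \<Longrightarrow> \<phi> \<in> {0..2*pi} \<Longrightarrow>
     poisson_kernel (of_real r * cis \<theta>) \<phi> \<le> C * ((1-r) / ((1-r)\<^sup>2 + (\<theta>-\<phi>)\<^sup>2))"
    using poisson_kernel_bound[OF \<theta>] by blast
  obtain d where d: "d > 0" "\<And>\<phi>. \<bar>\<phi>-\<theta>\<bar> < d \<Longrightarrow> \<bar>g \<phi> - g \<theta>\<bar> < e/2"
    using g e unfolding continuous_on_iff dist_real_def by (metis UNIV_I half_gt_zero)
  have "bounded (g ` {0..2*pi})"
    using g by (intro compact_imp_bounded compact_continuous_image) (auto intro: continuous_on_subset)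
  then obtain B where B: "\<And>\<phi>. \<phi> \<in> {0..2*pi} \<Longrightarrow> \<bar>g \<phi>\<bar> \<le> B" unfolding bounded_iff real_norm_def by blast
  have B0: "B \<ge> 0" using B[of \<theta>] \<theta> by auto
  \<comment> \<open>Away from \<theta> the kernel is at most C (1 - r) / d^2, and g differs from
    \<open>g \<theta>\<close> by at most 2 B.\<close>
  define D where "D = 2 * B * C / d\<^sup>2"
  have D: "D \<ge> 0" using B0 C d by (auto simp: D_def)
  have main: "\<bar>poisson g (of_real r * cis \<theta>) - g \<theta>\<bar> \<le> e/2 + (1-r) * D" if r: "1/2 \<le> r" "r < 1" for r
  proof -
    define z where "z = of_real r * cis \<theta>"
    have z: "cmod z < 1" using r by (simp add: z_def norm_mult)
    have gi: "integrable circle (\<lambda>\<phi>. poisson_kernel z \<phi> * g \<phi>)"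
      using g by (intro integrable_circle_continuous continuous_on_mult continuous_on_poisson_kernel[OF z])
        (auto intro: continuous_on_subset)
    have gt: "integrable circle (\<lambda>\<phi>. poisson_kernel z \<phi> * c)" for c
      by (intro integrable_circle_continuous continuous_on_mult continuous_on_poisson_kernel[OF z]) auto
    have "poisson g z - g \<theta> = poisson g z - poisson (\<lambda>_. g \<theta>) z" using z by (simp add: poisson_const)
    also have "\<dots> = (\<integral>\<phi>. poisson_kernel z \<phi> * (g \<phi> - g \<theta>) \<partial>circle) / (2*pi)"
      using gi gt by (simp add: poisson_def diff_divide_distrib right_diff_distrib)
    finally have "\<bar>poisson g z - g \<theta>\<bar> = \<bar>\<integral>\<phi>. poisson_kernel z \<phi> * (g \<phi> - g \<theta>) \<partial>circle\<bar> / (2*pi)" by simp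
    also have "\<dots> \<le> (\<integral>\<phi>. poisson_kernel z \<phi> * (e/2) + (1-r) * D \<partial>circle) / (2*pi)"
    proof (intro divide_right_mono)
      have "\<bar>\<integral>\<phi>. poisson_kernel z \<phi> * (g \<phi> - g \<theta>) \<partial>circle\<bar> \<le> (\<integral>\<phi>. \<bar>poisson_kernel z \<phi> * (g \<phi> - g \<theta>)\<bar> \<partial>circle)"
        by (rule integral_abs_bound)
      also have "\<dots> \<le> (\<integral>\<phi>. poisson_kernel z \<phi> * (e/2) + (1-r) * D \<partial>circle)"
      proof (intro integral_mono)
        show "integrable circle (\<lambda>\<phi>. \<bar>poisson_kernel z \<phi> * (g \<phi> - g \<theta>)\<bar>)"
          using gi gt by (intro integrable_abs) (auto simp: right_diff_distrib)
        show "integrable circle (\<lambda>\<phi>. poisson_kernel z \<phi> * (e/2) + (1-r) * D)" using gt by auto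
        fix \<phi> assume "\<phi> \<in> space circle"
        then have \<phi>: "\<phi> \<in> {0..2*pi}" by (simp add: space_restrict_space)
        have p0: "0 \<le> poisson_kernel z \<phi>" using z by (rule poisson_kernel_nonneg)
        show "\<bar>poisson_kernel z \<phi> * (g \<phi> - g \<theta>)\<bar> \<le> poisson_kernel z \<phi> * (e/2) + (1-r) * D"
        proof (cases "\<bar>\<phi>-\<theta>\<bar> < d")
          case True
          then have "poisson_kernel z \<phi> * \<bar>g \<phi> - g \<theta>\<bar> \<le> poisson_kernel z \<phi> * (e/2)"
            using d(2) p0 by (intro mult_left_mono) (auto simp: less_imp_le)
          also have "\<dots> \<le> poisson_kernel z \<phi> * (e/2) + (1-r) * D" using D r by simp
          finally show ?thesis using p0 by (simp add: abs_mult)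
        next
          case False
          have "d\<^sup>2 \<le> (\<theta>-\<phi>)\<^sup>2" using False d(1) by (auto simp: abs_le_square_iff[symmetric])
          then have dd: "d\<^sup>2 \<le> (1-r)\<^sup>2 + (\<theta>-\<phi>)\<^sup>2" by (simp add: add_increasing)
          have "poisson_kernel z \<phi> \<le> C * ((1-r) / ((1-r)\<^sup>2 + (\<theta>-\<phi>)\<^sup>2))"
            using C(2) r \<phi> by (simp add: z_def)
          also have "\<dots> \<le> C * ((1-r) / d\<^sup>2)"
            using C(1) r d(1) dd by (intro mult_left_mono divide_left_mono mult_pos_pos) (auto intro: add_pos_nonneg)
          finally have pk: "poisson_kernel z \<phi> \<le> C * ((1-r) / d\<^sup>2)" .
          have "\<bar>g \<phi> - g \<theta>\<bar> \<le> 2 * B" using B[OF \<phi>] B[of \<theta>] \<theta> by auto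
          then have "poisson_kernel z \<phi> * \<bar>g \<phi> - g \<theta>\<bar> \<le> C * ((1-r) / d\<^sup>2) * (2*B)"
            using pk p0 C r by (intro mult_mono) auto
          also have "\<dots> = (1-r) * D" by (simp add: D_def)
          also have "\<dots> \<le> poisson_kernel z \<phi> * (e/2) + (1-r) * D" using p0 e by simp
          finally show ?thesis using p0 by (simp add: abs_mult)
        qed
      qed
      finally show "\<bar>\<integral>\<phi>. poisson_kernel z \<phi> * (g \<phi> - g \<theta>) \<partial>circle\<bar> \<le> \<dots>" .
    qed auto
    also have "\<dots> = poisson (\<lambda>_. e/2) z + (\<integral>\<phi>. (1-r) * D \<partial>circle) / (2*pi)"
      using gt by (subst Bochner_Integration.integral_add) (auto simp: poisson_def add_divide_distrib)
    also have "\<dots> = e/2 + (1-r) * D"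
      using z by (simp add: poisson_const measure_circle space_restrict_space)
    finally show ?thesis by (simp add: z_def)
  qed
  have "((\<lambda>r. e/2 + (1-r) * D) \<longlongrightarrow> e/2 + (1-1) * D) (at_left 1)" by (intro tendsto_intros)
  then have ev: "\<forall>\<^sub>F r in at_left 1. e/2 + (1-r) * D < e" using e by (intro order_tendstoD(2)[where y="e/2 + (1-1) * D"]) auto
  have "\<forall>\<^sub>F r in at_left (1::real). 1/2 \<le> r \<and> r < 1"
    by (auto simp: eventually_at_left_field intro!: exI[of _ "1/2"])
  with ev show "\<forall>\<^sub>F r in at_left 1. dist (poisson g (of_real r * cis \<theta>)) (g \<theta>) < e"
    by eventually_elim (use main in \<open>force simp: dist_real_def\<close>)
qed

text \<open>Approximate h in L^1 with errors 4^(-n). The maximal inequality at height 2^(-n) gives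
  exceptional sets of measure at most 5 * 2^(-n); these are summable, so by Borel-Cantelli almost
  every angle lies in only finitely many. Off the n-th set the Poisson integrals of h and of its
  approximant differ by at most C 2^(-n), uniformly for radii in [1/2, 1).\<close>

theorem fatou_poisson:
  assumes h: "integrable circle h"
  shows "AE \<theta> in circle. ((\<lambda>r. poisson h (of_real r * cis \<theta>)) \<longlongrightarrow> h \<theta>) (at_left 1)"
proof -
  have "\<exists>g. continuous_on UNIV g \<and> (\<integral>x. \<bar>h x - g x\<bar> \<partial>circle) < (1/4)^n" for n :: nat
    using continuous_dense_L1_circle[OF h, of "(1/4)^n"] by (metis zero_less_divide_1_iff zero_less_numeral zero_less_power)
  then obtain g where gc: "\<And>n. continuous_on UNIV (g n)" and g: "\<And>n. (\<integral>x. \<bar>h x - g n x\<bar> \<partial>circle) < (1/4)^n"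
    by metis
  have gi: "integrable circle (g n)" for n
    using gc by (intro integrable_circle_continuous) (auto intro: continuous_on_subset)
  define w where "w n x = ennreal (indicator {0..2*pi} x * \<bar>h x - g n x\<bar>)" for n x
  have hg: "integrable lborel (\<lambda>x. indicator {0..2*pi} x * \<bar>h x - g n x\<bar>)" for n
  proof -
    have "integrable circle (\<lambda>x. \<bar>h x - g n x\<bar>)" using h gi by auto
    then show ?thesis by (simp add: integrable_circle_iff set_integrable_def)
  qed
  have [measurable]: "w n \<in> borel_measurable borel" for n
    unfolding w_def using borel_measurable_integrable[OF hg] by measurable
  have W: "(\<integral>\<^sup>+x. w n x \<partial>lborel) \<le> ennreal ((1/4)^n)" for n
  proof -
    have "(\<integral>\<^sup>+x. w n x \<partial>lborel) = ennreal (\<integral>x. indicator {0..2*pi} x * \<bar>h x - g n x\<bar> \<partial>lborel)"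
      unfolding w_def by (intro nn_integral_eq_integral hg) auto
    also have "\<dots> \<le> ennreal ((1/4)^n)"
      using g[of n] by (intro ennreal_leI) (simp add: integral_circle_eq set_lebesgue_integral_def)
    finally show ?thesis .
  qed
  define U where "U n = {x. \<exists>e>0. ennreal (2 * e * (1/2)^n) < (\<integral>\<^sup>+y\<in>cball x e. w n y \<partial>lborel)}" for n
  have Wfin: "(\<integral>\<^sup>+x. w n x \<partial>lborel) < \<infinity>" for n using W[of n] by (simp add: le_less_trans)
  have Uo: "open (U n)" for n
    unfolding U_def using Wfin by (intro maximal_weak_type) auto
  have Um: "emeasure lborel (U n) \<le> ennreal (5 * (1/2)^n)" for n
  proof -
    have "ennreal ((1/2)^n) * emeasure lborel (U n) \<le> 5 * (\<integral>\<^sup>+x. w n x \<partial>lborel)"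
      unfolding U_def using Wfin by (intro maximal_weak_type) auto
    also have "\<dots> \<le> 5 * ennreal ((1/4)^n)" using W by (intro mult_left_mono) auto
    also have "\<dots> = ennreal ((1/2)^n) * ennreal (5 * (1/2)^n)"
      by (simp add: power_mult_distrib[symmetric] flip: ennreal_mult ennreal_numeral)
    finally show ?thesis
      by (subst (asm) ennreal_mult_le_mult_iff) auto
  qed
  have "AE x in lborel. \<forall>\<^sub>F n in sequentially. x \<in> space lborel - U n"
  proof (rule borel_cantelli_AE1)
    show "U n \<in> sets lborel" for n using Uo by auto
    show "emeasure lborel (U n) < \<infinity>" for n using Um[of n] by (simp add: le_less_trans)
    have "measure lborel (U n) \<le> 5 * (1/2)^n" for n
      using Um[of n] by (simp add: measure_def enn2real_leI)
    moreover have "summable (\<lambda>n. 5 * (1/2::real)^n)" by (intro summable_mult summable_geometric) auto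
    ultimately show "summable (\<lambda>n. measure lborel (U n))"
      by (rule_tac summable_comparison_test'[where g="\<lambda>n. 5 * (1/2)^n" and N=0]) simp_all
  qed
  then have AU: "AE x in circle. \<forall>\<^sub>F n in sequentially. x \<notin> U n"
    unfolding AE_circle_iff by eventually_elim auto
  have "(\<lambda>n. \<integral>x. norm (g n x - h x) \<partial>circle) \<longlonglongrightarrow> 0"
  proof (rule Lim_null_comparison)
    show "\<forall>\<^sub>F n in sequentially. norm (\<integral>x. norm (g n x - h x) \<partial>circle) \<le> (1/4)^n"
      using g by (intro always_eventually allI) (simp add: abs_minus_commute less_imp_le)
    show "(\<lambda>n. (1/4::real)^n) \<longlonglongrightarrow> 0" by (rule LIMSEQ_power_zero) auto
  qed
  \<comment> \<open>Convergence in L^1 gives pointwise convergence almost everywhere only along a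
    subsequence. That suffices, as one good index per e is all that is used at the end.\<close>
  then obtain s where s: "strict_mono s" and As: "AE x in circle. (\<lambda>n. g (s n) x - h x) \<longlonglongrightarrow> 0"
    using tendsto_L1_AE_subseq[of circle "\<lambda>n x. g n x - h x"] h gi by auto
  have Ae: "AE \<theta> in circle. \<theta> \<noteq> 0 \<and> \<theta> \<noteq> 2*pi"
    unfolding AE_circle_iff using AE_lborel_singleton[of 0] AE_lborel_singleton[of "2*pi"] by eventually_elim auto
  have Asp: "AE \<theta> in circle. \<theta> \<in> {0..2*pi}" unfolding AE_circle_iff by simp
  show ?thesis using AU As Ae Asp
  proof eventually_elim
    case (elim \<theta>)
    then have \<theta>: "0 < \<theta>" "\<theta> < 2*pi" by auto
    obtain C where C: "C > 0" "\<And>r \<phi>. 1/2 \<le> r \<Longrightarrow> r < 1 \<Longrightarrow> \<phi> \<in> {0..2*pi} \<Longrightarrow>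
       poisson_kernel (of_real r * cis \<theta>) \<phi> \<le> C * ((1-r) / ((1-r)\<^sup>2 + (\<theta>-\<phi>)\<^sup>2))"
      using poisson_kernel_bound[OF \<theta>] by blast
    have main: "\<bar>poisson h (of_real r * cis \<theta>) - poisson (g n) (of_real r * cis \<theta>)\<bar> \<le> C * (1/2)^n"
      if n: "\<theta> \<notin> U n" and r: "1/2 \<le> r" "r < 1" for n r
    proof -
      define z where "z = of_real r * cis \<theta>"
      have z: "cmod z < 1" using r by (simp add: z_def norm_mult)
      have pk: "integrable circle (\<lambda>\<phi>. poisson_kernel z \<phi> * k \<phi>)" if "integrable circle k" for k
        using that by (intro integrable_circle_mult_real continuous_on_poisson_kernel[OF z])
      have i: "integrable circle (\<lambda>\<phi>. poisson_kernel z \<phi> * (h \<phi> - g n \<phi>))" using h gi by (intro pk) auto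
      have "poisson h z - poisson (g n) z = (\<integral>\<phi>. poisson_kernel z \<phi> * (h \<phi> - g n \<phi>) \<partial>circle) / (2*pi)"
        using pk[OF h] pk[OF gi[of n]] by (simp add: poisson_def diff_divide_distrib right_diff_distrib)
      then have "\<bar>poisson h z - poisson (g n) z\<bar> = \<bar>\<integral>\<phi>. poisson_kernel z \<phi> * (h \<phi> - g n \<phi>) \<partial>circle\<bar> / (2*pi)" by simp
      also have "\<dots> \<le> (\<integral>\<phi>. \<bar>poisson_kernel z \<phi> * (h \<phi> - g n \<phi>)\<bar> \<partial>circle) / (2*pi)"
        by (intro divide_right_mono integral_abs_bound) auto
      also have "\<dots> \<le> C * (2*pi*(1/2)^n) / (2*pi)"
      proof (intro divide_right_mono)
        have "ennreal (\<integral>\<phi>. \<bar>poisson_kernel z \<phi> * (h \<phi> - g n \<phi>)\<bar> \<partial>circle)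
          = (\<integral>\<^sup>+\<phi>. ennreal \<bar>poisson_kernel z \<phi> * (h \<phi> - g n \<phi>)\<bar> \<partial>circle)"
          using i by (intro nn_integral_eq_integral[symmetric]) auto
        also have "\<dots> = (\<integral>\<^sup>+\<phi>\<in>{0..2*pi}. ennreal \<bar>poisson_kernel z \<phi> * (h \<phi> - g n \<phi>)\<bar> \<partial>lborel)"
          by (intro nn_integral_restrict_space) auto
        also have "\<dots> \<le> (\<integral>\<^sup>+\<phi>. ennreal C * (w n \<phi> * ennreal ((1-r)/((1-r)\<^sup>2 + (\<theta>-\<phi>)\<^sup>2))) \<partial>lborel)"
        proof (intro nn_integral_mono)
          fix \<phi> :: real
          show "ennreal \<bar>poisson_kernel z \<phi> * (h \<phi> - g n \<phi>)\<bar> * indicator {0..2*pi} \<phi>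
            \<le> ennreal C * (w n \<phi> * ennreal ((1-r)/((1-r)\<^sup>2 + (\<theta>-\<phi>)\<^sup>2)))"
          proof (cases "\<phi> \<in> {0..2*pi}")
            case True
            have "poisson_kernel z \<phi> * \<bar>h \<phi> - g n \<phi>\<bar> \<le> C * ((1-r)/((1-r)\<^sup>2 + (\<theta>-\<phi>)\<^sup>2)) * \<bar>h \<phi> - g n \<phi>\<bar>"
              using C(2)[OF r True] by (intro mult_right_mono) (auto simp: z_def)
            then have "\<bar>poisson_kernel z \<phi> * (h \<phi> - g n \<phi>)\<bar> \<le> C * (\<bar>h \<phi> - g n \<phi>\<bar> * ((1-r)/((1-r)\<^sup>2 + (\<theta>-\<phi>)\<^sup>2)))"
              using poisson_kernel_nonneg[OF z, of \<phi>] by (simp add: abs_mult mult_ac)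
            then show ?thesis using True C(1) r
              by (auto simp: w_def intro!: ennreal_leI simp flip: ennreal_mult)
          qed auto
        qed
        also have "\<dots> = ennreal C * (\<integral>\<^sup>+\<phi>. w n \<phi> * ennreal ((1-r)/((1-r)\<^sup>2 + (\<theta>-\<phi>)\<^sup>2)) \<partial>lborel)"
          by (intro nn_integral_cmult) auto
        also have "\<dots> \<le> ennreal C * ennreal (2*pi*(1/2)^n)"
        proof (intro mult_left_mono cauchy_kernel_maximal)
          show "(\<integral>\<^sup>+y\<in>cball \<theta> e. w n y \<partial>lborel) \<le> ennreal (2 * e * (1/2)^n)" if "e > 0" for e
            using n that unfolding U_def by (metis (mono_tags, lifting) linorder_not_le mem_Collect_eq)
        qed (use r in auto)
        finally show "(\<integral>\<phi>. \<bar>poisson_kernel z \<phi> * (h \<phi> - g n \<phi>)\<bar> \<partial>circle) \<le> C * (2*pi*(1/2)^n)"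
          using C(1) by (simp flip: ennreal_mult)
      qed auto
      finally show ?thesis by (simp add: z_def)
    qed
    show ?case
    proof (rule tendstoI)
      fix e :: real assume e: "e > 0"
      have "(\<lambda>n. C * (1/2)^n) \<longlonglongrightarrow> C * 0" by (intro tendsto_intros LIMSEQ_power_zero) auto
      then have "\<forall>\<^sub>F n in sequentially. C * (1/2)^n < e/3" using e by (intro order_tendstoD(2)[where y="C*0"]) auto
      then have e1: "\<forall>\<^sub>F n in sequentially. C * (1/2)^(s n) < e/3"
        using filterlim_subseq[OF s] by (rule eventually_compose_filterlim)
      have e2: "\<forall>\<^sub>F n in sequentially. \<theta> \<notin> U (s n)"
        using elim(1) filterlim_subseq[OF s] by (rule eventually_compose_filterlim)
      have e3: "\<forall>\<^sub>F n in sequentially. \<bar>g (s n) \<theta> - h \<theta>\<bar> < e/3"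
        using tendstoD[OF elim(2), of "e/3"] e by (simp add: dist_real_def)
      from eventually_happens'[OF sequentially_bot eventually_conj[OF e1 eventually_conj[OF e2 e3]]]
      obtain n where n: "C * (1/2)^(s n) < e/3" "\<theta> \<notin> U (s n)" "\<bar>g (s n) \<theta> - h \<theta>\<bar> < e/3" by blast
      have "\<forall>\<^sub>F r in at_left 1. \<bar>poisson (g (s n)) (of_real r * cis \<theta>) - g (s n) \<theta>\<bar> < e/3"
        using tendstoD[OF poisson_tendsto_continuous[OF gc \<theta>], of "e/3" "s n"] e by (simp add: dist_real_def)
      moreover have "\<forall>\<^sub>F r in at_left (1::real). 1/2 \<le> r \<and> r < 1"
        by (auto simp: eventually_at_left_field intro!: exI[of _ "1/2"])
      ultimately show "\<forall>\<^sub>F r in at_left 1. dist (poisson h (of_real r * cis \<theta>)) (h \<theta>) < e"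
      proof eventually_elim
        case (elim r)
        then have "\<bar>poisson h (of_real r * cis \<theta>) - poisson (g (s n)) (of_real r * cis \<theta>)\<bar> \<le> C * (1/2)^(s n)"
          using n(2) by (intro main) auto
        then show ?case unfolding dist_real_def using n elim(1) by linarith
      qed
    qed
  qed
qed

section \<open>Radial limits of Herglotz integrals\<close>

text \<open>The kernel expands as 1 plus twice the sum over n \<ge> 1 of z^n e^(-i n phi).
  Integrating term by term exhibits the integral as a convergent power series.\<close>

lemma holomorphic_herglotz:
  assumes k: "integrable circle k"
  shows "herglotz k holomorphic_on ball 0 1"
proof -
  define a where "a n = (if n = 0 then 1 else 2) * (\<integral>\<phi>. cis (- real n * \<phi>) * complex_of_real (k \<phi>) \<partial>circle) / (2*pi)" for n :: nat
  have "(\<lambda>n. a n * (z - 0)^n) sums herglotz k z" if z: "z \<in> ball 0 1" for z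
  proof -
    have z1: "cmod z < 1" using z by simp
    define f where "f n \<phi> = (if n = 0 then 1 else 2) * z^n * (cis (- real n * \<phi>) * complex_of_real (k \<phi>))" for n :: nat and \<phi>
    have ik: "integrable circle (\<lambda>\<phi>. cis (- real n * \<phi>) * complex_of_real (k \<phi>))" for n
      using k by (intro integrable_circle_mult continuous_intros) auto
    have fi: "integrable circle (f n)" for n unfolding f_def using ik by (intro integrable_mult_right)
    have nf: "norm (f n \<phi>) = (if n = 0 then 1 else 2) * cmod z^n * \<bar>k \<phi>\<bar>" for n \<phi>
      by (simp add: f_def norm_mult norm_power)
    have sg: "summable (\<lambda>n. (if n = 0 then 1 else 2) * cmod z^n)"
    proof (rule summable_comparison_test')
      show "summable (\<lambda>n. 2 * cmod z^n)" using z1 by (intro summable_mult summable_geometric) auto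
    qed auto
    have sumf: "(\<lambda>n. f n \<phi>) sums ((cis \<phi> + z) / (cis \<phi> - z) * complex_of_real (k \<phi>))" for \<phi>
    proof -
      define q where "q = z * cis (-\<phi>)"
      have q: "cmod q < 1" using z1 by (simp add: q_def norm_mult)
      have "(\<lambda>n. 2 * q^n - (if n = 0 then 1 else 0)) sums (2 * (1 / (1 - q)) - 1)"
        using geometric_sums[OF q] sums_single[of 0 "\<lambda>_. 1::complex"]
        by (intro sums_diff sums_mult) auto
      moreover have "2 * (1 / (1 - q)) - 1 = (cis \<phi> + z) / (cis \<phi> - z)"
      proof -
        have "1 - q \<noteq> 0" using q by auto
        then have "2 * (1 / (1 - q)) - 1 = (1 + q) / (1 - q)" by (simp add: field_simps)
        also have "\<dots> = (cis \<phi> * (1 + q)) / (cis \<phi> * (1 - q))" by simp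
        also have "cis \<phi> * q = z" by (simp add: q_def cis_mult)
        then have "(cis \<phi> * (1 + q)) / (cis \<phi> * (1 - q)) = (cis \<phi> + z) / (cis \<phi> - z)"
          by (simp add: algebra_simps)
        finally show ?thesis .
      qed
      ultimately have "(\<lambda>n. (2 * q^n - (if n = 0 then 1 else 0)) * complex_of_real (k \<phi>)) sums ((cis \<phi> + z) / (cis \<phi> - z) * complex_of_real (k \<phi>))"
        by (intro sums_mult2) simp
      moreover have "(2 * q^n - (if n = 0 then 1 else 0)) * complex_of_real (k \<phi>) = f n \<phi>" for n
        by (simp add: f_def q_def power_mult_distrib Complex.DeMoivre)
      ultimately show ?thesis by simp
    qed
    have "(\<lambda>n. integral\<^sup>L circle (f n)) sums (\<integral>\<phi>. (\<Sum>n. f n \<phi>) \<partial>circle)"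
    proof (rule sums_integral)
      show "AE \<phi> in circle. summable (\<lambda>n. norm (f n \<phi>))"
        unfolding nf using sg by (intro AE_I2 summable_mult2)
      have "(\<integral>\<phi>. norm (f n \<phi>) \<partial>circle) = (if n = 0 then 1 else 2) * cmod z^n * (\<integral>\<phi>. \<bar>k \<phi>\<bar> \<partial>circle)" for n
        unfolding nf by (rule integral_mult_right_zero)
      then show "summable (\<lambda>n. \<integral>\<phi>. norm (f n \<phi>) \<partial>circle)" using sg by (simp add: summable_mult2)
    qed (rule fi)
    moreover have "(\<Sum>n. f n \<phi>) = (cis \<phi> + z) / (cis \<phi> - z) * complex_of_real (k \<phi>)" for \<phi>
      using sumf by (rule sums_unique[symmetric])
    ultimately have "(\<lambda>n. integral\<^sup>L circle (f n) / (2*pi)) sums herglotz k z"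
      unfolding herglotz_def by (intro sums_divide) simp
    moreover have "integral\<^sup>L circle (f n) / (2*pi) = a n * (z - 0)^n" for n
      unfolding f_def a_def by (subst integral_mult_right_zero) simp
    ultimately show ?thesis by simp
  qed
  then show ?thesis by (rule power_series_holomorphic)
qed

section \<open>Orthogonality and Parseval's identity on circles\<close>

lemma integral_circle_cis_power:
  "(\<integral>\<phi>. cis \<phi> ^ m * cnj (cis \<phi> ^ n) \<partial>circle) = (if m = n then 2*pi else 0)"
proof -
  have ge: "(\<integral>\<phi>. cis \<phi> ^ m * cnj (cis \<phi> ^ n) \<partial>circle) = (if m = n then 2*pi else 0)" if "n \<le> m" for m n
  proof -
    have "cis \<phi> ^ m * cnj (cis \<phi> ^ n) = cis \<phi> ^ (m - n)" for \<phi>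
    proof -
      have "cis \<phi> ^ m = cis \<phi> ^ (m - n) * cis \<phi> ^ n" using that by (simp flip: power_add)
      moreover have "cis \<phi> ^ n * cnj (cis \<phi> ^ n) = 1"
        by (simp add: complex_mult_cnj cmod_power2[symmetric] norm_power del: complex_cnj_power)
      ultimately show ?thesis by (simp add: mult.assoc del: complex_cnj_power)
    qed
    then have "(\<integral>\<phi>. cis \<phi> ^ m * cnj (cis \<phi> ^ n) \<partial>circle) = (\<integral>\<phi>. cis \<phi> ^ (m - n) \<partial>circle)" by simp
    also have "\<dots> = 2 * pi * 0 ^ (m - n)"
      using mean_value_circle[of "\<lambda>w. w ^ (m-n)" 2] by (simp add: holomorphic_intros)
    finally show ?thesis using that by (auto simp: power_0_left)
  qed
  show ?thesis
  proof (cases "n \<le> m")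
    case False
    then have "cnj (\<integral>\<phi>. cis \<phi> ^ n * cnj (cis \<phi> ^ m) \<partial>circle) = 0" by (subst ge) auto
    also have "cnj (\<integral>\<phi>. cis \<phi> ^ n * cnj (cis \<phi> ^ m) \<partial>circle) = (\<integral>\<phi>. cnj (cis \<phi> ^ n * cnj (cis \<phi> ^ m)) \<partial>circle)"
      by (rule Bochner_Integration.integral_cnj[symmetric])
    finally show ?thesis using False by (simp add: mult.commute)
  qed (rule ge)
qed

lemma sums_integral_circle_power_series:
  fixes b :: "nat \<Rightarrow> complex"
  assumes G: "continuous_on {0..2*pi} G" and s: "0 \<le> s" "s < 1"
    and B: "\<And>w. cmod w < 1 \<Longrightarrow> (\<lambda>n. b n * w^n) sums B w"
  shows "(\<lambda>n. b n * of_real s^n * (\<integral>\<phi>. cis \<phi> ^ n * G \<phi> \<partial>circle)) sums (\<integral>\<phi>. B (of_real s * cis \<phi>) * G \<phi> \<partial>circle)"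
proof -
  define f where "f n \<phi> = b n * of_real s^n * (cis \<phi> ^ n * G \<phi>)" for n \<phi>
  have fi: "integrable circle (f n)" for n
    unfolding f_def using G by (intro integrable_circle_continuous continuous_intros)
  obtain t where t: "s < t" "t < 1" using dense s by blast
  have sg: "summable (\<lambda>n. cmod (b n) * s^n)"
  proof -
    have "summable (\<lambda>n. b n * of_real t^n)" using B[of "of_real t"] t s by (auto simp: sums_iff)
    then have "summable (\<lambda>n. norm (b n * of_real s^n))"
      by (rule powser_insidea) (use s t in auto)
    then show ?thesis using s by (simp add: norm_mult norm_power)
  qed
  have nf: "norm (f n \<phi>) = cmod (b n) * s^n * norm (G \<phi>)" for n \<phi>
    using s by (simp add: f_def norm_mult norm_power)
  have "(\<lambda>n. integral\<^sup>L circle (f n)) sums (\<integral>\<phi>. (\<Sum>n. f n \<phi>) \<partial>circle)"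
  proof (rule sums_integral)
    show "AE \<phi> in circle. summable (\<lambda>n. norm (f n \<phi>))"
      unfolding nf using sg by (intro AE_I2 summable_mult2)
    have "(\<integral>\<phi>. norm (f n \<phi>) \<partial>circle) = cmod (b n) * s^n * (\<integral>\<phi>. norm (G \<phi>) \<partial>circle)" for n
      unfolding nf by (rule integral_mult_right_zero)
    then show "summable (\<lambda>n. \<integral>\<phi>. norm (f n \<phi>) \<partial>circle)" using sg by (simp add: summable_mult2)
  qed (rule fi)
  moreover have "(\<Sum>n. f n \<phi>) = B (of_real s * cis \<phi>) * G \<phi>" for \<phi>
  proof -
    have "(\<lambda>n. b n * (of_real s * cis \<phi>)^n * G \<phi>) sums (B (of_real s * cis \<phi>) * G \<phi>)"
      using s by (intro sums_mult2 B) (auto simp: norm_mult)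
    then show ?thesis by (simp add: f_def sums_iff power_mult_distrib mult_ac)
  qed
  moreover have "integral\<^sup>L circle (f n) = b n * of_real s^n * (\<integral>\<phi>. cis \<phi> ^ n * G \<phi> \<partial>circle)" for n
    unfolding f_def by (rule integral_mult_right_zero)
  ultimately show ?thesis by simp
qed

text \<open>The two radii are independent because the mixed inner product enters the distance
  between two dilations of B.\<close>

lemma parseval_circle:
  assumes B: "\<And>w. cmod w < 1 \<Longrightarrow> (\<lambda>n. b n * w^n) sums B w" and s: "0 \<le> s" "s < 1" and r: "0 \<le> r" "r < 1"
  shows "(\<lambda>n. 2 * pi * ((cmod (b n))\<^sup>2 * (r * s)^n)) sums (\<integral>\<phi>. Re (B (of_real r * cis \<phi>) * cnj (B (of_real s * cis \<phi>))) \<partial>circle)"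
proof -
  have "B holomorphic_on ball 0 1"
    by (rule power_series_holomorphic[where a=b]) (use B in auto)
  then have cB: "continuous_on (ball 0 1) B" by (rule holomorphic_on_imp_continuous_on)
  have c: "continuous_on A (\<lambda>\<phi>. B (of_real t * cis \<phi>))" if "0 \<le> t" "t < 1" for t A
    using cB by (rule continuous_on_compose2) (use that in \<open>auto intro!: continuous_intros simp: norm_mult\<close>)
  have inner: "(\<integral>\<phi>. cis \<phi> ^ n * cnj (B (of_real s * cis \<phi>)) \<partial>circle) = cnj (b n) * of_real s^n * (2*pi)" for n
  proof -
    have "(\<lambda>m. b m * of_real s^m * (\<integral>\<phi>. cis \<phi> ^ m * cnj (cis \<phi> ^ n) \<partial>circle)) sums (\<integral>\<phi>. B (of_real s * cis \<phi>) * cnj (cis \<phi> ^ n) \<partial>circle)"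
      by (intro sums_integral_circle_power_series B s continuous_intros)
    moreover have "(\<lambda>m. b m * of_real s^m * (\<integral>\<phi>. cis \<phi> ^ m * cnj (cis \<phi> ^ n) \<partial>circle))
       = (\<lambda>m. if m = n then b m * of_real s^m * (2*pi) else 0)"
      unfolding integral_circle_cis_power by auto
    ultimately have e: "(\<integral>\<phi>. B (of_real s * cis \<phi>) * cnj (cis \<phi> ^ n) \<partial>circle) = b n * of_real s^n * (2*pi)"
      using sums_single[of n "\<lambda>m. b m * of_real s^m * (2*pi)"] by (simp add: sums_iff)
    have "(\<integral>\<phi>. cis \<phi> ^ n * cnj (B (of_real s * cis \<phi>)) \<partial>circle) = (\<integral>\<phi>. cnj (B (of_real s * cis \<phi>) * cnj (cis \<phi> ^ n)) \<partial>circle)"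
      by (intro Bochner_Integration.integral_cong) (auto simp: mult.commute)
    also have "\<dots> = cnj (\<integral>\<phi>. B (of_real s * cis \<phi>) * cnj (cis \<phi> ^ n) \<partial>circle)"
      by (rule Bochner_Integration.integral_cnj)
    finally show ?thesis unfolding e by simp
  qed
  have "(\<lambda>n. b n * of_real r^n * (\<integral>\<phi>. cis \<phi> ^ n * cnj (B (of_real s * cis \<phi>)) \<partial>circle))
     sums (\<integral>\<phi>. B (of_real r * cis \<phi>) * cnj (B (of_real s * cis \<phi>)) \<partial>circle)"
    by (intro sums_integral_circle_power_series B r continuous_intros c s)
  then have "(\<lambda>n. Re (b n * of_real r^n * (\<integral>\<phi>. cis \<phi> ^ n * cnj (B (of_real s * cis \<phi>)) \<partial>circle)))
     sums Re (\<integral>\<phi>. B (of_real r * cis \<phi>) * cnj (B (of_real s * cis \<phi>)) \<partial>circle)"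
    by (rule sums_Re)
  moreover have "Re (b n * of_real r^n * (\<integral>\<phi>. cis \<phi> ^ n * cnj (B (of_real s * cis \<phi>)) \<partial>circle))
     = 2 * pi * ((cmod (b n))\<^sup>2 * (r * s)^n)" for n
  proof -
    have "b n * of_real r^n * (cnj (b n) * of_real s^n * (2*pi)) = (b n * cnj (b n)) * of_real (2 * pi * (r * s)^n)"
      by (simp add: power_mult_distrib mult_ac)
    also have "\<dots> = of_real (2 * pi * ((cmod (b n))\<^sup>2 * (r * s)^n))"
      by (simp add: complex_mult_cnj cmod_power2)
    finally show ?thesis unfolding inner by (metis Re_complex_of_real)
  qed
  moreover have "Re (\<integral>\<phi>. B (of_real r * cis \<phi>) * cnj (B (of_real s * cis \<phi>)) \<partial>circle)
    = (\<integral>\<phi>. Re (B (of_real r * cis \<phi>) * cnj (B (of_real s * cis \<phi>))) \<partial>circle)"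
    by (intro integral_Re[symmetric] integrable_circle_continuous continuous_intros c r s)
  ultimately show ?thesis by simp
qed

text \<open>The squared L^2 distance of the dilations to radii r and s is D r r + D s s - 2 D r s.
  By Parseval all coefficients are nonnegative, so the diagonal terms stay below their supremum l
  while D r s is at least D \<rho> \<rho>; the distance is small once D \<rho> \<rho> is close to
  l.\<close>

lemma bounded_holomorphic_L1_Cauchy:
  assumes B: "B holomorphic_on ball 0 1" and bd: "\<And>w. cmod w < 1 \<Longrightarrow> cmod (B w) \<le> 1" and e: "e > 0"
  obtains \<rho> where "0 \<le> \<rho>" "\<rho> < 1" "\<And>r s. \<rho> \<le> r \<Longrightarrow> r < 1 \<Longrightarrow> \<rho> \<le> s \<Longrightarrow> s < 1 \<Longrightarrow>
    (\<integral>\<phi>. cmod (B (of_real r * cis \<phi>) - B (of_real s * cis \<phi>)) \<partial>circle) \<le> e"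
proof -
  define b where "b n = (deriv ^^ n) B 0 / fact n" for n
  have Bs: "(\<lambda>n. b n * w^n) sums B w" if "cmod w < 1" for w
    using holomorphic_power_series[OF B, of w] that by (simp add: b_def)
  have cB: "continuous_on (ball 0 1) B" using B by (rule holomorphic_on_imp_continuous_on)
  have c: "continuous_on A (\<lambda>\<phi>. B (of_real t * cis \<phi>))" if "0 \<le> t" "t < 1" for t A
    using cB by (rule continuous_on_compose2) (use that in \<open>auto intro!: continuous_intros simp: norm_mult\<close>)
  define D where "D r s = (\<integral>\<phi>. Re (B (of_real r * cis \<phi>) * cnj (B (of_real s * cis \<phi>))) \<partial>circle)" for r s
  have iD: "integrable circle (\<lambda>\<phi>. Re (B (of_real r * cis \<phi>) * cnj (B (of_real s * cis \<phi>))))"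
    if "0 \<le> r" "r < 1" "0 \<le> s" "s < 1" for r s
    using that by (intro integrable_circle_continuous continuous_intros c)
  have Dsum: "(\<lambda>n. 2 * pi * ((cmod (b n))\<^sup>2 * (r * s)^n)) sums D r s" if "0 \<le> r" "r < 1" "0 \<le> s" "s < 1" for r s
    unfolding D_def using that by (intro parseval_circle Bs) auto
  have Dmono: "D \<rho> \<rho> \<le> D r s" if "0 \<le> \<rho>" "\<rho> \<le> r" "r < 1" "\<rho> \<le> s" "s < 1" for \<rho> r s
  proof (rule sums_le)
    show "(\<lambda>n. 2 * pi * ((cmod (b n))\<^sup>2 * (\<rho> * \<rho>)^n)) sums D \<rho> \<rho>" using that by (intro Dsum) auto
    show "(\<lambda>n. 2 * pi * ((cmod (b n))\<^sup>2 * (r * s)^n)) sums D r s" using that by (intro Dsum) auto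
    show "2 * pi * ((cmod (b n))\<^sup>2 * (\<rho> * \<rho>)^n) \<le> 2 * pi * ((cmod (b n))\<^sup>2 * (r * s)^n)" for n
      using that by (intro mult_left_mono power_mono mult_mono) auto
  qed
  have Dle: "D r r \<le> 2*pi" if "0 \<le> r" "r < 1" for r
  proof -
    have "D r r \<le> (\<integral>\<phi>. 1 \<partial>circle)"
      unfolding D_def
    proof (intro integral_mono iD that)
      fix \<phi>
      have "Re (B (of_real r * cis \<phi>) * cnj (B (of_real r * cis \<phi>))) = (cmod (B (of_real r * cis \<phi>)))\<^sup>2"
        by (simp add: complex_mult_cnj cmod_power2)
      also have "\<dots> \<le> 1" using that by (intro power_le_one bd) (auto simp: norm_mult)
      finally show "Re (B (of_real r * cis \<phi>) * cnj (B (of_real r * cis \<phi>))) \<le> 1" .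
    qed auto
    then show ?thesis by (simp add: measure_circle space_restrict_space)
  qed
  define l where "l = (SUP r\<in>{0..<1}. D r r)"
  have bdd: "bdd_above ((\<lambda>r. D r r) ` {0..<1})" using Dle by (auto intro!: bdd_aboveI2[where M="2*pi"])
  \<comment> \<open>Chosen so that the final bound 2 pi d + d^2 / d is exactly e.\<close>
  define d where "d = e / (2*pi + 1)"
  have d: "d > 0" using e by (simp add: d_def add_pos_pos)
  have "\<exists>\<rho>\<in>{0..<1}. l - d\<^sup>2/2 < D \<rho> \<rho>"
    using less_cSUP_iff[OF _ bdd, of "l - d\<^sup>2/2"] d by (auto simp: l_def)
  then obtain \<rho> where \<rho>: "0 \<le> \<rho>" "\<rho> < 1" "l - d\<^sup>2/2 < D \<rho> \<rho>" by auto
  show ?thesis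
  proof
    fix r s assume r: "\<rho> \<le> r" "r < 1" and s: "\<rho> \<le> s" "s < 1"
    have r0: "0 \<le> r" and s0: "0 \<le> s" using r s \<rho> by auto
    let ?x = "\<lambda>\<phi>. cmod (B (of_real r * cis \<phi>) - B (of_real s * cis \<phi>))"
    have cx: "continuous_on {0..2*pi} ?x" using r s r0 s0 by (intro continuous_intros c)
    have sq: "(?x \<phi>)\<^sup>2 = Re (B (of_real r * cis \<phi>) * cnj (B (of_real r * cis \<phi>)))
        + Re (B (of_real s * cis \<phi>) * cnj (B (of_real s * cis \<phi>)))
        - 2 * Re (B (of_real r * cis \<phi>) * cnj (B (of_real s * cis \<phi>)))" for \<phi>
      unfolding cmod_power2 by (simp add: power2_eq_square algebra_simps)
    have "(\<integral>\<phi>. (?x \<phi>)\<^sup>2 \<partial>circle) = D r r + D s s - 2 * D r s"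
    proof -
      define p where "p r s \<phi> = Re (B (of_real r * cis \<phi>) * cnj (B (of_real s * cis \<phi>)))" for r s \<phi>
      have "integrable circle (p r r)" "integrable circle (p s s)" "integrable circle (p r s)"
        using iD r s r0 s0 by (auto simp: p_def[abs_def] simp del: times_complex.simps)
      then have "(\<integral>\<phi>. p r r \<phi> + p s s \<phi> - 2 * p r s \<phi> \<partial>circle) = integral\<^sup>L circle (p r r) + integral\<^sup>L circle (p s s) - 2 * integral\<^sup>L circle (p r s)"
        by simp
      then show ?thesis unfolding sq D_def p_def[abs_def] .
    qed
    also have "\<dots> \<le> l + l - 2 * D \<rho> \<rho>"
      using cSUP_upper[OF _ bdd, of r] cSUP_upper[OF _ bdd, of s] Dmono[OF \<rho>(1) r s] r s r0 s0
      by (simp add: l_def)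
    also have "\<dots> \<le> d\<^sup>2" using \<rho>(3) by simp
    finally have J: "(\<integral>\<phi>. (?x \<phi>)\<^sup>2 \<partial>circle) \<le> d\<^sup>2" .
    \<comment> \<open>The elementary inequality y \<le> d + y^2 / d leads from the L^2 bound to
      L^1.\<close>
    have "(\<integral>\<phi>. ?x \<phi> \<partial>circle) \<le> (\<integral>\<phi>. d + (?x \<phi>)\<^sup>2 / d \<partial>circle)"
    proof (intro integral_mono)
      show "integrable circle ?x" using cx by (rule integrable_circle_continuous)
      show "integrable circle (\<lambda>\<phi>. d + (?x \<phi>)\<^sup>2 / d)"
        using d r s r0 s0 by (intro integrable_circle_continuous continuous_intros c) auto
      have "y \<le> d + y\<^sup>2 / d" if "y \<ge> 0" for y :: real
      proof -
        have "y * d \<le> d\<^sup>2 + y\<^sup>2" using sum_squares_bound[of y d] mult_nonneg_nonneg[OF that less_imp_le[OF d]] by linarith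
        then show ?thesis using d by (simp add: field_simps power2_eq_square)
      qed
      then show "?x \<phi> \<le> d + (?x \<phi>)\<^sup>2 / d" for \<phi> by simp
    qed
    also have "\<dots> = 2*pi*d + (\<integral>\<phi>. (?x \<phi>)\<^sup>2 \<partial>circle) / d"
    proof -
      have "integrable circle (\<lambda>\<phi>. (?x \<phi>)\<^sup>2 / d)"
        using d r s r0 s0 by (intro integrable_circle_continuous continuous_intros c) auto
      then show ?thesis by (simp add: measure_circle space_restrict_space)
    qed
    also have "\<dots> \<le> 2*pi*d + d\<^sup>2 / d" using J d by (intro add_left_mono divide_right_mono) auto
    also have "\<dots> = e"
    proof -
      have "2*pi*d + d\<^sup>2 / d = (2*pi + 1) * d" using d by (simp add: power2_eq_square algebra_simps)
      also have "2*pi + 1 > 0" by (simp add: add_pos_pos)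
      then have "(2*pi + 1) * d = e" by (simp add: d_def)
      finally show ?thesis .
    qed
    finally show "(\<integral>\<phi>. ?x \<phi> \<partial>circle) \<le> e" .
  qed (use \<rho> in auto)
qed

text \<open>Along radii that approach 1 fast enough the successive L^1 differences are summable, so
  the dilations converge almost everywhere. Each dilation is reproduced by its Poisson integral, and
  the common bound 1 lets dominated convergence carry the formula to the limit. Real and imaginary
  parts appear separately since \<open>poisson\<close> takes real functions.\<close>

lemma bounded_holomorphic_boundary_function:
  assumes B: "B holomorphic_on ball 0 1" and bd: "\<And>w. cmod w < 1 \<Longrightarrow> cmod (B w) \<le> 1"
  obtains \<beta> :: "real \<Rightarrow> complex" where "integrable circle \<beta>"
    "\<And>z. cmod z < 1 \<Longrightarrow> Re (B z) = poisson (\<lambda>\<phi>. Re (\<beta> \<phi>)) z"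
    "\<And>z. cmod z < 1 \<Longrightarrow> Im (B z) = poisson (\<lambda>\<phi>. Im (\<beta> \<phi>)) z"
proof -
  define Q where "Q n \<rho> \<longleftrightarrow> 0 \<le> \<rho> \<and> \<rho> < 1 \<and> (\<forall>r s. \<rho> \<le> r \<longrightarrow> r < 1 \<longrightarrow> \<rho> \<le> s \<longrightarrow> s < 1 \<longrightarrow>
    (\<integral>\<phi>. cmod (B (of_real r * cis \<phi>) - B (of_real s * cis \<phi>)) \<partial>circle) \<le> (1/2)^n)" for n :: nat and \<rho>
  have "\<exists>\<rho>. Q n \<rho>" for n
  proof -
    show ?thesis
      by (rule bounded_holomorphic_L1_Cauchy[OF B, of "(1/2)^n"]) (auto simp: Q_def bd intro!: exI)
  qed
  then obtain \<rho> where Q: "\<And>n. Q n (\<rho> n)" by metis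
  have \<rho>: "0 \<le> \<rho> n" "\<rho> n < 1" for n using Q[of n] by (auto simp: Q_def)
  have \<rho>3: "(\<integral>\<phi>. cmod (B (of_real r * cis \<phi>) - B (of_real s * cis \<phi>)) \<partial>circle) \<le> (1/2)^n"
    if "\<rho> n \<le> r" "r < 1" "\<rho> n \<le> s" "s < 1" for n r s
    using Q[of n] that by (auto simp: Q_def)
  \<comment> \<open>The maximum over all earlier indices puts both \<open>r n\<close> and
    \<open>r (Suc n)\<close> above \<open>\<rho> n\<close>, so consecutive dilations differ by at
    most 2^(-n) in L^1. The second entry forces the radii to 1.\<close>
  define r where "r n = Max ((\<lambda>i. max (\<rho> i) (1 - 1 / (real i + 1))) ` {..n})" for n
  have r1: "r n < 1" for n unfolding r_def using \<rho>(2) by (subst Max_less_iff) auto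
  have rge: "max (\<rho> i) (1 - 1 / (real i + 1)) \<le> r n" if "i \<le> n" for i n
    unfolding r_def using that by (intro Max_ge) auto
  have r0: "0 \<le> r n" for n using rge[of n n] \<rho>(1)[of n] by auto
  have rlim: "r \<longlonglongrightarrow> 1"
  proof (rule tendsto_sandwich[OF _ _ _ tendsto_const])
    show "\<forall>\<^sub>F n in sequentially. 1 - 1 / (real n + 1) \<le> r n" using rge by (auto intro!: always_eventually)
    show "\<forall>\<^sub>F n in sequentially. r n \<le> 1" using r1 by (auto intro!: always_eventually less_imp_le)
    have "(\<lambda>n. 1 - inverse (real (Suc n))) \<longlonglongrightarrow> 1 - 0"
      by (intro tendsto_diff tendsto_const LIMSEQ_inverse_real_of_nat)
    then show "(\<lambda>n. 1 - 1 / (real n + 1)) \<longlonglongrightarrow> 1" by (simp add: inverse_eq_divide add.commute)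
  qed
  have cB: "continuous_on (ball 0 1) B" using B by (rule holomorphic_on_imp_continuous_on)
  have c: "continuous_on A (\<lambda>\<phi>. B (of_real t * cis \<phi>))" if "0 \<le> t" "t < 1" for t A
    using cB by (rule continuous_on_compose2) (use that in \<open>auto intro!: continuous_intros simp: norm_mult\<close>)
  define f where "f n \<phi> = B (of_real (r n) * cis \<phi>)" for n \<phi>
  have fc: "continuous_on A (f n)" for n A unfolding f_def using c r0 r1 by blast
  have fi: "integrable circle (f n)" for n using fc by (rule integrable_circle_continuous)
  have [measurable]: "f n \<in> borel_measurable circle" for n using fi by (rule borel_measurable_integrable)
  have fb: "cmod (f n \<phi>) \<le> 1" for n \<phi>
    unfolding f_def using r0[of n] r1[of n] by (intro bd) (simp add: norm_mult)
  have diff: "(\<integral>\<phi>. cmod (f (Suc n) \<phi> - f n \<phi>) \<partial>circle) \<le> (1/2)^n" for n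
    unfolding f_def by (intro \<rho>3 r1) (use rge[of n n] rge[of n "Suc n"] in auto)
  have "(\<integral>\<^sup>+\<phi>. (\<Sum>n. ennreal (cmod (f (Suc n) \<phi> - f n \<phi>))) \<partial>circle)
     = (\<Sum>n. (\<integral>\<^sup>+\<phi>. ennreal (cmod (f (Suc n) \<phi> - f n \<phi>)) \<partial>circle))"
    by (intro nn_integral_suminf) measurable
  also have "\<dots> \<le> (\<Sum>n. ennreal ((1/2)^n))"
  proof (intro suminf_le allI)
    fix n
    have "(\<integral>\<^sup>+\<phi>. ennreal (cmod (f (Suc n) \<phi> - f n \<phi>)) \<partial>circle) = ennreal (\<integral>\<phi>. cmod (f (Suc n) \<phi> - f n \<phi>) \<partial>circle)"
      using fi by (intro nn_integral_eq_integral) auto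
    then show "(\<integral>\<^sup>+\<phi>. ennreal (cmod (f (Suc n) \<phi> - f n \<phi>)) \<partial>circle) \<le> ennreal ((1/2)^n)"
      using diff[of n] by (simp add: ennreal_leI)
  qed auto
  also have "\<dots> < \<infinity>"
  proof -
    have "(\<Sum>n. ennreal ((1/2)^n)) = ennreal (\<Sum>n. (1/2)^n)"
      by (rule suminf_ennreal2) (auto intro: summable_geometric)
    then show ?thesis by simp
  qed
  finally have "(\<integral>\<^sup>+\<phi>. (\<Sum>n. ennreal (cmod (f (Suc n) \<phi> - f n \<phi>))) \<partial>circle) \<noteq> \<infinity>" by simp
  then have "AE \<phi> in circle. (\<Sum>n. ennreal (cmod (f (Suc n) \<phi> - f n \<phi>))) \<noteq> \<infinity>"
    by (intro nn_integral_noteq_infinite) auto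
  then have AEc: "AE \<phi> in circle. convergent (\<lambda>n. f n \<phi>)"
  proof eventually_elim
    case (elim \<phi>)
    then have "summable (\<lambda>n. norm (f (Suc n) \<phi> - f n \<phi>))"
      by (intro summable_suminf_not_top) (auto simp: top_unique)
    then have "summable (\<lambda>n. f (Suc n) \<phi> - f n \<phi>)" by (rule summable_norm_cancel)
    then have "(\<lambda>n. (\<Sum>i<n. f (Suc i) \<phi> - f i \<phi>) + f 0 \<phi>) \<longlonglongrightarrow> (\<Sum>n. f (Suc n) \<phi> - f n \<phi>) + f 0 \<phi>"
      by (intro tendsto_intros summable_LIMSEQ)
    then show ?case unfolding sum_lessThan_telescope[of "\<lambda>n. f n \<phi>"] by (simp add: convergent_def) blast
  qed
  define \<beta> where "\<beta> \<phi> = lim (\<lambda>n. f n \<phi>)" for \<phi>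
  have [measurable]: "\<beta> \<in> borel_measurable circle" unfolding \<beta>_def by (intro borel_measurable_lim_metric) measurable
  have lim: "AE \<phi> in circle. (\<lambda>n. f n \<phi>) \<longlonglongrightarrow> \<beta> \<phi>"
    using AEc by eventually_elim (simp add: \<beta>_def convergent_LIMSEQ_iff)
  have \<beta>i: "integrable circle \<beta>"
  proof (rule circle.integrable_const_bound)
    show "AE \<phi> in circle. cmod (\<beta> \<phi>) \<le> 1"
      using lim by eventually_elim (use fb in \<open>auto intro: Lim_bounded tendsto_norm\<close>)
  qed auto
  have pois: "poisson (\<lambda>\<phi>. L (\<beta> \<phi>)) z = l" 
    if z: "cmod z < 1" and L: "bounded_linear (L :: complex \<Rightarrow> real)" "\<And>w. \<bar>L w\<bar> \<le> cmod w"
      and l: "(\<lambda>n. poisson (\<lambda>\<phi>. L (f n \<phi>)) z) \<longlonglongrightarrow> l" for L z l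
  proof -
    interpret L: bounded_linear L by fact
    have [measurable]: "L \<in> borel_measurable borel"
      by (intro borel_measurable_continuous_onI) (simp add: L.continuous_on)
    have pk[measurable]: "poisson_kernel z \<in> borel_measurable circle"
      using integrable_circle_continuous[OF continuous_on_poisson_kernel[OF z]] by (rule borel_measurable_integrable)
    have "(\<lambda>n. \<integral>\<phi>. poisson_kernel z \<phi> * L (f n \<phi>) \<partial>circle) \<longlonglongrightarrow> (\<integral>\<phi>. poisson_kernel z \<phi> * L (\<beta> \<phi>) \<partial>circle)"
    proof (rule integral_dominated_convergence)
      show "integrable circle (poisson_kernel z)"
        using continuous_on_poisson_kernel[OF z] by (rule integrable_circle_continuous)
      show "AE \<phi> in circle. (\<lambda>n. poisson_kernel z \<phi> * L (f n \<phi>)) \<longlonglongrightarrow> poisson_kernel z \<phi> * L (\<beta> \<phi>)"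
        using lim by eventually_elim (intro tendsto_intros L.tendsto)
      show "AE \<phi> in circle. norm (poisson_kernel z \<phi> * L (f n \<phi>)) \<le> poisson_kernel z \<phi>" for n
      proof (rule AE_I2)
        fix \<phi>
        have "\<bar>L (f n \<phi>)\<bar> \<le> 1" using L(2)[of "f n \<phi>"] fb[of n \<phi>] by linarith
        then show "norm (poisson_kernel z \<phi> * L (f n \<phi>)) \<le> poisson_kernel z \<phi>"
          using poisson_kernel_nonneg[OF z, of \<phi>] by (simp add: abs_mult mult_left_le)
      qed
    qed measurable
    then have "(\<lambda>n. poisson (\<lambda>\<phi>. L (f n \<phi>)) z) \<longlonglongrightarrow> poisson (\<lambda>\<phi>. L (\<beta> \<phi>)) z"
      unfolding poisson_def by (intro tendsto_divide tendsto_const) auto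
    with l show ?thesis using LIMSEQ_unique by blast
  qed
  have dil: "poisson (\<lambda>\<phi>. Re (F (of_real (r n) * cis \<phi>))) z = Re (F (of_real (r n) * z))"
    if F: "F holomorphic_on ball 0 1" and z: "cmod z < 1" for F n z
  proof (cases "r n = 0")
    \<comment> \<open>The radius can be 0 at n = 0; the dilation is then constant, and
      \<open>1 / r n\<close> would not describe a larger disc.\<close>
    case True then show ?thesis using z by (simp add: poisson_const)
  next
    case False
    then have rp: "0 < r n" using r0[of n] by simp
    have "(\<lambda>w. F (of_real (r n) * w)) holomorphic_on ball 0 (1 / r n)"
      by (rule holomorphic_on_compose_gen[OF _ F, unfolded o_def])
         (use rp in \<open>auto intro!: holomorphic_intros simp: norm_mult field_simps\<close>)
    from poisson_holomorphic[OF this _ z] show ?thesis using rp r1[of n] by simp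
  qed
  have limz: "(\<lambda>n. B (of_real (r n) * z)) \<longlonglongrightarrow> B z" if z: "cmod z < 1" for z
  proof -
    have "isCont B z" using cB z by (simp add: continuous_on_eq_continuous_at)
    moreover have "(\<lambda>n. of_real (r n) * z) \<longlonglongrightarrow> of_real 1 * z" by (intro tendsto_intros rlim)
    ultimately show ?thesis by (intro isCont_tendsto_compose[of _ B]) auto
  qed
  show ?thesis
  proof
    show "integrable circle \<beta>" by fact
    fix z assume z: "cmod z < 1"
    have "poisson (\<lambda>\<phi>. Re (\<beta> \<phi>)) z = Re (B z)"
      by (rule pois[OF z bounded_linear_Re abs_Re_le_cmod], unfold f_def dil[OF B z])
         (intro tendsto_intros limz z)
    then show "Re (B z) = poisson (\<lambda>\<phi>. Re (\<beta> \<phi>)) z" by simp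
    \<comment> \<open>Im B is the real part of -i B, so the dilation formula covers imaginary parts
      too.\<close>
    have "(\<lambda>w. - \<i> * B w) holomorphic_on ball 0 1" using B by (intro holomorphic_intros)
    from dil[OF this z] have dI: "poisson (\<lambda>\<phi>. Im (B (of_real (r n) * cis \<phi>))) z = Im (B (of_real (r n) * z))" for n
      by simp
    have "poisson (\<lambda>\<phi>. Im (\<beta> \<phi>)) z = Im (B z)"
      by (rule pois[OF z bounded_linear_Im abs_Im_le_cmod], unfold f_def dI)
         (intro tendsto_intros limz z)
    then show "Im (B z) = poisson (\<lambda>\<phi>. Im (\<beta> \<phi>)) z" by simp
  qed
qed

theorem fatou_bounded_holomorphic:
  assumes "B holomorphic_on ball 0 1" and "\<And>w. cmod w < 1 \<Longrightarrow> cmod (B w) \<le> 1"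
  shows "AE \<theta> in circle. \<exists>L. ((\<lambda>r. B (of_real r * cis \<theta>)) \<longlongrightarrow> L) (at_left 1)"
proof -
  obtain \<beta> where \<beta>: "integrable circle \<beta>"
    "\<And>z. cmod z < 1 \<Longrightarrow> Re (B z) = poisson (\<lambda>\<phi>. Re (\<beta> \<phi>)) z"
    "\<And>z. cmod z < 1 \<Longrightarrow> Im (B z) = poisson (\<lambda>\<phi>. Im (\<beta> \<phi>)) z"
    using bounded_holomorphic_boundary_function[OF assms] by metis
  have ev: "\<forall>\<^sub>F r in at_left (1::real). 0 \<le> r \<and> r < 1"
    by (auto simp: eventually_at_left_field intro!: exI[of _ "1/2"])
  have iR: "integrable circle (\<lambda>\<phi>. Re (\<beta> \<phi>))" and iI: "integrable circle (\<lambda>\<phi>. Im (\<beta> \<phi>))" using \<beta>(1) by auto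
  show ?thesis using fatou_poisson[OF iR] fatou_poisson[OF iI]
  proof eventually_elim
    case (elim \<theta>)
    have "\<forall>\<^sub>F r in at_left (1::real). poisson (\<lambda>\<phi>. Re (\<beta> \<phi>)) (of_real r * cis \<theta>) = Re (B (of_real r * cis \<theta>))"
      using ev by eventually_elim (simp add: \<beta>(2) norm_mult)
    from Lim_transform_eventually[OF elim(1) this]
    have 1: "((\<lambda>r. Re (B (of_real r * cis \<theta>))) \<longlongrightarrow> Re (\<beta> \<theta>)) (at_left 1)" .
    have "\<forall>\<^sub>F r in at_left (1::real). poisson (\<lambda>\<phi>. Im (\<beta> \<phi>)) (of_real r * cis \<theta>) = Im (B (of_real r * cis \<theta>))"
      using ev by eventually_elim (simp add: \<beta>(3) norm_mult)
    from Lim_transform_eventually[OF elim(2) this]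
    have 2: "((\<lambda>r. Im (B (of_real r * cis \<theta>))) \<longlongrightarrow> Im (\<beta> \<theta>)) (at_left 1)" .
    have "((\<lambda>r. B (of_real r * cis \<theta>)) \<longlongrightarrow> \<beta> \<theta>) (at_left 1)"
      using 1 2 by (simp add: tendsto_complex_iff)
    then show ?case by blast
  qed
qed

text \<open>The function K + Ln (exp (- K) / L) has exponential 1 / L, so its values lie in one
  coset of 2 pi i Z; being continuous on an interval, it is constant. Dividing by L keeps the
  argument of \<open>Ln\<close> near 1 and off the branch cut. Hence K is a constant minus a
  convergent term.\<close>

lemma exp_lift_tendsto:
  fixes K :: "real \<Rightarrow> complex"
  assumes c: "continuous_on {a..<1} K" and a: "a < 1"
    and L: "((\<lambda>r. exp (- K r)) \<longlongrightarrow> L) (at_left 1)" and L0: "L \<noteq> 0"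
  shows "\<exists>l. (K \<longlongrightarrow> l) (at_left 1)"
proof -
  have q: "((\<lambda>r. exp (- K r) / L) \<longlongrightarrow> 1) (at_left 1)"
    using tendsto_divide[OF L tendsto_const L0] L0 by simp
  then have "\<forall>\<^sub>F r in at_left 1. dist (exp (- K r) / L) 1 < 1" by (rule tendstoD) simp
  then obtain b where b: "b < 1" "\<And>r. b < r \<Longrightarrow> r < 1 \<Longrightarrow> dist (exp (- K r) / L) 1 < 1"
    unfolding eventually_at_left_field by blast
  define S where "S = {max a b<..<1}"
  have nz: "exp (- K r) / L \<notin> \<real>\<^sub>\<le>\<^sub>0" if "r \<in> S" for r
  proof
    assume "exp (- K r) / L \<in> \<real>\<^sub>\<le>\<^sub>0"
    then have "Re (exp (- K r) / L) \<le> 0" by (auto simp: complex_nonpos_Reals_iff)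
    moreover have "\<bar>Re (exp (- K r) / L - 1)\<bar> < 1"
      using b(2)[of r] that abs_Re_le_cmod[of "exp (- K r) / L - 1"] by (auto simp: S_def dist_norm)
    ultimately show False by simp
  qed
  define f where "f r = K r + Ln (exp (- K r) / L)" for r
  have cK: "continuous_on S K" using c by (rule continuous_on_subset) (auto simp: S_def)
  have cf: "continuous_on S f" unfolding f_def
    using nz L0 by (intro continuous_intros cK) auto
  have ef: "exp (f r) = 1 / L" for r
    unfolding f_def exp_add using L0 by (simp add: exp_minus field_simps)
  have "f constant_on S"
  proof (rule continuous_discrete_range_constant[OF _ cf])
    show "connected S" by (simp add: S_def)
    fix x assume "x \<in> S"
    have "1 \<le> norm (f y - f x)" if "f y \<noteq> f x" for y
    proof -
      obtain n :: int where n: "f y = f x + (of_int (2 * n) * pi) * \<i>"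
        using ef[of x] ef[of y] exp_eq[of "f y" "f x"] by auto
      then have "n \<noteq> 0" using that by auto
      then have "1 \<le> \<bar>real_of_int n\<bar>" by linarith
      moreover have "norm (f y - f x) = 2 * \<bar>real_of_int n\<bar> * pi" unfolding n by (simp add: norm_mult)
      moreover have "pi > 3" by (rule pi_gt3)
      ultimately show ?thesis by (smt (verit) mult_le_cancel_left1 mult_less_cancel_left1)
    qed
    then show "\<exists>e>0. \<forall>y. y \<in> S \<and> f y \<noteq> f x \<longrightarrow> e \<le> norm (f y - f x)"
      by (intro exI[of _ 1]) auto
  qed
  then obtain C where C: "\<And>r. r \<in> S \<Longrightarrow> f r = C" by (auto simp: constant_on_def)
  have "((\<lambda>r. C - Ln (exp (- K r) / L)) \<longlongrightarrow> C - Ln 1) (at_left 1)"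
    by (intro tendsto_intros q) auto
  moreover have "\<forall>\<^sub>F r in at_left 1. C - Ln (exp (- K r) / L) = K r"
    unfolding eventually_at_left_field
    by (rule exI[of _ "max a b"]) (use a b C in \<open>auto simp: S_def f_def algebra_simps\<close>)
  ultimately show ?thesis using Lim_transform_eventually by blast
qed

text \<open>The function exp(-K) is bounded, so it has radial limits almost everywhere; their modulus exp(-k) does
  not vanish, so convergence lifts to K.\<close>

theorem fatou_herglotz:
  assumes k: "integrable circle k" and k0: "\<And>\<phi>. k \<phi> \<ge> 0"
  shows "AE \<theta> in circle. \<exists>L. ((\<lambda>r. herglotz k (of_real r * cis \<theta>)) \<longlongrightarrow> L) (at_left 1) \<and> Re L = k \<theta>"
proof -
  define B where "B z = exp (- herglotz k z)" for z
  have hol: "herglotz k holomorphic_on ball 0 1" using k by (rule holomorphic_herglotz)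
  have Bh: "B holomorphic_on ball 0 1" unfolding B_def by (intro holomorphic_intros hol)
  have nB: "cmod (B z) = exp (- poisson k z)" if "cmod z < 1" for z
    using Re_herglotz[OF that k] by (simp add: B_def)
  have p0: "poisson k z \<ge> 0" if "cmod z < 1" for z
    unfolding poisson_def using poisson_kernel_nonneg[OF that] k0
    by (intro divide_nonneg_nonneg Bochner_Integration.integral_nonneg mult_nonneg_nonneg) auto
  have "AE \<theta> in circle. \<exists>L. ((\<lambda>r. B (of_real r * cis \<theta>)) \<longlongrightarrow> L) (at_left 1)"
    by (rule fatou_bounded_holomorphic[OF Bh]) (simp add: nB p0)
  with fatou_poisson[OF k] show ?thesis
  proof eventually_elim
    case (elim \<theta>)
    obtain L where L: "((\<lambda>r. B (of_real r * cis \<theta>)) \<longlongrightarrow> L) (at_left 1)" using elim(2) by blast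
    have ev: "\<forall>\<^sub>F r in at_left (1::real). 0 \<le> r \<and> r < 1"
      by (auto simp: eventually_at_left_field intro!: exI[of _ "1/2"])
    have "((\<lambda>r. exp (- poisson k (of_real r * cis \<theta>))) \<longlongrightarrow> exp (- k \<theta>)) (at_left 1)"
      by (intro tendsto_intros elim)
    moreover have "\<forall>\<^sub>F r in at_left (1::real). exp (- poisson k (of_real r * cis \<theta>)) = cmod (B (of_real r * cis \<theta>))"
      using ev by eventually_elim (simp add: nB norm_mult)
    ultimately have "((\<lambda>r. cmod (B (of_real r * cis \<theta>))) \<longlongrightarrow> exp (- k \<theta>)) (at_left 1)"
      by (rule Lim_transform_eventually)
    then have "cmod L = exp (- k \<theta>)"
      using tendsto_norm[OF L] tendsto_unique[OF trivial_limit_at_left_real] by blast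
    then have L0: "L \<noteq> 0" by auto
    have "\<exists>l. ((\<lambda>r. herglotz k (of_real r * cis \<theta>)) \<longlongrightarrow> l) (at_left 1)"
    proof (rule exp_lift_tendsto[OF _ _ _ L0])
      show "continuous_on {0..<1} (\<lambda>r. herglotz k (of_real r * cis \<theta>))"
        using holomorphic_on_imp_continuous_on[OF hol]
        by (rule continuous_on_compose2) (auto intro!: continuous_intros simp: norm_mult)
      show "((\<lambda>r. exp (- herglotz k (of_real r * cis \<theta>))) \<longlongrightarrow> L) (at_left 1)"
        using L by (simp add: B_def)
    qed auto
    then obtain l where l: "((\<lambda>r. herglotz k (of_real r * cis \<theta>)) \<longlongrightarrow> l) (at_left 1)" by blast
    have "\<forall>\<^sub>F r in at_left (1::real). poisson k (of_real r * cis \<theta>) = Re (herglotz k (of_real r * cis \<theta>))"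
      using ev by eventually_elim (simp add: Re_herglotz k norm_mult)
    from Lim_transform_eventually[OF elim(1) this]
    have "((\<lambda>r. Re (herglotz k (of_real r * cis \<theta>))) \<longlongrightarrow> k \<theta>) (at_left 1)" .
    then have "Re l = k \<theta>"
      using tendsto_Re[OF l] tendsto_unique[OF trivial_limit_at_left_real] by blast
    with l show ?case by blast
  qed
qed

section \<open>Continuation across the circle\<close>

lemma real_symmetric_continuation:
  fixes F :: "complex \<Rightarrow> complex"
  assumes F: "F holomorphic_on ball 0 \<rho>" and \<rho>: "\<rho> \<ge> 1"
    and sym: "\<And>z. cmod z < 1 \<Longrightarrow> F (cnj z) = cnj (F z)" and z: "cmod z < \<rho>"
  shows "F (cnj z) = cnj (F z)"
proof -
  have H: "(\<lambda>z. cnj (F (cnj z))) holomorphic_on ball 0 \<rho>"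
  proof -
    have "cnj ` ball 0 \<rho> \<subseteq> ball 0 \<rho>" by auto
    from holomorphic_on_compose_cnj_cnj[OF holomorphic_on_subset[OF F this]] show ?thesis by (simp add: o_def)
  qed
  have "cnj (F (cnj z)) = F z"
  proof (rule analytic_continuation_open[of "ball 0 1" "ball 0 \<rho>" "\<lambda>z. cnj (F (cnj z))" F])
    show "cnj (F (cnj w)) = F w" if "w \<in> ball 0 1" for w using sym[of w] that by simp
  qed (use F H \<rho> z in auto)
  then show ?thesis by (metis complex_cnj_cnj)
qed

text \<open>Simple zeros of g at 1 and -1 are cancelled by those of 1 - z^2, so the quotient has
  removable singularities there. The remaining zeros of g lie outside the closed disc and only limit
  the radius.\<close>

lemma reciprocal_factor:
  fixes g :: "complex \<Rightarrow> complex"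
  assumes R: "R > 1" and g: "g holomorphic_on ball 0 R"
    and nz: "\<And>z. z \<in> cball 0 1 - {1,-1} \<Longrightarrow> g z \<noteq> 0"
    and s1: "g 1 = 0 \<longrightarrow> deriv g 1 \<noteq> 0" and s2: "g (-1) = 0 \<longrightarrow> deriv g (-1) \<noteq> 0"
  obtains \<rho> N where "1 < \<rho>" "\<rho> \<le> R" "N holomorphic_on ball 0 \<rho>" "\<And>z. cmod z < \<rho> \<Longrightarrow> N z * g z = 1 - z\<^sup>2"
proof -
  \<comment> \<open>On a compact disc of intermediate radius g has finitely many zeros, so those
    beyond the closed unit disc keep a positive distance from it.\<close>
  define R' where "R' = (1 + R) / 2"
  have R': "1 < R'" "R' < R" using R by (auto simp: R'_def)
  define Z where "Z = {z \<in> cball 0 R'. g z = 0}"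
  have "finite Z"
  proof (cases "g constant_on ball 0 R")
    case True
    then obtain c where c: "\<And>z. z \<in> ball 0 R \<Longrightarrow> g z = c" by (auto simp: constant_on_def)
    have "c \<noteq> 0" using c[of 0] nz[of 0] R by auto
    then have "Z = {}" using c R' by (auto simp: Z_def)
    then show ?thesis by simp
  next
    case False
    then show ?thesis unfolding Z_def
      using R' by (intro holomorphic_compact_finite_zeros[OF g]) auto
  qed
  define \<rho> where "\<rho> = Min (insert R' (cmod ` (Z - {1,-1})))"
  have fin: "finite (insert R' (cmod ` (Z - {1,-1})))" using \<open>finite Z\<close> by simp
  have \<rho>1: "1 < \<rho>"
    unfolding \<rho>_def using fin
  proof (subst Min_gr_iff)
    show "\<forall>a\<in>insert R' (cmod ` (Z - {1, - 1})). 1 < a"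
    proof (intro ballI)
      fix a assume "a \<in> insert R' (cmod ` (Z - {1,-1}))"
      then consider "a = R'" | z where "z \<in> Z" "z \<noteq> 1" "z \<noteq> -1" "a = cmod z" by auto
      then show "1 < a" using R' nz by cases (auto simp: Z_def not_less[symmetric])
    qed
  qed auto
  have \<rho>R': "\<rho> \<le> R'" unfolding \<rho>_def using fin by simp
  have zero: "z = 1 \<or> z = -1" if "cmod z < \<rho>" "g z = 0" for z
  proof (rule ccontr)
    assume "\<not> (z = 1 \<or> z = -1)"
    then have "cmod z \<in> insert R' (cmod ` (Z - {1,-1}))" using that \<rho>R' by (auto simp: Z_def)
    then have "\<rho> \<le> cmod z" unfolding \<rho>_def using fin by simp
    with that show False by simp
  qed
  have lim: "\<exists>c. ((\<lambda>z. (1 - z\<^sup>2) / g z) \<longlongrightarrow> c) (at a) \<and> c * g a = 0"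
    if a: "a = 1 \<or> a = -1" for a
  proof -
    have aR: "a \<in> ball 0 R" and a2: "a\<^sup>2 = 1" using a R by auto
    have der: "(g has_field_derivative deriv g a) (at a)"
      using g aR by (intro holomorphic_derivI) auto
    show ?thesis
    proof (cases "g a = 0")
      case False
      have "((\<lambda>z. (1 - z\<^sup>2) / g z) \<longlongrightarrow> (1 - a\<^sup>2) / g a) (at a)"
        using False DERIV_isCont[OF der] by (intro tendsto_intros) (auto simp: isCont_def)
      then show ?thesis using a2 by (intro exI[of _ 0]) auto
    next
      case True
      then have d0: "deriv g a \<noteq> 0" using a s1 s2 by auto
      have "((\<lambda>z. (g z - g a) / (z - a)) \<longlongrightarrow> deriv g a) (at a)" using der by (simp add: has_field_derivative_iff)
      then have "((\<lambda>z. - (z + a) / ((g z - g a) / (z - a))) \<longlongrightarrow> - (a + a) / deriv g a) (at a)"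
        using d0 by (intro tendsto_intros)
      moreover have "\<forall>\<^sub>F z in at a. - (z + a) / ((g z - g a) / (z - a)) = (1 - z\<^sup>2) / g z"
        unfolding eventually_at_filter
      proof (intro always_eventually allI impI)
        fix z assume "z \<noteq> a"
        have "- (z + a) * (z - a) = 1 - z\<^sup>2" using a2 by (simp add: power2_eq_square algebra_simps)
        then show "- (z + a) / ((g z - g a) / (z - a)) = (1 - z\<^sup>2) / g z"
          using True by (simp add: divide_divide_eq_right)
      qed
      ultimately have "((\<lambda>z. (1 - z\<^sup>2) / g z) \<longlongrightarrow> - (a + a) / deriv g a) (at a)"
        by (rule Lim_transform_eventually)
      then show ?thesis using True by auto
    qed
  qed
  \<comment> \<open>The value at 1 or -1 is the limit of the quotient. The clause
    \<open>c * g a = 0\<close> treats a zero of g and a nonzero value of g alike, and it is the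
    product relation at \<open>a\<close>, where 1 - a^2 = 0.\<close>
  define c where "c a = (SOME c. ((\<lambda>z. (1 - z\<^sup>2) / g z) \<longlongrightarrow> c) (at a) \<and> c * g a = 0)" for a
  have c: "((\<lambda>z. (1 - z\<^sup>2) / g z) \<longlongrightarrow> c a) (at a)" "c a * g a = 0" if "a = 1 \<or> a = -1" for a
    using someI_ex[OF lim[OF that]] by (auto simp: c_def)
  define N where "N z = (if z = 1 \<or> z = -1 then c z else (1 - z\<^sup>2) / g z)" for z
  show ?thesis
  proof
    show "1 < \<rho>" "\<rho> \<le> R" using \<rho>1 \<rho>R' R' by auto
    show "N holomorphic_on ball 0 \<rho>"
    proof (rule no_isolated_singularity'[where K="{1,-1}"])
      fix a :: complex assume "a \<in> {1,-1}"
      then have a: "a = 1 \<or> a = -1" by auto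
      have "\<forall>\<^sub>F z in at a. (1 - z\<^sup>2) / g z = N z"
        by (rule eventually_at[THEN iffD2], rule exI[of _ 1]) (use a in \<open>auto simp: N_def dist_norm norm_minus_commute\<close>)
      with c(1)[OF a] have "(N \<longlongrightarrow> c a) (at a)" by (rule Lim_transform_eventually)
      then show "(N \<longlongrightarrow> N a) (at a within ball 0 \<rho>)" using a
        by (auto simp: N_def intro: tendsto_within_subset)
    next
      have "(\<lambda>z. (1 - z\<^sup>2) / g z) holomorphic_on ball 0 \<rho> - {1,-1}"
        using zero \<rho>R' R' by (intro holomorphic_intros holomorphic_on_subset[OF g]) auto
      then show "N holomorphic_on ball 0 \<rho> - {1,-1}"
        by (rule holomorphic_transform) (auto simp: N_def)
    qed auto
    show "N z * g z = 1 - z\<^sup>2" if "cmod z < \<rho>" for z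
      using c(2)[of z] zero[OF that] by (auto simp: N_def)
  qed
qed

section \<open>Reflection of the angle and Herglotz integrals of analytic densities\<close>

lemma integral_circle_reflect:
  fixes f :: "real \<Rightarrow> 'a::{banach, second_countable_topology}"
  shows "(\<integral>\<phi>. f (2*pi - \<phi>) \<partial>circle) = (\<integral>\<phi>. f \<phi> \<partial>circle)"
proof -
  have "(\<integral>\<phi>. f \<phi> \<partial>circle) = (\<integral>\<phi>. indicator {0..2*pi} \<phi> *\<^sub>R f \<phi> \<partial>lborel)"
    by (simp add: integral_circle_eq set_lebesgue_integral_def)
  also have "\<dots> = \<bar>-1\<bar> *\<^sub>R (\<integral>\<phi>. indicator {0..2*pi} (2*pi + (-1) * \<phi>) *\<^sub>R f (2*pi + (-1) * \<phi>) \<partial>lborel)"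
    by (rule lborel_integral_real_affine) simp
  also have "\<dots> = (\<integral>\<phi>. indicator {0..2*pi} \<phi> *\<^sub>R f (2*pi - \<phi>) \<partial>lborel)"
    by (simp, intro Bochner_Integration.integral_cong) (auto split: split_indicator)
  finally show ?thesis by (simp add: integral_circle_eq set_lebesgue_integral_def)
qed

lemma cis_reflect: "cis (2*pi - \<phi>) = cnj (cis \<phi>)"
  by (simp add: complex_eq_iff cos_diff sin_diff)

lemma herglotz_cnj:
  assumes k: "\<And>\<phi>. k (2*pi - \<phi>) = k \<phi>"
  shows "herglotz k (cnj z) = cnj (herglotz k z)"
proof -
  have "(\<integral>\<phi>. (cis \<phi> + cnj z) / (cis \<phi> - cnj z) * complex_of_real (k \<phi>) \<partial>circle)
    = (\<integral>\<phi>. (cis (2*pi-\<phi>) + cnj z) / (cis (2*pi-\<phi>) - cnj z) * complex_of_real (k (2*pi-\<phi>)) \<partial>circle)"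
    by (rule integral_circle_reflect[symmetric])
  also have "\<dots> = (\<integral>\<phi>. cnj ((cis \<phi> + z) / (cis \<phi> - z) * complex_of_real (k \<phi>)) \<partial>circle)"
    unfolding k cis_reflect by simp
  also have "\<dots> = cnj (\<integral>\<phi>. (cis \<phi> + z) / (cis \<phi> - z) * complex_of_real (k \<phi>) \<partial>circle)"
    by (rule Bochner_Integration.integral_cnj)
  finally show ?thesis by (simp add: herglotz_def)
qed

lemma circlepath_integral_annulus_eq:
  assumes "f holomorphic_on {w. a < cmod w \<and> cmod w < b}" "0 \<le> a" "a < r" "r < b" "a < s" "s < b"
  shows "contour_integral (circlepath 0 r) f = contour_integral (circlepath 0 s) f"
proof (rule Cauchy_theorem_homotopic_loops)
  let ?S = "{w::complex. a < cmod w \<and> cmod w < b}"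
  show "open ?S" by (intro open_Collect_conj open_Collect_less continuous_intros)
  show "f holomorphic_on ?S" by fact
  show "homotopic_loops ?S (circlepath 0 r) (circlepath 0 s)"
  proof (rule homotopic_loops_linear)
    fix t :: real assume "t \<in> {0..1}"
    show "closed_segment (circlepath 0 r t) (circlepath 0 s t) \<subseteq> ?S"
    proof
      fix w assume "w \<in> closed_segment (circlepath 0 r t) (circlepath 0 s t)"
      then obtain u where u: "0 \<le> u" "u \<le> 1" "w = (1 - u) *\<^sub>R circlepath 0 r t + u *\<^sub>R circlepath 0 s t"
        by (auto simp: in_segment)
      define q where "q = (1 - u) * r + u * s"
      have "w = of_real q * exp (2 * of_real pi * \<i> * of_real t)"
        unfolding u(3) q_def by (simp add: circlepath scaleR_conv_of_real algebra_simps)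
      then have "cmod w = \<bar>q\<bar>" by (simp add: norm_mult)
      moreover have "a < q" unfolding q_def
        using convex_bound_lt[of "-r" "-a" "-s" "1-u" u] assms u by simp
      moreover have "q < b" unfolding q_def
        using convex_bound_lt[of "r" "b" "s" "1-u" u] assms u by simp
      ultimately show "w \<in> ?S" using assms by simp
    qed
  qed auto
qed auto

lemma herglotz_contour:
  assumes k: "\<And>\<phi>. G (cis \<phi>) = complex_of_real (k \<phi>)" and G: "continuous_on (sphere 0 1) G" and z: "cmod z < 1"
  shows "herglotz k z = contour_integral (circlepath 0 1) (\<lambda>w. (w + z) / (w - z) * G w / w) / (2 * pi * \<i>)"
proof -
  have "contour_integral (circlepath 0 1) (\<lambda>w. (w + z) / (w - z) * G w / w)
    = \<i> * (\<integral>\<phi>. cis \<phi> * ((cis \<phi> + z) / (cis \<phi> - z) * G (cis \<phi>) / cis \<phi>) \<partial>circle)"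
    using z by (intro integral_circle_contour continuous_intros G) auto
  also have "\<dots> = \<i> * (\<integral>\<phi>. (cis \<phi> + z) / (cis \<phi> - z) * complex_of_real (k \<phi>) \<partial>circle)"
    by (simp add: k)
  finally show ?thesis by (simp add: herglotz_def)
qed

text \<open>By the symmetry of N the density is N(w) N(1/w) / 2 on the circle, and this is
  holomorphic in an annulus. The contour can therefore be pushed out to radius \<sigma>, and the
  integral over the larger circle is holomorphic inside it. The functional equation holds on the
  circle, where K(z) + K(1/z) is 2 Re K, and spreads over the annulus by the identity
  theorem.\<close>

lemma herglotz_extension:
  fixes N :: "complex \<Rightarrow> complex"
  assumes N: "N holomorphic_on ball 0 \<rho>" and \<rho>: "\<rho> > 1"
    and sym: "\<And>z. cmod z < \<rho> \<Longrightarrow> N (cnj z) = cnj (N z)"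
  defines "k \<equiv> \<lambda>\<phi>. (cmod (N (cis \<phi>)))\<^sup>2 / 2"
  obtains K \<sigma> where "1 < \<sigma>" "\<sigma> \<le> \<rho>" "K holomorphic_on ball 0 \<sigma>" "\<And>z. cmod z < 1 \<Longrightarrow> K z = herglotz k z"
    "\<And>z. 1/\<sigma> < cmod z \<Longrightarrow> cmod z < \<sigma> \<Longrightarrow> K z + K (inverse z) = N z * N (inverse z)"
    "\<And>\<phi>. Re (K (cis \<phi>)) = k \<phi>"
proof -
  define G where "G w = N w * N (inverse w) / 2" for w
  define A where "A a b = {w::complex. a < cmod w \<and> cmod w < b}" for a b
  have A_open: "open (A a b)" for a b
    unfolding A_def by (intro open_Collect_conj open_Collect_less continuous_intros)
  have inv: "cmod (inverse w) < \<sigma>" if "0 < \<sigma>" "1/\<sigma> < cmod w" for w \<sigma>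
  proof -
    have "0 < cmod w" using that by (meson divide_pos_pos less_trans zero_less_one)
    moreover from this have "inverse (cmod w) < \<sigma>" using that by (simp add: field_simps)
    ultimately show ?thesis by (simp only: norm_inverse)
  qed
  have G: "G holomorphic_on A (1/\<rho>) \<rho>" unfolding G_def
  proof (intro holomorphic_intros holomorphic_on_subset[OF N] holomorphic_on_compose_gen[OF _ N, unfolded o_def])
    show "w \<noteq> 0" if "w \<in> A (1/\<rho>) \<rho>" for w
    proof -
      have "0 < 1 / \<rho>" using \<rho> by simp
      then have "0 < cmod w" using that unfolding A_def by (smt (verit) mem_Collect_eq)
      then show ?thesis by simp
    qed
    show "inverse ` A (1/\<rho>) \<rho> \<subseteq> ball 0 \<rho>" using inv[of \<rho>] \<rho> by (auto simp: A_def)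
  qed (auto simp: A_def)
  have Gk: "G (cis \<phi>) = complex_of_real (k \<phi>)" for \<phi>
  proof -
    have "inverse (cis \<phi>) = cnj (cis \<phi>)" by (simp add: cis_inverse cis_cnj)
    moreover have "N (cnj (cis \<phi>)) = cnj (N (cis \<phi>))" using \<rho> by (intro sym) simp
    ultimately show ?thesis by (simp add: G_def k_def complex_norm_square[symmetric])
  qed
  obtain \<sigma> where \<sigma>: "1 < \<sigma>" "\<sigma> < \<rho>" using dense[OF \<rho>] by blast
  have Gc: "continuous_on (A (1/\<rho>) \<rho>) G" using G by (rule holomorphic_on_imp_continuous_on)
  have \<rho>i: "1/\<rho> < 1" using \<rho> by simp
  have Gs: "continuous_on (sphere 0 1) G" using Gc by (rule continuous_on_subset) (use \<rho> in \<open>auto simp: A_def\<close>)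
  have G\<sigma>: "continuous_on (sphere 0 \<sigma>) G" using Gc
    by (rule continuous_on_subset) (use \<sigma> less_trans[OF \<rho>i \<sigma>(1)] in \<open>auto simp: A_def\<close>)
  \<comment> \<open>The kernel splits as (w + z) / ((w - z) w) = 2 / (w - z) - 1 / w. This is the
    source of \<open>C\<close>, \<open>H\<close> and the combination
    \<open>2 * H z - C\<close>.\<close>
  define C where "C = contour_integral (circlepath 0 \<sigma>) (\<lambda>w. G w / w)"
  define H where "H z = contour_integral (circlepath 0 \<sigma>) (\<lambda>w. G w / (w - z))" for z
  define K where "K z = (2 * H z - C) / (2 * pi * \<i>)" for z
  have ci: "(\<lambda>w. G w / (w - z)) contour_integrable_on circlepath 0 \<sigma>" if "cmod z < \<sigma>" for z
    using \<sigma> that by (intro contour_integrable_continuous_circlepath continuous_intros)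
      (auto intro!: G\<sigma> simp: path_image_circlepath)
  have "(H has_field_derivative (1 * contour_integral (circlepath 0 \<sigma>) (\<lambda>u. G u / (u - z)^Suc 1))) (at z)" if "z \<in> ball 0 \<sigma>" for z
  proof -
    have "(H has_field_derivative (of_nat 1 * contour_integral (circlepath 0 \<sigma>) (\<lambda>u. G u / (u - z)^Suc 1))) (at z)"
    proof (rule Cauchy_next_derivative_circlepath)
      show "continuous_on (path_image (circlepath 0 \<sigma>)) G" using G\<sigma> \<sigma> by simp
      show "((\<lambda>u. G u / (u - w) ^ 1) has_contour_integral H w) (circlepath 0 \<sigma>)" if "w \<in> ball 0 \<sigma>" for w
        using ci[of w] that by (simp add: H_def has_contour_integral_integral)
    qed (use that in auto)
    then show ?thesis by simp
  qed
  then have Hh: "H holomorphic_on ball 0 \<sigma>"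
    by (intro holomorphic_onI) (auto simp: field_differentiable_def intro: has_field_derivative_at_within)
  have Kh: "K holomorphic_on ball 0 \<sigma>" unfolding K_def by (intro holomorphic_intros Hh) auto
  have KH: "K z = herglotz k z" if z: "cmod z < 1" for z
  proof -
    let ?F = "\<lambda>w. (w + z) / (w - z) * G w / w"
    \<comment> \<open>The annulus swept by the contour has to avoid the pole at z and stay in the
      domain of G.\<close>
    define a where "a = max (cmod z) (1/\<rho>)"
    have a: "0 \<le> a" "a < 1" using z \<rho> by (auto simp: a_def le_max_iff_disj)
    have "?F holomorphic_on {w. a < cmod w \<and> cmod w < \<rho>}"
      using a by (intro holomorphic_intros holomorphic_on_subset[OF G]) (auto simp: A_def a_def)
    then have "contour_integral (circlepath 0 1) ?F = contour_integral (circlepath 0 \<sigma>) ?F"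
      using a \<sigma> by (intro circlepath_integral_annulus_eq[of _ a \<rho>]) auto
    also have "\<dots> = contour_integral (circlepath 0 \<sigma>) (\<lambda>w. 2 * (G w / (w - z)) - G w / w)"
    proof (rule contour_integral_cong)
      fix w assume "w \<in> path_image (circlepath 0 \<sigma>)"
      then have "cmod w = \<sigma>" using \<sigma> by simp
      then have "w \<noteq> 0" "w - z \<noteq> 0" using z \<sigma> by auto
      then show "?F w = 2 * (G w / (w - z)) - G w / w" by (simp add: field_simps)
    qed simp
    also have "\<dots> = 2 * H z - C"
    proof -
      have c1: "(\<lambda>w. G w / (w - z)) contour_integrable_on circlepath 0 \<sigma>" using z \<sigma> by (intro ci) auto
      have c0: "(\<lambda>w. G w / w) contour_integrable_on circlepath 0 \<sigma>" using ci[of 0] \<sigma> by simp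
      show ?thesis unfolding H_def C_def
        using contour_integral_diff[OF contour_integrable_lmul[OF c1, of 2] c0] contour_integral_lmul[OF c1, of 2]
        by simp
    qed
    finally show ?thesis unfolding K_def using herglotz_contour[OF Gk Gs z] by simp
  qed
  have ksym: "k (2*pi - \<phi>) = k \<phi>" for \<phi>
    using sym[of "cis \<phi>"] \<rho> by (simp add: k_def cis_reflect)
  have Ksym: "K (cnj z) = cnj (K z)" if "cmod z < \<sigma>" for z
    by (rule real_symmetric_continuation[OF Kh]) (use \<sigma> that in \<open>auto simp: KH herglotz_cnj ksym\<close>)
  have cN: "continuous_on UNIV (\<lambda>\<phi>. N (cis \<phi>))"
    using holomorphic_on_imp_continuous_on[OF N]
    by (rule continuous_on_compose2) (use \<rho> in \<open>auto intro!: continuous_intros\<close>)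
  have ck: "continuous_on UNIV k" unfolding k_def using cN by (intro continuous_intros) auto
  have ik: "integrable circle k" using ck by (intro integrable_circle_continuous) (auto intro: continuous_on_subset)
  have ReK': "Re (K (cis \<theta>)) = k \<theta>" if \<theta>: "0 < \<theta>" "\<theta> < 2*pi" for \<theta>
  proof -
    have "isCont K (cis \<theta>)"
      using holomorphic_on_imp_continuous_on[OF Kh] \<sigma> by (simp add: continuous_on_eq_continuous_at)
    moreover have "((\<lambda>r. complex_of_real r * cis \<theta>) \<longlongrightarrow> complex_of_real 1 * cis \<theta>) (at_left 1)"
      by (intro tendsto_intros)
    ultimately have lim: "((\<lambda>r. Re (K (of_real r * cis \<theta>))) \<longlongrightarrow> Re (K (cis \<theta>))) (at_left 1)"
      by (intro tendsto_Re isCont_tendsto_compose[of _ K]) auto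
    have "\<forall>\<^sub>F r in at_left (1::real). poisson k (of_real r * cis \<theta>) = Re (K (of_real r * cis \<theta>))"
      unfolding eventually_at_left_field
      by (rule exI[of _ 0]) (auto simp: KH Re_herglotz ik norm_mult)
    note ev = this
    have "((\<lambda>r. Re (K (of_real r * cis \<theta>))) \<longlongrightarrow> k \<theta>) (at_left 1)"
      by (rule Lim_transform_eventually[OF poisson_tendsto_continuous[OF ck \<theta>] ev])
    then show ?thesis by (rule tendsto_unique[OF trivial_limit_at_left_real lim])
  qed
  have ker: "inverse (cis \<phi>) = cnj (cis \<phi>)" for \<phi> by (simp add: cis_inverse cis_cnj)
  have twoRe: "K (cis \<phi>) + K (inverse (cis \<phi>)) = complex_of_real (2 * Re (K (cis \<phi>)))" for \<phi>
    unfolding ker using \<sigma> Ksym[of "cis \<phi>"] by (simp add: complex_add_cnj)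
  \<comment> \<open>The circle without the point 1, because the boundary limits in
    \<open>ReK'\<close> are available only for angles strictly between 0 and 2 pi. It is connected
    and has -1 as a limit point, as the identity theorem requires.\<close>
  define U where "U = cis ` {0<..<2*pi}"
  have rel: "K z + K (inverse z) - 2 * G z = 0" if z: "z \<in> A (1/\<sigma>) \<sigma>" for z
  proof (rule analytic_continuation[where S="A (1/\<sigma>) \<sigma>" and U=U and \<xi>="-1" and f="\<lambda>z. K z + K (inverse z) - 2 * G z"])
    have nz: "w \<noteq> 0" if "w \<in> A (1/\<sigma>) \<sigma>" for w
      using that \<sigma> by (auto simp: A_def)
    have sub: "A (1/\<sigma>) \<sigma> \<subseteq> A (1/\<rho>) \<rho>"
    proof -
      have "1/\<rho> < 1/\<sigma>" using \<sigma> by (simp add: field_simps)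
      then show ?thesis using \<sigma> by (auto simp: A_def)
    qed
    show "(\<lambda>z. K z + K (inverse z) - 2 * G z) holomorphic_on A (1/\<sigma>) \<sigma>"
      using inv[of \<sigma>] \<sigma> nz
      by (intro holomorphic_intros holomorphic_on_subset[OF Kh] holomorphic_on_subset[OF G sub]
            holomorphic_on_compose_gen[OF _ Kh, unfolded o_def]) (auto simp: A_def)
    show "open (A (1/\<sigma>) \<sigma>)" by (rule A_open)
    show "connected (A (1/\<sigma>) \<sigma>)"
      using connected_annulus(1)[where 'N=complex, of "1/\<sigma>" 0 \<sigma>] by (simp add: A_def)
    show "U \<subseteq> A (1/\<sigma>) \<sigma>" using \<sigma> by (auto simp: A_def U_def)
    show "-1 \<in> A (1/\<sigma>) \<sigma>" using \<sigma> by (auto simp: A_def)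
    have "-1 \<in> U" unfolding U_def by (rule image_eqI[of _ _ pi]) (auto simp: complex_eq_iff)
    moreover have "cis (pi/2) \<in> U" unfolding U_def by (intro imageI) auto
    moreover have "cis (pi/2) \<noteq> -1" by (simp add: complex_eq_iff)
    ultimately have "\<not> (\<exists>a. U = {a})" by auto
    moreover have "connected U" unfolding U_def by (intro connected_continuous_image continuous_intros) auto
    ultimately show "-1 islimpt U" using \<open>-1 \<in> U\<close> by (intro connected_imp_perfect) auto
    fix w assume "w \<in> U"
    then obtain \<theta> where "0 < \<theta>" "\<theta> < 2*pi" "w = cis \<theta>" by (auto simp: U_def)
    then show "K w + K (inverse w) - 2 * G w = 0" by (simp add: twoRe ReK' Gk del: cis_inverse)
  qed (rule z)
  show ?thesis
  proof
    show "1 < \<sigma>" "\<sigma> \<le> \<rho>" using \<sigma> by auto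
    show "K holomorphic_on ball 0 \<sigma>" by (rule Kh)
    show "K z = herglotz k z" if "cmod z < 1" for z using that by (rule KH)
    show "K z + K (inverse z) = N z * N (inverse z)" if "1/\<sigma> < cmod z" "cmod z < \<sigma>" for z
      using rel[of z] that by (simp add: A_def G_def)
    \<comment> \<open>The relation on the whole annulus recovers the point 1 that
      \<open>ReK'\<close> leaves out.\<close>
    show "Re (K (cis \<phi>)) = k \<phi>" for \<phi>
    proof -
      have "complex_of_real (2 * Re (K (cis \<phi>))) = 2 * G (cis \<phi>)"
        using rel[of "cis \<phi>"] \<sigma> twoRe[of \<phi>] by (simp add: A_def del: cis_inverse)
      also have "\<dots> = complex_of_real (2 * k \<phi>)" by (simp add: Gk)
      finally show ?thesis unfolding of_real_eq_iff by simp
    qed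
  qed
qed

section \<open>Outer functions\<close>

lemma AE_circle_not_singular: "AE \<phi> in circle. \<phi> \<in> {0..2*pi} \<and> sin \<phi> \<noteq> 0"
proof -
  have *: "\<phi> \<in> {0..2*pi} \<Longrightarrow> sin \<phi> = 0 \<Longrightarrow> \<phi> = 0 \<or> \<phi> = pi \<or> \<phi> = 2*pi" for \<phi>
  proof -
    assume a: "\<phi> \<in> {0..2*pi}" "sin \<phi> = 0"
    then obtain i :: int where i: "\<phi> = of_int i * pi" using sin_zero_iff_int2 by auto
    have "0 * pi \<le> of_int i * pi" "of_int i * pi \<le> of_int 2 * pi" using a i by auto
    then have "0 \<le> i" "i \<le> 2" unfolding mult_le_cancel_right_pos[OF pi_gt_zero] by simp_all
    then have "i = 0 \<or> i = 1 \<or> i = 2" by auto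
    then show "\<phi> = 0 \<or> \<phi> = pi \<or> \<phi> = 2*pi" using i by auto
  qed
  show ?thesis unfolding AE_circle_iff
    using AE_lborel_singleton[of 0] AE_lborel_singleton[of "pi"] AE_lborel_singleton[of "2*pi"]
    by eventually_elim (use * in blast)
qed

lemma norm_one_minus_cis_sq: "cmod (1 - (cis \<phi>)\<^sup>2) = 2 * \<bar>sin \<phi>\<bar>"
proof -
  have "1 - (cis \<phi>)\<^sup>2 = - (2 * \<i> * complex_of_real (sin \<phi>)) * cis \<phi>"
  proof -
    have 1: "(cos \<phi>)\<^sup>2 + (sin \<phi>)\<^sup>2 = 1" by simp
    show ?thesis using 1 by (simp add: complex_eq_iff power2_eq_square algebra_simps)
  qed
  then show ?thesis by (simp add: norm_mult)
qed

text \<open>The dilated functions ln |1 - r^2 e^(2 i phi)| are real parts of holomorphic functions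
  vanishing at 0, so their means are 0, and they are bounded above by ln 2. Fatou's lemma applied to
  ln 2 minus these functions bounds the integral of the limit by 2 pi ln 2.\<close>

lemma integrable_ln_abs_sin: "integrable circle (\<lambda>\<phi>. ln (cmod (1 - (cis \<phi>)\<^sup>2)))"
proof -
  define r where "r n = 1 - (1/2::real)^Suc n" for n :: nat
  have r: "0 < r n" "r n < 1" for n using power_Suc_less_one[of "1/2::real" n] by (simp_all add: r_def del: power_Suc)
  have "(\<lambda>n. 1 - (1/2::real)^Suc n) \<longlonglongrightarrow> 1 - 0"
    by (intro tendsto_diff tendsto_const LIMSEQ_Suc LIMSEQ_power_zero) simp
  then have rlim: "r \<longlonglongrightarrow> 1" by (simp add: r_def[abs_def])
  define l where "l n \<phi> = ln (cmod (1 - (of_real (r n))\<^sup>2 * (cis \<phi>)\<^sup>2))" for n \<phi>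
  have small: "cmod ((of_real (r n))\<^sup>2 * (cis \<phi>)\<^sup>2) < 1" for n \<phi>
    using r[of n] by (simp add: norm_mult norm_power power_less_one_iff abs_less_iff)
  have nz: "1 - (complex_of_real (r n))\<^sup>2 * (cis \<phi>)\<^sup>2 \<noteq> 0" for n \<phi>
    using small[of n \<phi>] by auto
  have lc: "continuous_on A (l n)" for n A unfolding l_def using nz by (intro continuous_intros) auto
  have li: "integrable circle (l n)" for n using lc by (rule integrable_circle_continuous)
  have lle: "l n \<phi> \<le> ln 2" for n \<phi>
  proof -
    have "cmod (1 - (of_real (r n))\<^sup>2 * (cis \<phi>)\<^sup>2) \<le> cmod 1 + cmod ((of_real (r n))\<^sup>2 * (cis \<phi>)\<^sup>2)"
      by (rule norm_triangle_ineq4)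
    also have "\<dots> \<le> 2" using small[of n \<phi>] by simp
    finally show ?thesis unfolding l_def using nz[of n \<phi>] by (subst ln_le_cancel_iff) auto
  qed
  have mean: "(\<integral>\<phi>. l n \<phi> \<partial>circle) = 0" for n
  proof -
    define F where "F w = Ln (1 - (of_real (r n))\<^sup>2 * w\<^sup>2)" for w
    have sm: "cmod ((of_real (r n))\<^sup>2 * w\<^sup>2) < 1" if "w \<in> ball 0 (1 / r n)" for w
    proof -
      have "cmod (of_real (r n) * w) < 1" using that r[of n] by (simp add: norm_mult field_simps)
      then have "(cmod (of_real (r n) * w))\<^sup>2 < 1" by (simp add: power_less_one_iff)
      then show ?thesis by (simp add: norm_mult norm_power power_mult_distrib)
    qed
    have nn: "1 - (complex_of_real (r n))\<^sup>2 * w\<^sup>2 \<notin> \<real>\<^sub>\<le>\<^sub>0" if "w \<in> ball 0 (1 / r n)" for w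
    proof
      assume "1 - (of_real (r n))\<^sup>2 * w\<^sup>2 \<in> \<real>\<^sub>\<le>\<^sub>0"
      then have "Re (1 - (of_real (r n))\<^sup>2 * w\<^sup>2) \<le> 0" unfolding complex_nonpos_Reals_iff by blast
      then show False using complex_Re_le_cmod[of "(of_real (r n))\<^sup>2 * w\<^sup>2"] sm[OF that] by simp
    qed
    have F: "F holomorphic_on ball 0 (1 / r n)" unfolding F_def using nn by (intro holomorphic_intros) auto
    have r1: "1 / r n > 1" using r[of n] by simp
    have "(\<integral>\<phi>. F (cis \<phi>) \<partial>circle) = 0" using mean_value_circle[OF F r1] by (simp add: F_def)
    then have "Re (\<integral>\<phi>. F (cis \<phi>) \<partial>circle) = 0" by simp
    moreover have "Re (\<integral>\<phi>. F (cis \<phi>) \<partial>circle) = (\<integral>\<phi>. Re (F (cis \<phi>)) \<partial>circle)"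
    proof (intro integral_Re[symmetric] integrable_circle_continuous)
      show "continuous_on {0..2*pi} (\<lambda>x. F (cis x))"
        using holomorphic_on_imp_continuous_on[OF F]
        by (rule continuous_on_compose2) (use r1 in \<open>auto intro!: continuous_intros\<close>)
    qed
    moreover have "Re (F (cis \<phi>)) = l n \<phi>" for \<phi>
      unfolding F_def l_def using nz by (subst Re_Ln) auto
    ultimately show ?thesis by simp
  qed
  define L where "L \<phi> = ln (cmod (1 - (cis \<phi>)\<^sup>2))" for \<phi>
  have Lm[measurable]: "L \<in> borel_measurable circle"
  proof -
    have "(\<lambda>\<phi>. cmod (1 - (cis \<phi>)\<^sup>2)) \<in> borel_measurable borel"
      by (intro borel_measurable_continuous_onI continuous_intros)
    then show ?thesis unfolding L_def[abs_def] by (intro measurable_circleI borel_measurable_ln)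
  qed
  have [measurable]: "l n \<in> borel_measurable circle" for n using li by (rule borel_measurable_integrable)
  have lim: "(\<lambda>n. l n \<phi>) \<longlonglongrightarrow> L \<phi>" if "sin \<phi> \<noteq> 0" for \<phi>
  proof -
    have "(\<lambda>n. l n \<phi>) \<longlonglongrightarrow> ln (cmod (1 - (of_real 1)\<^sup>2 * (cis \<phi>)\<^sup>2))"
      unfolding l_def using that norm_one_minus_cis_sq[of \<phi>] by (intro tendsto_intros rlim) auto
    then show ?thesis by (simp add: L_def)
  qed
  have Lle: "L \<phi> \<le> ln 2" for \<phi>
  proof -
    have "cmod (1 - (cis \<phi>)\<^sup>2) \<le> 2" unfolding norm_one_minus_cis_sq by simp
    then show ?thesis unfolding L_def by (cases "cmod (1 - (cis \<phi>)\<^sup>2) = 0") (auto simp: ln_le_cancel_iff)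
  qed
  have "(\<integral>\<^sup>+\<phi>. ennreal (ln 2 - L \<phi>) \<partial>circle) \<le> (\<integral>\<^sup>+\<phi>. liminf (\<lambda>n. ennreal (ln 2 - l n \<phi>)) \<partial>circle)"
  proof (rule nn_integral_mono_AE)
    show "AE \<phi> in circle. ennreal (ln 2 - L \<phi>) \<le> liminf (\<lambda>n. ennreal (ln 2 - l n \<phi>))"
      using AE_circle_not_singular
    proof eventually_elim
      case (elim \<phi>)
      have "(\<lambda>n. ennreal (ln 2 - l n \<phi>)) \<longlonglongrightarrow> ennreal (ln 2 - L \<phi>)"
        using elim by (intro tendsto_ennrealI tendsto_intros lim) auto
      then show ?case by (simp add: lim_imp_Liminf)
    qed
  qed
  also have "\<dots> \<le> liminf (\<lambda>n. \<integral>\<^sup>+\<phi>. ennreal (ln 2 - l n \<phi>) \<partial>circle)"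
    by (intro nn_integral_liminf) measurable
  also have "\<dots> = liminf (\<lambda>n::nat. ennreal (2*pi*ln 2))"
  proof -
    have "(\<integral>\<^sup>+\<phi>. ennreal (ln 2 - l n \<phi>) \<partial>circle) = ennreal (2*pi*ln 2)" for n
    proof -
      have "(\<integral>\<^sup>+\<phi>. ennreal (ln 2 - l n \<phi>) \<partial>circle) = ennreal (\<integral>\<phi>. ln 2 - l n \<phi> \<partial>circle)"
        using li lle by (intro nn_integral_eq_integral) auto
      also have "(\<integral>\<phi>. ln 2 - l n \<phi> \<partial>circle) = 2*pi*ln 2"
        using li mean[of n] by (simp add: measure_circle space_restrict_space)
      finally show ?thesis .
    qed
    then show ?thesis by simp
  qed
  also have "\<dots> < \<infinity>" by (simp add: Liminf_const)
  finally have "integrable circle (\<lambda>\<phi>. ln 2 - L \<phi>)"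
    using Lle by (intro integrableI_nonneg) (auto intro!: AE_I2)
  from Bochner_Integration.integrable_diff[OF circle.integrable_const this, of "ln 2"]
  show ?thesis by (simp add: L_def)
qed

text \<open>Dilations of a logarithm of U satisfy the Schwarz formula, and passing to radius 1 calls
  for a dominating function. As N is bounded, N U = 1 - z^2 bounds |U| below by a multiple of |1 -
  z^2|, so ln |1 - e^(2 i phi)| supplies the majorant. Positivity of U at 0 removes the free
  imaginary constant.\<close>

lemma outer_representation:
  fixes U N :: "complex \<Rightarrow> complex"
  assumes U: "U holomorphic_on ball 0 \<rho>" and N: "N holomorphic_on ball 0 \<rho>" and \<rho>: "\<rho> > 1"
    and NU: "\<And>z. cmod z < \<rho> \<Longrightarrow> N z * U z = 1 - z\<^sup>2"
    and c: "U 0 = complex_of_real c" "c > 0"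
  shows "integrable circle (\<lambda>\<phi>. ln (cmod (U (cis \<phi>))))"
    and "cmod z < 1 \<Longrightarrow> U z = exp (herglotz (\<lambda>\<phi>. ln (cmod (U (cis \<phi>)))) z)"
proof -
  have Unz: "U z \<noteq> 0" if "cmod z < 1" for z
  proof
    assume "U z = 0"
    then have "z\<^sup>2 = 1" using NU[of z] that \<rho> by simp
    then have "cmod z = 1" by (auto simp: power2_eq_1_iff)
    with that show False by simp
  qed
  have Uc: "continuous_on (ball 0 \<rho>) U" and Nc: "continuous_on (ball 0 \<rho>) N"
    using U N by (auto intro: holomorphic_on_imp_continuous_on)
  have sub: "cball 0 1 \<subseteq> ball (0::complex) \<rho>" using \<rho> by auto
  have "bounded (N ` cball 0 1)" "bounded (U ` cball 0 1)"
    using continuous_on_subset[OF Nc sub] continuous_on_subset[OF Uc sub]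
    by (auto intro!: compact_imp_bounded compact_continuous_image)
  then obtain C1 C2 where C: "\<And>z. z \<in> cball 0 1 \<Longrightarrow> cmod (N z) \<le> C1" "\<And>z. z \<in> cball 0 1 \<Longrightarrow> cmod (U z) \<le> C2"
    unfolding bounded_iff by (metis imageI)
  define C where "C = max 1 (max C1 C2)"
  have C1: "cmod (N z) \<le> C" and C2: "cmod (U z) \<le> C" if "cmod z \<le> 1" for z
    using C[of z] that by (auto simp: C_def)
  have Cge: "C \<ge> 1" by (simp add: C_def)
  define L where "L \<phi> = ln (cmod (1 - (cis \<phi>)\<^sup>2))" for \<phi>
  have Li: "integrable circle L" unfolding L_def by (rule integrable_ln_abs_sin)
  have bound: "\<bar>ln (cmod (U (of_real r * cis \<phi>)))\<bar> \<le> 2 * ln C + 2 * ln 2 + \<bar>L \<phi>\<bar>"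
    if r: "0 \<le> r" "r \<le> 1" and s: "sin \<phi> \<noteq> 0" for r \<phi>
  proof -
    define z where "z = of_real r * cis \<phi>"
    have z: "cmod z \<le> 1" using r by (simp add: z_def norm_mult)
    have z2: "z\<^sup>2 = of_real (r\<^sup>2) * (cis \<phi>)\<^sup>2" by (simp add: z_def power_mult_distrib)
    have q0: "cmod (1 - (cis \<phi>)\<^sup>2) > 0" using s norm_one_minus_cis_sq[of \<phi>] by simp
    have r2: "r\<^sup>2 \<le> 1" using r by (simp add: power_le_one)
    \<comment> \<open>Moving inward along a radius shrinks |1 - z^2| by at most a factor 2, because
      z^2 moves by 1 - r^2 and this is itself at most |1 - z^2|.\<close>
    have "cmod (1 - (cis \<phi>)\<^sup>2) \<le> cmod (1 - z\<^sup>2) + cmod (z\<^sup>2 - (cis \<phi>)\<^sup>2)"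
      using norm_triangle_ineq[of "1 - z\<^sup>2" "z\<^sup>2 - (cis \<phi>)\<^sup>2"] by simp
    also have "z\<^sup>2 - (cis \<phi>)\<^sup>2 = of_real (r\<^sup>2 - 1) * (cis \<phi>)\<^sup>2" by (simp add: z2 algebra_simps)
    also have "cmod \<dots> = 1 - r\<^sup>2" using r2 by (simp only: norm_mult norm_power norm_of_real norm_cis) simp
    also have "1 - r\<^sup>2 \<le> cmod (1 - z\<^sup>2)"
    proof -
      have "cmod (z\<^sup>2) = r\<^sup>2" using r by (simp add: z_def norm_mult norm_power)
      then show ?thesis using norm_triangle_ineq2[of 1 "z\<^sup>2"] by simp
    qed
    finally have q: "cmod (1 - (cis \<phi>)\<^sup>2) \<le> 2 * cmod (1 - z\<^sup>2)" by simp
    also have "cmod (1 - z\<^sup>2) = cmod (N z) * cmod (U z)" using NU[of z] z \<rho> by (simp flip: norm_mult)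
    also have "\<dots> \<le> C * cmod (U z)" using C1[OF z] by (intro mult_right_mono) auto
    finally have q2: "cmod (1 - (cis \<phi>)\<^sup>2) \<le> 2 * C * cmod (U z)" by simp
    then have u0: "cmod (U z) > 0" using q0 Cge by (smt (verit) mult_nonneg_nonpos norm_ge_zero)
    have "L \<phi> \<le> ln (2 * C * cmod (U z))" unfolding L_def using q0 q2 by (intro ln_mono) auto
    also have "\<dots> = ln 2 + ln C + ln (cmod (U z))" using u0 Cge by (simp add: ln_mult)
    finally have lo: "L \<phi> - ln 2 - ln C \<le> ln (cmod (U z))" by simp
    have hi: "ln (cmod (U z)) \<le> ln C" using C2[OF z] u0 by (intro ln_mono) auto
    have "ln C \<ge> 0" "ln 2 \<ge> (0::real)" using Cge by auto
    then show ?thesis using lo hi unfolding z_def[symmetric] by linarith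
  qed
  have cisU: "continuous_on A (\<lambda>\<phi>. U (of_real r * cis \<phi>))" if "0 \<le> r" "r \<le> 1" for r A
    using Uc by (rule continuous_on_compose2) (use that \<rho> in \<open>auto intro!: continuous_intros simp: norm_mult\<close>)
  have meas: "(\<lambda>\<phi>. ln (cmod (U (of_real r * cis \<phi>)))) \<in> borel_measurable circle" if "0 \<le> r" "r \<le> 1" for r
  proof -
    have "(\<lambda>\<phi>. cmod (U (of_real r * cis \<phi>))) \<in> borel_measurable borel"
      using that by (intro borel_measurable_continuous_onI continuous_intros cisU)
    then show ?thesis by (intro measurable_circleI borel_measurable_ln)
  qed
  define D where "D \<phi> = 2 * ln C + 2 * ln 2 + \<bar>L \<phi>\<bar>" for \<phi>
  have Di: "integrable circle D" unfolding D_def using Li by auto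
  show i: "integrable circle (\<lambda>\<phi>. ln (cmod (U (cis \<phi>))))"
  proof (rule Bochner_Integration.integrable_bound[OF Di])
    show "(\<lambda>\<phi>. ln (cmod (U (cis \<phi>)))) \<in> borel_measurable circle" using meas[of 1] by simp
    show "AE \<phi> in circle. norm (ln (cmod (U (cis \<phi>)))) \<le> norm (D \<phi>)"
      using AE_circle_not_singular by eventually_elim (use bound[of 1] in \<open>simp add: D_def order_trans[OF _ abs_ge_self]\<close>)
  qed
  obtain \<Lambda> where \<Lambda>: "\<Lambda> holomorphic_on ball 0 1" "\<And>z. z \<in> ball 0 1 \<Longrightarrow> U z = exp (\<Lambda> z)"
    by (rule contractible_imp_holomorphic_log[of U "ball 0 1"])
       (use U \<rho> Unz in \<open>auto intro: holomorphic_on_subset convex_imp_contractible\<close>)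
  \<comment> \<open>The branch of log U with the real value ln c at 0, so that the correction term
    in \<open>herglotz_Re\<close> vanishes.\<close>
  define F where "F z = \<Lambda> z - \<Lambda> 0 + complex_of_real (ln c)" for z
  have F: "F holomorphic_on ball 0 1" unfolding F_def by (intro holomorphic_intros \<Lambda>)
  have FU: "U z = exp (F z)" if "cmod z < 1" for z
  proof -
    have "exp (\<Lambda> 0) = complex_of_real c" using \<Lambda>(2)[of 0] c by simp
    then have "exp (F z) = exp (\<Lambda> z) / complex_of_real c * complex_of_real c"
      unfolding F_def using c by (simp add: exp_add exp_diff exp_of_real)
    then show ?thesis using \<Lambda>(2)[of z] that c by simp
  qed
  have F0: "Im (F 0) = 0" by (simp add: F_def)
  show "U z = exp (herglotz (\<lambda>\<phi>. ln (cmod (U (cis \<phi>)))) z)" if z: "cmod z < 1"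
  proof -
    define r where "r n = 1 - (1/2::real)^Suc n" for n :: nat
    have r: "0 < r n" "r n < 1" for n using power_Suc_less_one[of "1/2::real" n] by (simp_all add: r_def del: power_Suc)
    have "(\<lambda>n. 1 - (1/2::real)^Suc n) \<longlonglongrightarrow> 1 - 0"
      by (intro tendsto_diff tendsto_const LIMSEQ_Suc LIMSEQ_power_zero) simp
    then have rlim: "r \<longlonglongrightarrow> 1" by (simp add: r_def[abs_def])
    have hr: "herglotz (\<lambda>\<phi>. ln (cmod (U (of_real (r n) * cis \<phi>)))) z = F (of_real (r n) * z)" for n
    proof -
      have h: "(\<lambda>w. F (of_real (r n) * w)) holomorphic_on ball 0 (1 / r n)"
        by (rule holomorphic_on_compose_gen[OF _ F, unfolded o_def])
           (use r[of n] in \<open>auto intro!: holomorphic_intros simp: norm_mult field_simps\<close>)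
      have "Re (F (of_real (r n) * cis \<phi>)) = ln (cmod (U (of_real (r n) * cis \<phi>)))" for \<phi>
        using r[of n] by (simp add: FU norm_mult)
      then show ?thesis using herglotz_Re[OF h _ z] r[of n] F0 by simp
    qed
    have lim: "(\<lambda>n. herglotz (\<lambda>\<phi>. ln (cmod (U (of_real (r n) * cis \<phi>)))) z) \<longlonglongrightarrow> herglotz (\<lambda>\<phi>. ln (cmod (U (cis \<phi>)))) z"
      unfolding herglotz_def
    proof (intro tendsto_divide tendsto_const integral_dominated_convergence)
      let ?g = "\<lambda>\<phi>. (cis \<phi> + z) / (cis \<phi> - z)"
      have gm: "?g \<in> borel_measurable circle"
        using integrable_circle_continuous[OF continuous_on_herglotz_kernel[OF z]] by (rule borel_measurable_integrable)
      show "(\<lambda>\<phi>. ?g \<phi> * complex_of_real (ln (cmod (U (cis \<phi>))))) \<in> borel_measurable circle"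
        using gm borel_measurable_integrable[OF i] by measurable
      show "(\<lambda>\<phi>. ?g \<phi> * complex_of_real (ln (cmod (U (of_real (r n) * cis \<phi>))))) \<in> borel_measurable circle" for n
        using gm meas[OF less_imp_le[OF r(1)] less_imp_le[OF r(2)], of n] by measurable
      show "integrable circle (\<lambda>\<phi>. cmod (?g \<phi>) * D \<phi>)"
        using Di by (intro integrable_circle_mult_real continuous_on_norm continuous_on_herglotz_kernel[OF z])
      show "AE \<phi> in circle. (\<lambda>n. ?g \<phi> * complex_of_real (ln (cmod (U (of_real (r n) * cis \<phi>)))))
         \<longlonglongrightarrow> ?g \<phi> * complex_of_real (ln (cmod (U (cis \<phi>))))"
        using AE_circle_not_singular
      proof eventually_elim
        case (elim \<phi>)
        have "isCont U (cis \<phi>)" using Uc \<rho> by (simp add: continuous_on_eq_continuous_at)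
        moreover have "(\<lambda>n. of_real (r n) * cis \<phi>) \<longlonglongrightarrow> of_real 1 * cis \<phi>" by (intro tendsto_intros rlim)
        ultimately have "(\<lambda>n. U (of_real (r n) * cis \<phi>)) \<longlonglongrightarrow> U (cis \<phi>)"
          by (intro isCont_tendsto_compose[of _ U]) auto
        moreover have "U (cis \<phi>) \<noteq> 0"
          using NU[of "cis \<phi>"] \<rho> elim norm_one_minus_cis_sq[of \<phi>] by auto
        ultimately show ?case by (intro tendsto_intros) auto
      qed
      show "AE \<phi> in circle. norm (?g \<phi> * complex_of_real (ln (cmod (U (of_real (r n) * cis \<phi>))))) \<le> cmod (?g \<phi>) * D \<phi>" for n
        using AE_circle_not_singular
      proof eventually_elim
        case (elim \<phi>)
        have "\<bar>ln (cmod (U (of_real (r n) * cis \<phi>)))\<bar> \<le> D \<phi>"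
          unfolding D_def using elim r[of n] by (intro bound) auto
        then show ?case unfolding norm_mult norm_of_real by (intro mult_left_mono) auto
      qed
    qed auto
    have "isCont F z" using holomorphic_on_imp_continuous_on[OF F] z by (simp add: continuous_on_eq_continuous_at)
    moreover have "(\<lambda>n. of_real (r n) * z) \<longlonglongrightarrow> of_real 1 * z" by (intro tendsto_intros rlim)
    ultimately have "(\<lambda>n. F (of_real (r n) * z)) \<longlonglongrightarrow> F z"
      by (intro isCont_tendsto_compose[of _ F]) auto
    with lim have "herglotz (\<lambda>\<phi>. ln (cmod (U (cis \<phi>)))) z = F z"
      unfolding hr by (rule LIMSEQ_unique)
    then show ?thesis using FU[OF z] by simp
  qed
qed

section \<open>Measures on [-2,2] and the circle\<close>

text \<open>The map phi -> 2 cos phi covers [-2,2] twice and has |dx| = 2 |sin phi| d phi, so the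
  two factors 2 cancel. The substitution is made on [pi, 2 pi], where 2 cos is increasing; a
  reflection treats the other half.\<close>

lemma nn_integral_two_cos:
  fixes F :: "real \<Rightarrow> real"
  assumes F[measurable]: "F \<in> borel_measurable borel" and F0: "\<And>x. F x \<ge> 0"
  shows "(\<integral>\<^sup>+\<phi>. ennreal (F (2 * cos \<phi>) * \<bar>sin \<phi>\<bar>) \<partial>circle) = (\<integral>\<^sup>+x\<in>{-2..2}. ennreal (F x) \<partial>lborel)"
proof -
  let ?h = "\<lambda>\<phi>. ennreal (F (2 * cos \<phi>) * \<bar>sin \<phi>\<bar>)"
  have [measurable]: "?h \<in> borel_measurable borel" by measurable
  have sub: "(\<integral>\<^sup>+x. ennreal (F x) * indicator {-2..2} x \<partial>lborel) = 2 * (\<integral>\<^sup>+\<phi>\<in>{pi..2*pi}. ?h \<phi> \<partial>lborel)"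
  proof -
    have "(\<integral>\<^sup>+x. F x * indicator {2 * cos pi..2 * cos (2*pi)} x \<partial>lborel)
        = (\<integral>\<^sup>+x. F (2 * cos x) * (- 2 * sin x) * indicator {pi..2*pi} x \<partial>lborel)"
    proof (rule nn_integral_substitution)
      show "set_borel_measurable borel {2 * cos pi..2 * cos (2 * pi)} F"
        unfolding set_borel_measurable_def by measurable
      show "((\<lambda>x. 2 * cos x) has_real_derivative - 2 * sin x) (at x)" for x
        by (auto intro!: derivative_eq_intros)
      show "0 \<le> - 2 * sin x" if "x \<in> {pi..2*pi}" for x
        using sin_le_zero[of x] that by (cases "x = 2*pi") auto
    qed (auto intro!: continuous_intros)
    also have "\<dots> = (\<integral>\<^sup>+\<phi>. 2 * (?h \<phi> * indicator {pi..2*pi} \<phi>) \<partial>lborel)"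
    proof (intro nn_integral_cong)
      fix x :: real
      show "ennreal (F (2 * cos x) * (- 2 * sin x) * indicator {pi..2*pi} x) = 2 * (?h x * indicator {pi..2*pi} x)"
      proof (cases "x \<in> {pi..2*pi}")
        case True
        have "sin x \<le> 0" using sin_le_zero[of x] True by (cases "x = 2*pi") auto
        then have "ennreal (F (2 * cos x) * (- 2 * sin x)) = ennreal (2 * (F (2 * cos x) * \<bar>sin x\<bar>))" by (simp add: mult_ac)
        also have "\<dots> = ennreal 2 * ?h x" using F0 by (intro ennreal_mult) auto
        finally show ?thesis using True by simp
      qed simp
    qed
    also have "\<dots> = 2 * (\<integral>\<^sup>+\<phi>\<in>{pi..2*pi}. ?h \<phi> \<partial>lborel)" by (rule nn_integral_cmult) measurable
    finally show ?thesis by (simp add: ennreal_mult' F0 ennreal_indicator[symmetric])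
  qed
  have refl: "(\<integral>\<^sup>+\<phi>\<in>{0..pi}. ?h \<phi> \<partial>lborel) = (\<integral>\<^sup>+\<phi>\<in>{pi..2*pi}. ?h \<phi> \<partial>lborel)"
  proof -
    have "(\<integral>\<^sup>+\<phi>\<in>{0..pi}. ?h \<phi> \<partial>lborel) = ennreal \<bar>-1\<bar> * (\<integral>\<^sup>+\<phi>. ?h (2*pi + (-1) * \<phi>) * indicator {0..pi} (2*pi + (-1) * \<phi>) \<partial>lborel)"
      by (rule nn_integral_real_affine) auto
    also have "\<dots> = (\<integral>\<^sup>+\<phi>\<in>{pi..2*pi}. ?h \<phi> \<partial>lborel)"
      by (simp, intro nn_integral_cong) (auto split: split_indicator simp: cos_diff sin_diff)
    finally show ?thesis .
  qed
  have "(\<integral>\<^sup>+\<phi>. ?h \<phi> \<partial>circle) = (\<integral>\<^sup>+\<phi>\<in>{0..2*pi}. ?h \<phi> \<partial>lborel)"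
    by (intro nn_integral_restrict_space) auto
  also have "\<dots> = (\<integral>\<^sup>+\<phi>. ?h \<phi> * indicator {0..pi} \<phi> + ?h \<phi> * indicator {pi..2*pi} \<phi> \<partial>lborel)"
  proof (intro nn_integral_cong_AE)
    show "AE \<phi> in lborel. ?h \<phi> * indicator {0..2*pi} \<phi> = ?h \<phi> * indicator {0..pi} \<phi> + ?h \<phi> * indicator {pi..2*pi} \<phi>"
      using AE_lborel_singleton[of pi] by eventually_elim (auto split: split_indicator)
  qed
  also have "\<dots> = (\<integral>\<^sup>+\<phi>\<in>{0..pi}. ?h \<phi> \<partial>lborel) + (\<integral>\<^sup>+\<phi>\<in>{pi..2*pi}. ?h \<phi> \<partial>lborel)"
    by (intro nn_integral_add) auto
  also have "\<dots> = (\<integral>\<^sup>+x\<in>{-2..2}. ennreal (F x) \<partial>lborel)" unfolding refl sub by (rule mult_2[symmetric])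
  finally show ?thesis .
qed

text \<open>The lift of f(x) dx through x = 2 cos phi, scaled by 2 pi to match the normalisation of
  \<open>herglotz\<close>. For the spectral density it is 2 sin theta Im M(e^(i theta)) almost
  everywhere.\<close>

definition circle_density :: "(real \<Rightarrow> real) \<Rightarrow> real \<Rightarrow> real" where
  "circle_density f \<phi> = 2 * pi * (f (2 * cos \<phi>) * \<bar>sin \<phi>\<bar>)"

lemma circle_density_reflect: "circle_density f (2*pi - \<phi>) = circle_density f \<phi>"
  by (simp add: circle_density_def cos_diff sin_diff)

text \<open>Behind the second identity is an equality of measures: the image of the weighted circle
  under 2 cos phi is 2 pi f(x) dx. Going through \<open>distr\<close> and \<open>density\<close>
  transfers complex integrals of all Borel functions at once, integrable or not.\<close>

lemma
  fixes f :: "real \<Rightarrow> real"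
  assumes f[measurable]: "f \<in> borel_measurable borel" and f0: "\<And>x. f x \<ge> 0" and fs: "\<And>x. x \<notin> {-2..2} \<Longrightarrow> f x = 0"
  shows nn_integral_circle_density: "(\<integral>\<^sup>+\<phi>. ennreal (circle_density f \<phi>) \<partial>circle) = ennreal (2*pi) * (\<integral>\<^sup>+x. ennreal (f x) \<partial>lborel)"
    and integral_circle_density: "\<And>\<Phi> :: real \<Rightarrow> complex. \<Phi> \<in> borel_measurable borel \<Longrightarrow>
      (\<integral>\<phi>. \<Phi> (2 * cos \<phi>) * circle_density f \<phi> \<partial>circle) = 2 * pi * (\<integral>x. \<Phi> x * f x \<partial>lborel)"
proof -
  have [measurable]: "circle_density f \<in> borel_measurable borel" unfolding circle_density_def[abs_def] by measurable
  then have [measurable]: "circle_density f \<in> borel_measurable circle" by (rule measurable_circleI)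
  have c0: "circle_density f \<phi> \<ge> 0" for \<phi> using f0 by (simp add: circle_density_def)
  have gen: "(\<integral>\<^sup>+\<phi>. ennreal (circle_density (\<lambda>x. f x * G x) \<phi>) \<partial>circle) = ennreal (2*pi) * (\<integral>\<^sup>+x. ennreal (f x * G x) \<partial>lborel)"
    if [measurable]: "G \<in> borel_measurable borel" and G0: "\<And>x. G x \<ge> 0" for G
  proof -
    have [measurable]: "(\<lambda>\<phi>. f (2 * cos \<phi>) * G (2 * cos \<phi>) * \<bar>sin \<phi>\<bar>) \<in> borel_measurable circle"
      by (intro measurable_circleI) measurable
    have "(\<integral>\<^sup>+\<phi>. ennreal (circle_density (\<lambda>x. f x * G x) \<phi>) \<partial>circle)
       = (\<integral>\<^sup>+\<phi>. ennreal (2*pi) * ennreal (f (2 * cos \<phi>) * G (2 * cos \<phi>) * \<bar>sin \<phi>\<bar>) \<partial>circle)"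
      using f0 G0 by (simp add: circle_density_def ennreal_mult' mult_ac)
    also have "\<dots> = ennreal (2*pi) * (\<integral>\<^sup>+\<phi>. ennreal (f (2 * cos \<phi>) * G (2 * cos \<phi>) * \<bar>sin \<phi>\<bar>) \<partial>circle)"
      by (rule nn_integral_cmult) measurable
    also have "(\<integral>\<^sup>+\<phi>. ennreal (f (2 * cos \<phi>) * G (2 * cos \<phi>) * \<bar>sin \<phi>\<bar>) \<partial>circle) = (\<integral>\<^sup>+x\<in>{-2..2}. ennreal (f x * G x) \<partial>lborel)"
      using nn_integral_two_cos[of "\<lambda>x. f x * G x"] f0 G0 by simp
    also have "\<dots> = (\<integral>\<^sup>+x. ennreal (f x * G x) \<partial>lborel)"
      by (intro nn_integral_cong) (use fs in \<open>auto split: split_indicator\<close>)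
    finally show ?thesis .
  qed
  show "(\<integral>\<^sup>+\<phi>. ennreal (circle_density f \<phi>) \<partial>circle) = ennreal (2*pi) * (\<integral>\<^sup>+x. ennreal (f x) \<partial>lborel)"
    using gen[of "\<lambda>_. 1"] by simp
  fix \<Phi> :: "real \<Rightarrow> complex" assume [measurable]: "\<Phi> \<in> borel_measurable borel"
  have tc[measurable]: "(\<lambda>\<phi>. 2 * cos \<phi>) \<in> borel_measurable (density circle (circle_density f))"
    by (subst measurable_density_eq1) (intro measurable_circleI, measurable)
  have eq: "distr (density circle (circle_density f)) borel (\<lambda>\<phi>. 2 * cos \<phi>) = density lborel (\<lambda>x. ennreal (2 * pi * f x))"
  proof (rule measure_eqI)
    fix A assume "A \<in> sets (distr (density circle (circle_density f)) borel (\<lambda>\<phi>. 2 * cos \<phi>))"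
    then have [measurable]: "A \<in> sets borel" by simp
    have [measurable]: "(\<lambda>\<phi>. 2 * cos \<phi>) \<in> borel_measurable circle" by (intro measurable_circleI) measurable
    have vs: "(\<lambda>\<phi>. 2 * cos \<phi>) -` A \<inter> space circle \<in> sets circle" by measurable
    have "emeasure (distr (density circle (circle_density f)) borel (\<lambda>\<phi>. 2 * cos \<phi>)) A
       = emeasure (density circle (circle_density f)) ((\<lambda>\<phi>. 2 * cos \<phi>) -` A \<inter> space circle)"
      by (subst emeasure_distr) auto
    also have "\<dots> = (\<integral>\<^sup>+\<phi>\<in>(\<lambda>\<phi>. 2 * cos \<phi>) -` A \<inter> space circle. ennreal (circle_density f \<phi>) \<partial>circle)"
      using vs by (intro emeasure_density) measurable
    also have "\<dots> = (\<integral>\<^sup>+\<phi>. ennreal (circle_density (\<lambda>x. f x * indicator A x) \<phi>) \<partial>circle)"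
      by (intro nn_integral_cong) (auto simp: circle_density_def split: split_indicator)
    also have "\<dots> = ennreal (2*pi) * (\<integral>\<^sup>+x. ennreal (f x * indicator A x) \<partial>lborel)"
      by (rule gen) auto
    also have "\<dots> = (\<integral>\<^sup>+x. ennreal (2*pi) * ennreal (f x * indicator A x) \<partial>lborel)"
      by (rule nn_integral_cmult[symmetric]) measurable
    also have "\<dots> = (\<integral>\<^sup>+x\<in>A. ennreal (2 * pi * f x) \<partial>lborel)"
      by (intro nn_integral_cong) (auto split: split_indicator simp: ennreal_mult f0)
    also have "\<dots> = emeasure (density lborel (\<lambda>x. ennreal (2 * pi * f x))) A"
      by (rule emeasure_density[symmetric]) auto
    finally show "emeasure (distr (density circle (circle_density f)) borel (\<lambda>\<phi>. 2 * cos \<phi>)) A = \<dots>" .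
  qed simp
  have \<Phi>c: "(\<lambda>\<phi>. \<Phi> (2 * cos \<phi>)) \<in> borel_measurable circle" by (intro measurable_circleI) measurable
  have "(\<integral>\<phi>. \<Phi> (2 * cos \<phi>) * circle_density f \<phi> \<partial>circle) = (\<integral>\<phi>. circle_density f \<phi> *\<^sub>R \<Phi> (2 * cos \<phi>) \<partial>circle)"
    by (simp add: scaleR_conv_of_real mult.commute)
  also have "\<dots> = (\<integral>\<phi>. \<Phi> (2 * cos \<phi>) \<partial>density circle (circle_density f))"
    using c0 \<Phi>c by (intro integral_density[symmetric]) auto
  also have "\<dots> = (\<integral>x. \<Phi> x \<partial>distr (density circle (circle_density f)) borel (\<lambda>\<phi>. 2 * cos \<phi>))"
    by (rule integral_distr[symmetric]) (use tc in auto)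
  also have "\<dots> = (\<integral>x. (2 * pi * f x) *\<^sub>R \<Phi> x \<partial>lborel)"
    unfolding eq using f0 by (intro integral_density) auto
  also have "\<dots> = (\<integral>x. (2 * pi) * (\<Phi> x * f x) \<partial>lborel)"
    by (simp add: scaleR_conv_of_real mult_ac)
  also have "\<dots> = 2 * pi * (\<integral>x. \<Phi> x * f x \<partial>lborel)" by (rule integral_mult_right_zero)
  finally show "(\<integral>\<phi>. \<Phi> (2 * cos \<phi>) * circle_density f \<phi> \<partial>circle) = 2 * pi * (\<integral>x. \<Phi> x * f x \<partial>lborel)" .
qed

lemma integrable_circle_density:
  assumes f: "f \<in> borel_measurable borel" and f0: "\<And>x. f x \<ge> 0" and fs: "\<And>x. x \<notin> {-2..2} \<Longrightarrow> f x = 0"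
    and fin: "(\<integral>\<^sup>+x. ennreal (f x) \<partial>lborel) < \<infinity>"
  shows "integrable circle (circle_density f)"
proof (rule integrableI_nonneg)
  have "circle_density f \<in> borel_measurable borel" unfolding circle_density_def[abs_def] using f by measurable
  then show "circle_density f \<in> borel_measurable circle" by (rule measurable_circleI)
  show "AE x in circle. 0 \<le> circle_density f x" using f0 by (intro AE_I2) (simp add: circle_density_def)
  show "(\<integral>\<^sup>+\<phi>. ennreal (circle_density f \<phi>) \<partial>circle) < \<infinity>"
    using nn_integral_circle_density[of f] f f0 fs fin by (simp add: ennreal_mult_less_top)
qed

text \<open>Averaging the Herglotz kernel over the points e^(i phi) and e^(-i phi) gives a function of
  cos phi, which turns the Stieltjes transform into a Herglotz integral on the circle.\<close>

lemma M_fun_herglotz: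
  assumes f[measurable]: "f \<in> borel_measurable borel" and f0: "\<And>x. f x \<ge> 0" and fs: "\<And>x. x \<notin> {-2..2} \<Longrightarrow> f x = 0"
    and fin: "(\<integral>\<^sup>+x. ennreal (f x) \<partial>lborel) < \<infinity>"
    and z: "cmod z < 1" "z \<noteq> 0"
  shows "M_fun (density lborel (\<lambda>x. ennreal (f x))) z = z / (1 - z\<^sup>2) * herglotz (circle_density f) z"
proof -
  let ?k = "circle_density f"
  have ik: "integrable circle ?k" by (rule integrable_circle_density) (use f f0 fs fin in auto)
  have ik': "integrable circle (\<lambda>\<phi>. (cis \<phi> + z) / (cis \<phi> - z) * complex_of_real (?k \<phi>))"
    using ik by (intro integrable_circle_mult continuous_on_herglotz_kernel z) auto
  have ik'': "integrable circle (\<lambda>\<phi>. (cnj (cis \<phi>) + z) / (cnj (cis \<phi>) - z) * complex_of_real (?k \<phi>))"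
    using ik z by (intro integrable_circle_mult continuous_intros) (auto simp: cis_cnj cis_neq)
  have z21: "1 - z\<^sup>2 \<noteq> 0" using z by (auto simp: power2_eq_1_iff)
  \<comment> \<open>This is 1 / (z + 1/z - x) with the inverse cleared. At x = 2 cos phi its
    denominator factors as (e^(i phi) - z) (e^(-i phi) - z), which matches the two averaged
    kernels.\<close>
  define \<Phi> where "\<Phi> x = z / (1 - complex_of_real x * z + z\<^sup>2)" for x
  have [measurable]: "\<Phi> \<in> borel_measurable borel" unfolding \<Phi>_def[abs_def] by measurable
  have fac: "1 - complex_of_real (2 * cos \<phi>) * z + z\<^sup>2 = (cis \<phi> - z) * (cnj (cis \<phi>) - z)" for \<phi>
  proof -
    have "cis \<phi> * cnj (cis \<phi>) = 1" by (simp add: cis_cnj cis_mult)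
    moreover have "cis \<phi> + cnj (cis \<phi>) = complex_of_real (2 * cos \<phi>)" by (simp add: complex_add_cnj)
    moreover have "(cis \<phi> - z) * (cnj (cis \<phi>) - z) = cis \<phi> * cnj (cis \<phi>) - (cis \<phi> + cnj (cis \<phi>)) * z + z\<^sup>2"
      by (simp add: power2_eq_square algebra_simps)
    ultimately show ?thesis by simp
  qed
  have ker: "(cis \<phi> + z) / (cis \<phi> - z) + (cnj (cis \<phi>) + z) / (cnj (cis \<phi>) - z) = 2 * (1 - z\<^sup>2) / z * \<Phi> (2 * cos \<phi>)" for \<phi>
  proof -
    have n1: "cis \<phi> - z \<noteq> 0" and n2: "cnj (cis \<phi>) - z \<noteq> 0"
      using cis_neq[OF z(1), of \<phi>] cis_neq[OF z(1), of "-\<phi>"] by (auto simp: cis_cnj)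
    have "cis \<phi> * cnj (cis \<phi>) = 1" by (simp add: cis_cnj cis_mult)
    then have "(cis \<phi> + z) * (cnj (cis \<phi>) - z) + (cnj (cis \<phi>) + z) * (cis \<phi> - z) = 2 * (1 - z\<^sup>2)"
      by (simp add: power2_eq_square algebra_simps)
    then show ?thesis unfolding \<Phi>_def fac using n1 n2 z by (simp add: add_frac_eq)
  qed
  have "herglotz ?k z = (\<integral>\<phi>. (cis \<phi> + z) / (cis \<phi> - z) * complex_of_real (?k \<phi>) \<partial>circle) / (2*pi)"
    by (simp add: herglotz_def)
  moreover have "(\<integral>\<phi>. (cis \<phi> + z) / (cis \<phi> - z) * complex_of_real (?k \<phi>) \<partial>circle)
     = (\<integral>\<phi>. (cnj (cis \<phi>) + z) / (cnj (cis \<phi>) - z) * complex_of_real (?k \<phi>) \<partial>circle)"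
    using integral_circle_reflect[of "\<lambda>\<phi>. (cis \<phi> + z) / (cis \<phi> - z) * complex_of_real (?k \<phi>)"]
    by (simp add: cis_reflect circle_density_reflect)
  ultimately have "2 * herglotz ?k z = ((\<integral>\<phi>. (cis \<phi> + z) / (cis \<phi> - z) * complex_of_real (?k \<phi>) \<partial>circle)
     + (\<integral>\<phi>. (cnj (cis \<phi>) + z) / (cnj (cis \<phi>) - z) * complex_of_real (?k \<phi>) \<partial>circle)) / (2*pi)"
    by (simp add: add_divide_distrib)
  also have "\<dots> = (\<integral>\<phi>. ((cis \<phi> + z) / (cis \<phi> - z) + (cnj (cis \<phi>) + z) / (cnj (cis \<phi>) - z)) * complex_of_real (?k \<phi>) \<partial>circle) / (2*pi)"
    unfolding distrib_right using ik' ik'' by (subst Bochner_Integration.integral_add) auto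
  also have "\<dots> = (\<integral>\<phi>. 2 * (1 - z\<^sup>2) / z * (\<Phi> (2 * cos \<phi>) * complex_of_real (?k \<phi>)) \<partial>circle) / (2*pi)"
    unfolding ker by (simp only: mult.assoc)
  also have "\<dots> = 2 * (1 - z\<^sup>2) / z * (\<integral>\<phi>. \<Phi> (2 * cos \<phi>) * complex_of_real (?k \<phi>) \<partial>circle) / (2*pi)"
    by (subst integral_mult_right_zero) simp
  also have "\<dots> = 2 * ((1 - z\<^sup>2) / z * (\<integral>x. \<Phi> x * f x \<partial>lborel))"
    using integral_circle_density[of f \<Phi>] f f0 fs by simp
  finally have h: "herglotz ?k z = (1 - z\<^sup>2) / z * (\<integral>x. \<Phi> x * f x \<partial>lborel)"
    unfolding mult_cancel_left by simp
  have "M_fun (density lborel (\<lambda>x. ennreal (f x))) z = - (\<integral>x. f x *\<^sub>R (1 / (complex_of_real x - (z + inverse z))) \<partial>lborel)"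
    unfolding M_fun_def m_fun_def using f0 by (subst integral_density) auto
  also have "\<dots> = (\<integral>x. \<Phi> x * f x \<partial>lborel)"
  proof -
    have "- (f x *\<^sub>R (1 / (complex_of_real x - (z + inverse z)))) = \<Phi> x * f x" for x
    proof -
      have "1 - complex_of_real x * z + z\<^sup>2 = - z * (complex_of_real x - (z + inverse z))"
        using z by (simp add: field_simps power2_eq_square)
      then have "\<Phi> x = - (1 / (complex_of_real x - (z + inverse z)))" unfolding \<Phi>_def using z by simp
      then show ?thesis by (simp add: scaleR_conv_of_real)
    qed
    then show ?thesis by (simp flip: Bochner_Integration.integral_minus)
  qed
  finally show ?thesis unfolding h using z z21 by simp
qed

section \<open>Moments of a stripped Jacobi matrix\<close>

lemma Jop_linear: "Jop a b (\<lambda>n. \<Sum>i\<in>I. c i * v i n) = (\<lambda>n. \<Sum>i\<in>I. c i * Jop a b (v i) n)"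
  by (rule ext) (auto simp: Jop_def sum_distrib_left sum.distrib algebra_simps)

text \<open>Duhamel formula: the coordinates from 2 on evolve under the stripped matrix, driven at
  its first site by a_1 times the first coordinate. Iteration yields a convolution of the first
  coordinates with the stripped orbit of \<open>delta1\<close>.\<close>

lemma moment_vector_decomposition:
  fixes a b :: "nat \<Rightarrow> real"
  defines "v \<equiv> \<lambda>k. (Jop a b ^^ k) delta1" and "v' \<equiv> \<lambda>k. (Jop (strip 1 a) (strip 1 b) ^^ k) delta1"
  assumes "n \<ge> 1"
  shows "v k (Suc n) = a 1 * (\<Sum>i<k. v (k - 1 - i) 1 * v' i n)"
  using assms(3)
proof (induction k arbitrary: n)
  case 0
  then show ?case by (simp add: v_def delta1_def)
next
  case (Suc k)
  define w where "w = (\<lambda>m. \<Sum>i<k. (a 1 * v (k - 1 - i) 1) * v' i m)"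
  \<comment> \<open>The induction hypothesis says nothing about index 0, and \<open>Jop\<close>
    never reads coordinate 0 at a positive index.\<close>
  have IH: "v k (Suc m) = w m" if "m \<ge> 1" for m
    using Suc.IH[OF that] by (simp add: w_def sum_distrib_left mult_ac)
  have vS: "v (Suc k) = Jop a b (v k)" and v'S: "Jop (strip 1 a) (strip 1 b) (v' i) = v' (Suc i)" for i
    by (simp_all add: v_def v'_def)
  have "v (Suc k) (Suc n) = a n * v k n + b (Suc n) * v k (Suc n) + a (Suc n) * v k (Suc (Suc n))"
    unfolding vS using Suc.prems by (simp add: Jop_def)
  also have "\<dots> = a 1 * v k 1 * delta1 n + Jop (strip 1 a) (strip 1 b) w n"
  proof (cases "n = 1")
    case True
    then show ?thesis using IH[of 1] IH[of 2] by (simp add: Jop_def delta1_def strip_def numeral_2_eq_2)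
  next
    case False
    then obtain m where m: "n = Suc m" "m \<ge> 1" using Suc.prems by (cases n) auto
    then show ?thesis using IH[of m] IH[of n] IH[of "Suc n"] by (simp add: Jop_def delta1_def strip_def)
  qed
  also have "Jop (strip 1 a) (strip 1 b) w n = (\<Sum>i<k. (a 1 * v (k - 1 - i) 1) * v' (Suc i) n)"
    unfolding w_def Jop_linear v'S ..
  also have "a 1 * v k 1 * delta1 n + \<dots> = (\<Sum>i<Suc k. (a 1 * v (k - i) 1) * v' i n)"
    by (subst sum.lessThan_Suc_shift) (simp add: v'_def)
  also have "\<dots> = a 1 * (\<Sum>i<Suc k. v (Suc k - 1 - i) 1 * v' i n)"
    unfolding sum_distrib_left by (intro sum.cong) (auto simp: mult_ac)
  finally show ?case .
qed

lemma jmoment_0 [simp]: "jmoment a b 0 = 1"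
  by (simp add: jmoment_def delta1_def)

lemma jmoment_1: "jmoment a b (Suc 0) = b 1"
  by (simp add: jmoment_def delta1_def Jop_def)

text \<open>Read the first coordinate of J v, which is b_1 v_1 + a_1 v_2, and insert the Duhamel
  formula for v_2. This is the coefficient form of the relation between M and M_1.\<close>

lemma jmoment_recursion:
  "jmoment a b (Suc (Suc k)) = b 1 * jmoment a b (Suc k)
     + (a 1)\<^sup>2 * (\<Sum>i\<le>k. jmoment a b (k - i) * jmoment (strip 1 a) (strip 1 b) i)"
proof -
  have "jmoment a b (Suc (Suc k)) = b 1 * jmoment a b (Suc k) + a 1 * (Jop a b ^^ Suc k) delta1 (Suc 1)"
    by (simp add: jmoment_def Jop_def)
  also have "(Jop a b ^^ Suc k) delta1 (Suc 1) = a 1 * (\<Sum>i<Suc k. jmoment a b (k - i) * jmoment (strip 1 a) (strip 1 b) i)"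
    using moment_vector_decomposition[where n=1 and a=a and b=b and k="Suc k"] by (simp add: jmoment_def)
  finally show ?thesis by (simp add: power2_eq_square lessThan_Suc_atMost)
qed

text \<open>Each application of J enlarges the supremum norm by a factor of at most 2 sup |a| + sup
  |b|; the added 1 makes C positive at once.\<close>

lemma jmoment_bound:
  assumes "jacobi a b"
  obtains C where "C > 0" "\<And>k. \<bar>jmoment a b k\<bar> \<le> C ^ k"
proof -
  obtain A B where A: "\<And>n. \<bar>a n\<bar> \<le> A" and B: "\<And>n. \<bar>b n\<bar> \<le> B"
    using assms unfolding jacobi_def bounded_iff by auto
  define C where "C = 2 * A + B + 1"
  have A0: "A \<ge> 0" and B0: "B \<ge> 0" using A[of 0] B[of 0] by auto
  then have C: "C > 0" by (simp add: C_def)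
  have "\<bar>(Jop a b ^^ k) delta1 n\<bar> \<le> C ^ k" for k n
  proof (induction k arbitrary: n)
    case 0 then show ?case by (simp add: delta1_def)
  next
    case (Suc k)
    let ?v = "(Jop a b ^^ k) delta1"
    have m: "\<bar>c * ?v i\<bar> \<le> D * C ^ k" if "\<bar>c\<bar> \<le> D" for c D i
      unfolding abs_mult using that Suc.IH by (intro mult_mono) auto
    have "\<bar>Jop a b ?v n\<bar> \<le> A * C ^ k + B * C ^ k + A * C ^ k"
    proof (cases "n = 0")
      case True
      then show ?thesis using A0 B0 C by (simp add: Jop_def)
    next
      case False
      define x where "x = (if n \<ge> 2 then a (n - 1) * ?v (n - 1) else 0)"
      have "\<bar>x\<bar> \<le> A * C ^ k" using m[OF A, of "n-1" "n-1"] A0 C by (simp add: x_def)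
      moreover have "Jop a b ?v n = x + b n * ?v n + a n * ?v (Suc n)" using False by (simp add: Jop_def x_def)
      ultimately show ?thesis using m[OF B, of n n] m[OF A, of n "Suc n"] by linarith
    qed
    also have "\<dots> \<le> C * C ^ k" using C by (simp add: C_def algebra_simps)
    finally show ?case by simp
  qed
  then show ?thesis using C that by (auto simp: jmoment_def)
qed

lemma jacobi_strip: "jacobi a b \<Longrightarrow> jacobi (strip n a) (strip n b)"
  unfolding jacobi_def strip_def by (auto intro: bounded_subset)

lemma strip_strip: "strip m (strip n a) = strip (n + m) a"
  by (simp add: strip_def add.assoc)

text \<open>The convolution in the moment recursion becomes a Cauchy product of two power series in
  w = 1/E. The sums stand for -m and -m_1, so with E = z + 1/z the result is M (z + 1/z - b_1 -
  a_1^2 M_1) = 1, for |E| beyond both growth rates.\<close>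

lemma stieltjes_coefficient_stripping:
  assumes J: "jacobi a b"
  obtains K where "K > 0" "\<And>E. cmod E > K \<Longrightarrow> summable (\<lambda>k. complex_of_real (jmoment a b k) / E ^ Suc k)"
    "\<And>E. cmod E > K \<Longrightarrow> summable (\<lambda>k. complex_of_real (jmoment (strip 1 a) (strip 1 b) k) / E ^ Suc k)"
    "\<And>E. cmod E > K \<Longrightarrow> (\<Sum>k. complex_of_real (jmoment a b k) / E ^ Suc k) *
      (E - complex_of_real (b 1) - complex_of_real ((a 1)\<^sup>2) * (\<Sum>k. complex_of_real (jmoment (strip 1 a) (strip 1 b) k) / E ^ Suc k)) = 1"
proof -
  define s where "s k = complex_of_real (jmoment a b k)" for k
  define t where "t k = complex_of_real (jmoment (strip 1 a) (strip 1 b) k)" for k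
  obtain C1 where C1: "C1 > 0" "\<And>k. \<bar>jmoment a b k\<bar> \<le> C1 ^ k" using jmoment_bound[OF J] by blast
  obtain C2 where C2: "C2 > 0" "\<And>k. \<bar>jmoment (strip 1 a) (strip 1 b) k\<bar> \<le> C2 ^ k"
    using jmoment_bound[OF jacobi_strip[OF J]] by blast
  define K where "K = max C1 C2"
  have K: "K > 0" using C1 by (simp add: K_def)
  have sk: "cmod (s k) \<le> K ^ k" for k
    using C1 power_mono[of C1 K k] by (simp add: s_def K_def) (meson order_trans less_imp_le)
  have tk: "cmod (t k) \<le> K ^ k" for k
    using C2 power_mono[of C2 K k] by (simp add: t_def K_def) (meson order_trans less_imp_le)
  have summ: "summable (\<lambda>k. norm (c k * (1/E) ^ k))" if "\<And>k. cmod (c k) \<le> K ^ k" "cmod E > K" for c :: "nat \<Rightarrow> complex" and E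
  proof (rule summable_comparison_test')
    have "K / cmod E < 1" using that(2) K by (subst divide_less_eq_1_pos) auto
    then have "norm (K / cmod E) < 1" using K by simp
    then show "summable (\<lambda>k. (K / cmod E) ^ k)" by (rule summable_geometric)
    show "norm (norm (c n * (1/E) ^ n)) \<le> (K / cmod E) ^ n" if "n \<ge> 0" for n
      using \<open>\<And>k. cmod (c k) \<le> K ^ k\<close>[of n]
      by (simp add: norm_mult norm_power norm_divide power_divide divide_right_mono)
  qed
  have conv: "(\<lambda>k. c k / E ^ Suc k) = (\<lambda>k. (1/E) * (c k * (1/E) ^ k))" for c :: "nat \<Rightarrow> complex" and E
    by (simp add: power_divide)
  have summ1: "summable (\<lambda>k. c k / E ^ Suc k)" if "\<And>k. cmod (c k) \<le> K ^ k" "cmod E > K" for c E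
    by (subst conv) (intro summable_mult summable_norm_cancel[OF summ] that)
  show ?thesis
  proof
    show "K > 0" by (rule K)
    fix E assume E: "cmod E > K"
    show "summable (\<lambda>k. complex_of_real (jmoment a b k) / E ^ Suc k)"
      using summ1[of s E, OF sk E] by (simp add: s_def)
    show "summable (\<lambda>k. complex_of_real (jmoment (strip 1 a) (strip 1 b) k) / E ^ Suc k)"
      using summ1[of t E, OF tk E] by (simp add: t_def)
    define w where "w = 1 / E"
    have E0: "E \<noteq> 0" using E K by auto
    have w0: "w \<noteq> 0" "w * E = 1" using E0 by (auto simp: w_def)
    define S where "S = (\<Sum>k. s k * w ^ k)"
    define T where "T = (\<Sum>k. t k * w ^ k)"
    have ns: "summable (\<lambda>k. norm (s k * w ^ k))" and nt: "summable (\<lambda>k. norm (t k * w ^ k))"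
      unfolding w_def by (intro summ sk tk E)+
    have Ssum: "(\<lambda>k. s k * w ^ k) sums S" unfolding S_def by (intro summable_sums summable_norm_cancel[OF ns])
    have "(\<lambda>k. \<Sum>i\<le>k. (t i * w ^ i) * (s (k - i) * w ^ (k - i))) sums (T * S)"
      unfolding S_def T_def by (rule Cauchy_product_sums[OF nt ns])
    then have prod: "(\<lambda>k. w\<^sup>2 * complex_of_real ((a 1)\<^sup>2) * (\<Sum>i\<le>k. (t i * w ^ i) * (s (k - i) * w ^ (k - i)))) sums (w\<^sup>2 * complex_of_real ((a 1)\<^sup>2) * (T * S))"
      by (rule sums_mult)
    \<comment> \<open>The recursion starts at the second moment, so the moments 0 and 1 are split
      off first.\<close>
    have S1: "(\<lambda>k. s (Suc k) * w ^ Suc k) sums (S - s 0)"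
      using Ssum by (subst sums_Suc_iff) simp
    have S2: "(\<lambda>k. s (Suc (Suc k)) * w ^ Suc (Suc k)) sums (S - s 0 - s 1 * w)"
      using S1 by (subst sums_Suc_iff) simp
    have bS: "(\<lambda>k. complex_of_real (b 1) * w * (s (Suc k) * w ^ Suc k)) sums (complex_of_real (b 1) * w * (S - s 0))"
      by (intro sums_mult S1)
    have step: "s (Suc (Suc k)) * w ^ Suc (Suc k) = complex_of_real (b 1) * w * (s (Suc k) * w ^ Suc k)
       + w\<^sup>2 * complex_of_real ((a 1)\<^sup>2) * (\<Sum>i\<le>k. (t i * w ^ i) * (s (k - i) * w ^ (k - i)))" for k
    proof -
      have "(\<Sum>i\<le>k. (t i * w ^ i) * (s (k - i) * w ^ (k - i))) = (\<Sum>i\<le>k. s (k - i) * t i) * w ^ k"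
        unfolding sum_distrib_right
      proof (rule sum.cong)
        fix i assume "i \<in> {..k}"
        then have "w ^ k = w ^ i * w ^ (k - i)" by (simp flip: power_add)
        then show "(t i * w ^ i) * (s (k - i) * w ^ (k - i)) = s (k - i) * t i * w ^ k" by (simp add: mult_ac)
      qed simp
      moreover have "s (Suc (Suc k)) = complex_of_real (b 1) * s (Suc k) + complex_of_real ((a 1)\<^sup>2) * (\<Sum>i\<le>k. s (k - i) * t i)"
        unfolding s_def t_def jmoment_recursion[of a b k] by simp
      ultimately show ?thesis by (simp add: power2_eq_square algebra_simps)
    qed
    have "S - s 0 - s 1 * w = complex_of_real (b 1) * w * (S - s 0) + w\<^sup>2 * complex_of_real ((a 1)\<^sup>2) * (T * S)"
      using sums_unique2[OF S2] sums_add[OF bS prod] unfolding step by blast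
    moreover have "s 0 = 1" "s 1 = complex_of_real (b 1)" by (simp_all add: s_def jmoment_1)
    ultimately have key: "S * (1 - complex_of_real (b 1) * w - w\<^sup>2 * complex_of_real ((a 1)\<^sup>2) * T) = 1"
      by (simp add: algebra_simps)
    have eS: "(\<Sum>k. s k / E ^ Suc k) = w * S" unfolding S_def w_def
      by (subst conv) (intro suminf_mult summable_norm_cancel[OF summ] sk E)
    have eT: "(\<Sum>k. t k / E ^ Suc k) = w * T" unfolding T_def w_def
      by (subst conv) (intro suminf_mult summable_norm_cancel[OF summ] tk E)
    have "(w * S) * (E - complex_of_real (b 1) - complex_of_real ((a 1)\<^sup>2) * (w * T)) = S * (w * E - complex_of_real (b 1) * w - w\<^sup>2 * complex_of_real ((a 1)\<^sup>2) * T)"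
      by (simp add: power2_eq_square algebra_simps)
    also have "\<dots> = S * (1 - complex_of_real (b 1) * w - w\<^sup>2 * complex_of_real ((a 1)\<^sup>2) * T)"
      by (simp add: w0(2))
    also have "\<dots> = 1" by (rule key)
    finally show "(\<Sum>k. complex_of_real (jmoment a b k) / E ^ Suc k) *
      (E - complex_of_real (b 1) - complex_of_real ((a 1)\<^sup>2) * (\<Sum>k. complex_of_real (jmoment (strip 1 a) (strip 1 b) k) / E ^ Suc k)) = 1"
      unfolding s_def[symmetric] t_def[symmetric] eS eT .
  qed
qed

section \<open>The stripped Jost function\<close>

text \<open>The two roots of z^2 - E z + 1 have product 1, so one lies in the disc unless both are
  unimodular. In that case they are conjugate and E = 2 Re p lies in [-2,2].\<close>

lemma joukowski_surj:
  fixes E :: complex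
  assumes "\<And>x. x \<in> {-2..2} \<Longrightarrow> E \<noteq> complex_of_real x"
  obtains z where "z \<noteq> 0" "cmod z < 1" "z + inverse z = E"
proof -
  define s where "s = csqrt (E\<^sup>2 - 4)"
  define p where "p = (E + s) / 2"
  define q where "q = (E - s) / 2"
  have "s\<^sup>2 = E\<^sup>2 - 4" by (simp add: s_def)
  then have pq: "p * q = 1" by (simp add: p_def q_def power2_eq_square algebra_simps)
  then have p0: "p \<noteq> 0" and qp: "q = inverse p" by (auto simp: inverse_unique)
  have sum: "p + q = E" by (simp add: p_def q_def add_divide_distrib[symmetric])
  have "cmod p \<noteq> 1"
  proof
    assume p1: "cmod p = 1"
    then have "q = cnj p" using pq p0 complex_norm_square[of p]
      by (metis mult.commute mult_cancel_left of_real_1 one_power2)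
    then have E: "E = complex_of_real (2 * Re p)" using sum by (simp add: complex_add_cnj)
    have "\<bar>Re p\<bar> \<le> 1" using abs_Re_le_cmod[of p] p1 by simp
    then have "2 * Re p \<in> {-2..2}" by auto
    from assms[OF this] E show False by simp
  qed
  moreover have "cmod p * cmod q = 1" using pq by (metis norm_mult norm_one)
  ultimately consider "cmod p < 1" | "cmod q < 1"
    by (metis less_1_mult linorder_neqE_linordered_idom mult.right_neutral order_less_irrefl)
  then show ?thesis
  proof cases
    case 1 then show ?thesis using that[of p] p0 sum qp by auto
  next
    case 2 then show ?thesis using that[of q] p0 sum qp by (auto simp: add.commute)
  qed
qed

lemma joukowski_inj: "inj_on (\<lambda>z::complex. z + inverse z) (ball 0 1 - {0})"
proof (rule inj_onI)
  fix z w :: complex assume z: "z \<in> ball 0 1 - {0}" and w: "w \<in> ball 0 1 - {0}" and e: "z + inverse z = w + inverse w"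
  have z0: "z \<noteq> 0" and w0: "w \<noteq> 0" using z w by auto
  from e have "(z - w) * (z * w - 1) = 0" using z0 w0 by (simp add: field_simps)
  moreover have "cmod (z * w) < 1"
    using z w mult_strict_mono[of "cmod z" 1 "cmod w" 1] by (simp add: norm_mult)
  then have "z * w - 1 \<noteq> 0" by auto
  ultimately show "z = w" by simp
qed

text \<open>With w = 1 / (z + 1/z) = z / (1 + z^2) the series is w P(w), and (1/z - z) w = (1 - z^2)
  / (1 + z^2) tends to 1. This identifies the value at 0 of (1/z - z) M, the total mass of the
  measure.\<close>

lemma joukowski_moment_limit:
  fixes c :: "nat \<Rightarrow> real"
  assumes K: "K > 0" and summ: "\<And>E. cmod E > K \<Longrightarrow> summable (\<lambda>k. complex_of_real (c k) / E ^ Suc k)"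
  shows "((\<lambda>z. (inverse z - z) * (\<Sum>k. complex_of_real (c k) / (z + inverse z) ^ Suc k)) \<longlongrightarrow> complex_of_real (c 0)) (at 0)"
proof -
  define P where "P w = (\<Sum>k. complex_of_real (c k) * w ^ k)" for w :: complex
  have Psums: "(\<lambda>k. complex_of_real (c k) * w ^ k) sums P w" if "norm w < inverse K" for w
  proof (cases "w = 0")
    case True
    then show ?thesis unfolding P_def by (intro summable_sums) (auto intro: summable_zero_power')
  next
    case False
    have "cmod (inverse w) > K" using that K False
      by (simp only: norm_inverse) (simp add: field_simps)
    from summable_mult[OF summ[OF this], of "inverse w"]
    have "summable (\<lambda>k. complex_of_real (c k) * w ^ k)"
      using False by (simp add: field_simps)
    then show ?thesis unfolding P_def by (rule summable_sums)
  qed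
  have P0: "(P \<longlongrightarrow> complex_of_real (c 0)) (at 0)"
    by (rule powser_limit_0[of "inverse K"]) (use K Psums in auto)
  have P00: "P 0 = complex_of_real (c 0)"
    using sums_unique2[OF Psums[of 0] powser_sums_zero[of "\<lambda>k. complex_of_real (c k)"]] K by simp
  have isc: "isCont P 0" using P0 P00 by (simp add: isCont_def)
  have wl: "((\<lambda>z::complex. z / (1 + z\<^sup>2)) \<longlongrightarrow> 0 / (1 + 0\<^sup>2)) (at 0)"
    by (intro tendsto_intros) auto
  then have "((\<lambda>z. P (z / (1 + z\<^sup>2))) \<longlongrightarrow> P 0) (at 0)"
    by (intro isCont_tendsto_compose[OF isc]) simp
  then have lim: "((\<lambda>z. (1 - z\<^sup>2) / (1 + z\<^sup>2) * P (z / (1 + z\<^sup>2))) \<longlongrightarrow> (1 - 0\<^sup>2) / (1 + 0\<^sup>2) * P 0) (at 0)"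
    by (intro tendsto_intros) auto
  have "\<forall>\<^sub>F z in at (0::complex). cmod (z / (1 + z\<^sup>2)) < inverse K"
    using wl K by (intro order_tendstoD(2)[OF tendsto_norm[OF wl]]) auto
  moreover have "\<forall>\<^sub>F z in at (0::complex). z \<noteq> 0 \<and> cmod z < 1"
    by (auto simp: eventually_at intro!: exI[of _ 1])
  ultimately have "\<forall>\<^sub>F z in at 0. (1 - z\<^sup>2) / (1 + z\<^sup>2) * P (z / (1 + z\<^sup>2))
     = (inverse z - z) * (\<Sum>k. complex_of_real (c k) / (z + inverse z) ^ Suc k)"
  proof eventually_elim
    case (elim z)
    define w where "w = z / (1 + z\<^sup>2)"
    have z0: "z \<noteq> 0" and z1: "cmod z < 1" using elim by auto
    have "cmod (z\<^sup>2) < 1" using z1 by (simp add: norm_power power_less_one_iff)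
    then have n: "1 + z\<^sup>2 \<noteq> 0" by (metis add_eq_0_iff less_irrefl norm_minus_cancel norm_one)
    have E: "z + inverse z = inverse w" using z0 n by (simp add: w_def field_simps power2_eq_square)
    have w0: "w \<noteq> 0" using z0 n by (simp add: w_def)
    have "(\<lambda>k. complex_of_real (c k) / inverse w ^ Suc k) = (\<lambda>k. w * (complex_of_real (c k) * w ^ k))"
      using w0 by (simp add: power_inverse field_simps)
    then have "(\<Sum>k. complex_of_real (c k) / (z + inverse z) ^ Suc k) = (\<Sum>k. w * (complex_of_real (c k) * w ^ k))"
      unfolding E by simp
    also have "\<dots> = w * P w" unfolding P_def
      using Psums[of w] elim by (intro suminf_mult) (auto simp: w_def sums_iff)
    finally have T: "(\<Sum>k. complex_of_real (c k) / (z + inverse z) ^ Suc k) = w * P w" .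
    have "(inverse z - z) * w = (1 - z\<^sup>2) / (1 + z\<^sup>2)"
    proof -
      have "(inverse z - z) * z = 1 - z\<^sup>2" using z0 by (simp add: algebra_simps power2_eq_square)
      then show ?thesis by (simp add: w_def)
    qed
    then show ?case unfolding T w_def[symmetric] by (simp flip: mult.assoc)
  qed
  with lim P00 show ?thesis by (intro Lim_transform_eventually[OF lim[THEN tendsto_eq_rhs]]) auto
qed

section \<open>What the Jost function reveals about the spectral measure\<close>

lemma emeasure_density_singleton:
  "f \<in> borel_measurable borel \<Longrightarrow> emeasure (density lborel (\<lambda>x::real. ennreal (f x))) {x} = 0"
proof -
  assume [measurable]: "f \<in> borel_measurable borel"
  have "(\<integral>\<^sup>+y\<in>{x}. ennreal (f y) \<partial>lborel) = (\<integral>\<^sup>+y. 0 \<partial>(lborel::real measure))"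
  proof (intro nn_integral_cong_AE)
    show "AE y in lborel. ennreal (f y) * indicator {x} y = 0"
      using AE_lborel_singleton[of x] by eventually_elim simp
  qed
  then show ?thesis by (simp add: emeasure_density)
qed

text \<open>Each factor of the product vanishes at its own point of the disc, so a product without
  zeros has no factors. Every real x outside [-2,2] is z + 1/z for some z in the disc, hence no
  point of \<open>S\<close> carries mass.\<close>

lemma standing_form_absolutely_continuous:
  assumes sets: "sets \<gamma> = sets borel" and st: "standing_form \<gamma>"
    and nz: "\<And>z. cmod z < 1 \<Longrightarrow> (\<Prod>\<zeta>\<in>jost_zeros \<gamma>. (z - \<zeta>) / (1 - cnj \<zeta> * z)) \<noteq> 0"
  obtains f where "f \<in> borel_measurable borel" "\<And>x. f x \<ge> 0" "\<And>x. x \<notin> {-2..2} \<Longrightarrow> f x = 0"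
    "\<gamma> = density lborel (\<lambda>x. ennreal (f x))" "jost_zeros \<gamma> = {}"
proof -
  obtain f S w where f[measurable]: "f \<in> borel_measurable borel" and f0: "\<And>x. f x \<ge> 0" and fs: "\<And>x. x \<notin> {-2..2} \<Longrightarrow> f x = 0"
    and S: "finite S" "S \<inter> {-2..2} = {}"
    and em: "\<And>A. A \<in> sets borel \<Longrightarrow> emeasure \<gamma> A = (\<integral>\<^sup>+ x. ennreal (f x) * indicator A x \<partial>lborel) + (\<Sum>x\<in>S \<inter> A. w x)"
    using st unfolding standing_form_def by blast
  have sing: "emeasure \<gamma> {x} = (\<Sum>y\<in>S \<inter> {x}. w y)" for x
    using em[of "{x}"] emeasure_density_singleton[OF f, of x] by (simp add: emeasure_density)
  have sub: "(\<lambda>z. z + inverse z) ` jost_zeros \<gamma> \<subseteq> complex_of_real ` S"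
  proof
    fix E assume "E \<in> (\<lambda>z. z + inverse z) ` jost_zeros \<gamma>"
    then obtain x where x: "E = complex_of_real x" "emeasure \<gamma> {x} > 0" by (auto simp: jost_zeros_def)
    then have "x \<in> S" using sing[of x] by (cases "x \<in> S") auto
    then show "E \<in> complex_of_real ` S" using x by blast
  qed
  \<comment> \<open>A product over an infinite set is 1 by convention, so finiteness must be known
    before zeros can be read off. Injectivity of z + 1/z on the punctured disc pulls it back from
    \<open>S\<close>.\<close>
  have "finite (jost_zeros \<gamma>)"
  proof (rule finite_imageD)
    show "finite ((\<lambda>z. z + inverse z) ` jost_zeros \<gamma>)" using sub S by (meson finite_imageI finite_subset)
    show "inj_on (\<lambda>z. z + inverse z) (jost_zeros \<gamma>)"
      by (rule inj_on_subset[OF joukowski_inj]) (auto simp: jost_zeros_def)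
  qed
  then have jz: "jost_zeros \<gamma> = {}"
    using nz prod_zero_iff by (fastforce simp: jost_zeros_def)
  have w0: "w x = 0" if x: "x \<in> S" for x
  proof (rule ccontr)
    assume "w x \<noteq> 0"
    then have "emeasure \<gamma> {x} > 0" using sing[of x] x by (simp add: zero_less_iff_neq_zero)
    moreover obtain z where "z \<noteq> 0" "cmod z < 1" "z + inverse z = complex_of_real x"
      using joukowski_surj[of "complex_of_real x"] x S by (metis IntI empty_iff of_real_eq_iff)
    ultimately have "z \<in> jost_zeros \<gamma>" by (auto simp: jost_zeros_def)
    with jz show False by simp
  qed
  have "\<gamma> = density lborel (\<lambda>x. ennreal (f x))"
  proof (rule measure_eqI)
    fix A assume "A \<in> sets \<gamma>"
    then have "A \<in> sets borel" using sets by simp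
    then show "emeasure \<gamma> A = emeasure (density lborel (\<lambda>x. ennreal (f x))) A"
      using em[of A] w0 by (simp add: emeasure_density)
  qed (simp add: sets)
  then show ?thesis using that f f0 fs jz by blast
qed

lemma herglotz_cong_AE:
  assumes "integrable circle h" "integrable circle k" "AE \<phi> in circle. h \<phi> = k \<phi>" "cmod z < 1"
  shows "herglotz h z = herglotz k z"
proof -
  have i: "integrable circle (\<lambda>\<phi>. (cis \<phi> + z) / (cis \<phi> - z) * complex_of_real (l \<phi>))" if "integrable circle l" for l
    using that by (intro integrable_circle_mult continuous_on_herglotz_kernel assms) auto
  have "(\<integral>\<phi>. (cis \<phi> + z) / (cis \<phi> - z) * complex_of_real (h \<phi>) \<partial>circle)
    = (\<integral>\<phi>. (cis \<phi> + z) / (cis \<phi> - z) * complex_of_real (k \<phi>) \<partial>circle)"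
    using assms(3) by (intro integral_cong_AE borel_measurable_integrable i assms) (auto elim: eventually_mono)
  then show ?thesis by (simp add: herglotz_def)
qed

lemma herglotz_0: "herglotz k 0 = complex_of_real ((\<integral>\<phi>. k \<phi> \<partial>circle) / (2*pi))"
  by (simp add: herglotz_def)

text \<open>On the circle z / (1 - z^2) equals i / (2 sin theta), and the factor i exchanges real
  and imaginary parts. The limit of H is taken as a complex limit because \<open>ImM_bdry\<close>
  applies \<open>Lim\<close> to M itself.\<close>

lemma radial_boundary_Im:
  assumes lim: "((\<lambda>r. H (of_real r * cis \<theta>)) \<longlongrightarrow> L) (at_left 1)" and s: "sin \<theta> \<noteq> 0"
    and M: "\<And>z. cmod z < 1 \<Longrightarrow> z \<noteq> 0 \<Longrightarrow> M_fun \<gamma> z = z / (1 - z\<^sup>2) * H z"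
  shows "ImM_bdry \<gamma> \<theta> = Re L / (2 * sin \<theta>)"
proof -
  let ?\<zeta> = "cis \<theta>"
  have n: "1 - ?\<zeta>\<^sup>2 \<noteq> 0" using norm_one_minus_cis_sq[of \<theta>] s by auto
  have zl: "((\<lambda>r. complex_of_real r * ?\<zeta>) \<longlongrightarrow> complex_of_real 1 * ?\<zeta>) (at_left 1)" by (intro tendsto_intros)
  then have "((\<lambda>r. of_real r * ?\<zeta> / (1 - (of_real r * ?\<zeta>)\<^sup>2) * H (of_real r * ?\<zeta>)) \<longlongrightarrow> ?\<zeta> / (1 - ?\<zeta>\<^sup>2) * L) (at_left 1)"
    using n by (intro tendsto_intros lim) auto
  moreover have "\<forall>\<^sub>F r in at_left (1::real). of_real r * ?\<zeta> / (1 - (of_real r * ?\<zeta>)\<^sup>2) * H (of_real r * ?\<zeta>) = M_fun \<gamma> (of_real r * ?\<zeta>)"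
    unfolding eventually_at_left_field by (rule exI[of _ 0]) (auto simp: M norm_mult)
  ultimately have "((\<lambda>r. M_fun \<gamma> (of_real r * ?\<zeta>)) \<longlongrightarrow> ?\<zeta> / (1 - ?\<zeta>\<^sup>2) * L) (at_left 1)"
    by (rule Lim_transform_eventually)
  then have "ImM_bdry \<gamma> \<theta> = Im (?\<zeta> / (1 - ?\<zeta>\<^sup>2) * L)"
    unfolding ImM_bdry_def by (subst tendsto_Lim[OF trivial_limit_at_left_real]) auto
  also have "?\<zeta> / (1 - ?\<zeta>\<^sup>2) = \<i> / complex_of_real (2 * sin \<theta>)"
  proof -
    have 1: "(cos \<theta>)\<^sup>2 + (sin \<theta>)\<^sup>2 = 1" by simp
    have "1 - ?\<zeta>\<^sup>2 = - (\<i> * complex_of_real (2 * sin \<theta>)) * ?\<zeta>"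
      using 1 by (simp add: complex_eq_iff power2_eq_square algebra_simps)
    then show ?thesis using s by (simp add: divide_simps)
  qed
  also have "\<i> / complex_of_real (2 * sin \<theta>) * L = \<i> * L / complex_of_real (2 * sin \<theta>)" by simp
  finally show ?thesis unfolding Im_divide_of_real by simp
qed

text \<open>Mass of the density that belongs to |g| = 1; it is compared with the total mass of the
  spectral density.\<close>

lemma integral_two_sin_sq_circle: "(\<integral>\<phi>. 2 * (sin \<phi>)\<^sup>2 \<partial>circle) = 2 * pi"
proof -
  have "(\<integral>\<phi>. 1 - (cis \<phi>)\<^sup>2 \<partial>circle) = 2 * pi"
    using mean_value_circle[of "\<lambda>w. 1 - w\<^sup>2" 2] by (simp add: holomorphic_intros)
  then have "Re (\<integral>\<phi>. 1 - (cis \<phi>)\<^sup>2 \<partial>circle) = 2 * pi" by simp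
  moreover have "Re (\<integral>\<phi>. 1 - (cis \<phi>)\<^sup>2 \<partial>circle) = (\<integral>\<phi>. Re (1 - (cis \<phi>)\<^sup>2) \<partial>circle)"
    by (intro integral_Re[symmetric] integrable_circle_continuous continuous_intros)
  moreover have "Re (1 - (cis \<phi>)\<^sup>2) = 2 * (sin \<phi>)\<^sup>2" for \<phi>
    using sin_cos_squared_add[of \<phi>] by (simp add: power2_eq_square)
  ultimately show ?thesis by simp
qed

lemma finite_cis_fibre: "finite {\<theta> \<in> {0..2*pi}. cis \<theta> = w}"
proof (cases "\<exists>t\<in>{0..2*pi}. cis t = w")
  case True
  then obtain t where t: "t \<in> {0..2*pi}" "cis t = w" by blast
  have "{\<theta> \<in> {0..2*pi}. cis \<theta> = w} \<subseteq> {t - 2*pi, t, t + 2*pi}"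
  proof
    fix \<theta> assume \<theta>: "\<theta> \<in> {\<theta> \<in> {0..2*pi}. cis \<theta> = w}"
    then have "sin \<theta> = sin t \<and> cos \<theta> = cos t" using t(2) by (metis (mono_tags) cis.simps mem_Collect_eq)
    then obtain n :: int where n: "\<theta> = t + 2 * pi * n" unfolding sin_cos_eq_iff by blast
    have "\<bar>\<theta> - t\<bar> \<le> 2*pi" using \<theta> t(1) by auto
    then have "(2*pi) * \<bar>real_of_int n\<bar> \<le> (2*pi) * 1" using n by (simp add: abs_mult)
    then have "\<bar>real_of_int n\<bar> \<le> 1" by (rule mult_left_le_imp_le) simp
    then have "\<bar>n\<bar> \<le> 1" by linarith
    then have "n = -1 \<or> n = 0 \<or> n = 1" by auto
    then show "\<theta> \<in> {t - 2*pi, t, t + 2*pi}" using n by auto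
  qed
  then show ?thesis by (rule finite_subset) simp
next
  case False
  then have "{\<theta> \<in> {0..2*pi}. cis \<theta> = w} = {}" by auto
  then show ?thesis by (metis finite.emptyI)
qed

lemma infinite_circle_nonnull:
  assumes "\<not> (AE \<phi> in circle. \<phi> \<notin> Z)" shows "infinite (Z \<inter> {0..2*pi})"
proof
  assume "finite (Z \<inter> {0..2*pi})"
  then have "Z \<inter> {0..2*pi} \<in> null_sets lborel" by (rule finite_imp_null_set_lborel)
  then have "AE \<phi> in lborel. \<phi> \<notin> Z \<inter> {0..2*pi}" by (rule AE_not_in)
  then have "AE \<phi> in circle. \<phi> \<notin> Z" unfolding AE_circle_iff by eventually_elim auto
  with assms show False by simp
qed

text \<open>By symmetry |g|^2 equals g(z) g(1/z) on the circle, and this product is holomorphic in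
  an annulus. An infinite subset of the circle accumulates on it, so the identity theorem
  applies.\<close>

lemma unimodular_on_circle:
  fixes g :: "complex \<Rightarrow> complex"
  assumes R: "R > 1" and g: "g holomorphic_on ball 0 R"
    and sym: "\<And>z. cmod z < R \<Longrightarrow> g (cnj z) = cnj (g z)"
    and Z: "infinite Z" "Z \<subseteq> sphere 0 1" "\<And>z. z \<in> Z \<Longrightarrow> cmod (g z) = 1"
    and z: "cmod z = 1"
  shows "cmod (g z) = 1"
proof -
  let ?A = "{w::complex. 1/R < cmod w \<and> cmod w < R}"
  have sq: "g w * g (inverse w) = complex_of_real ((cmod (g w))\<^sup>2)" if "cmod w = 1" for w
  proof -
    have "w * cnj w = 1" using that complex_norm_square[of w] by simp
    then have "inverse w = cnj w" by (rule inverse_unique)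
    moreover have "g (cnj w) = cnj (g w)" using that R by (intro sym) simp
    ultimately show ?thesis by (simp only: complex_norm_square)
  qed
  obtain \<xi> where \<xi>: "\<xi> \<in> sphere 0 1" "\<xi> islimpt Z"
    using Z(1,2) compact_sphere[of "0::complex" 1] unfolding compact_eq_Bolzano_Weierstrass by metis
  have inv: "cmod (inverse w) < R" "w \<noteq> 0" if "w \<in> ?A" for w
  proof -
    have "0 < 1/R" using R by simp
    then have p: "0 < cmod w" using that by (smt (verit) mem_Collect_eq)
    then show "w \<noteq> 0" by simp
    have "inverse (cmod w) < R" using that p R by (auto simp: field_simps)
    then show "cmod (inverse w) < R" by (simp only: norm_inverse)
  qed
  have inA: "w \<in> ?A" if "cmod w = 1" for w using that R by simp
  have "g z * g (inverse z) - 1 = 0"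
  proof (rule analytic_continuation[where S="?A" and U=Z and \<xi>=\<xi> and f="\<lambda>z. g z * g (inverse z) - 1"])
    show "(\<lambda>z. g z * g (inverse z) - 1) holomorphic_on ?A"
      using inv by (intro holomorphic_intros holomorphic_on_subset[OF g]
        holomorphic_on_compose_gen[OF _ g, unfolded o_def]) auto
    show "open ?A" by (intro open_Collect_conj open_Collect_less continuous_intros)
    show "connected ?A" using connected_annulus(1)[where 'N=complex, of "1/R" 0 R] by simp
    show "Z \<subseteq> ?A" using Z(2) inA by auto
    show "\<xi> \<in> ?A" using \<xi>(1) inA by auto
    show "\<xi> islimpt Z" by fact
    show "g w * g (inverse w) - 1 = 0" if "w \<in> Z" for w
      using Z(2) Z(3)[OF that] that by (subst sq) auto
    show "z \<in> ?A" using z by (rule inA)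
  qed
  then have "complex_of_real ((cmod (g z))\<^sup>2) = complex_of_real 1" using sq[OF z] by simp
  then have "(cmod (g z))\<^sup>2 = 1" unfolding of_real_eq_iff .
  then show ?thesis by (simp add: power2_eq_1_iff) (metis norm_ge_zero not_one_le_zero neg_0_le_iff_le)
qed

text \<open>Since ln 0 = 0, the hypothesis on the Jost function does not see a set where the density
  vanishes as long as |g| = 1 there.  Then |g| = 1 on the whole circle by analyticity, and the
  normalisation of the total mass excludes such a set.\<close>

lemma spectral_density_boundary:
  fixes g N :: "complex \<Rightarrow> complex"
  assumes f[measurable]: "f \<in> borel_measurable borel" and f0: "\<And>x. f x \<ge> 0" and fs: "\<And>x. x \<notin> {-2..2} \<Longrightarrow> f x = 0"
    and fin: "(\<integral>\<^sup>+x. ennreal (f x) \<partial>lborel) < \<infinity>"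
    and mass: "(\<integral>\<phi>. circle_density f \<phi> \<partial>circle) = 2 * pi"
    and h: "integrable circle (\<lambda>\<theta>. ln (sin \<theta> / ImM_bdry (density lborel (\<lambda>x. ennreal (f x))) \<theta>))"
    and R: "R > 1" and g: "g holomorphic_on ball 0 R"
    and gh: "\<And>z. cmod z < 1 \<Longrightarrow> g z = exp (herglotz (\<lambda>\<theta>. ln (sin \<theta> / ImM_bdry (density lborel (\<lambda>x. ennreal (f x))) \<theta>) / 2) z)"
    and \<rho>: "1 < \<rho>" and N: "N holomorphic_on ball 0 \<rho>" and Ng: "\<And>z. cmod z < \<rho> \<Longrightarrow> N z * g z = 1 - z\<^sup>2"
  shows "\<And>z. cmod z < R \<Longrightarrow> g (cnj z) = cnj (g z)"
    and "AE \<theta> in circle. circle_density f \<theta> = (cmod (N (cis \<theta>)))\<^sup>2 / 2"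
proof -
  define \<gamma> where "\<gamma> = density lborel (\<lambda>x. ennreal (f x))"
  define k where "k = circle_density f"
  define h where "h \<theta> = ln (sin \<theta> / ImM_bdry \<gamma> \<theta>) / 2" for \<theta>
  have hi: "integrable circle h" unfolding h_def using assms(6) by (auto simp: \<gamma>_def)
  have gh': "g z = exp (herglotz h z)" if "cmod z < 1" for z
    using gh[OF that] unfolding h_def \<gamma>_def .
  have k0: "k \<phi> \<ge> 0" for \<phi> using f0 by (simp add: k_def circle_density_def)
  have ik: "integrable circle k"
    unfolding k_def by (rule integrable_circle_density) (use f f0 fs fin in auto)
  have M: "M_fun \<gamma> z = z / (1 - z\<^sup>2) * herglotz k z" if "cmod z < 1" "z \<noteq> 0" for z
    unfolding \<gamma>_def k_def by (rule M_fun_herglotz) (use f f0 fs fin that in auto)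
  have ImM: "AE \<theta> in circle. ImM_bdry \<gamma> \<theta> = k \<theta> / (2 * sin \<theta>)"
    using fatou_herglotz[OF ik k0] AE_circle_not_singular
  proof eventually_elim
    case (elim \<theta>)
    then obtain L where "((\<lambda>r. herglotz k (of_real r * cis \<theta>)) \<longlongrightarrow> L) (at_left 1)" "Re L = k \<theta>" by blast
    then show ?case using radial_boundary_Im[of "herglotz k" \<theta> L \<gamma>] M elim by auto
  qed
  \<comment> \<open>An explicit representative of h. Measurability and the symmetry under theta -> 2
    pi - theta are visible here, whereas \<open>ImM_bdry\<close> is known only almost
    everywhere.\<close>
  define h' where "h' \<theta> = ln (2 * (sin \<theta>)\<^sup>2 / k \<theta>) / 2" for \<theta>
  have hh': "AE \<theta> in circle. h \<theta> = h' \<theta>"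
    using ImM AE_circle_not_singular
  proof eventually_elim
    case (elim \<theta>)
    then show ?case by (simp add: h_def h'_def power2_eq_square mult_ac)
  qed
  have [measurable]: "k \<in> borel_measurable borel" unfolding k_def circle_density_def[abs_def] by measurable
  have "h' \<in> borel_measurable borel" unfolding h'_def[abs_def] by measurable
  then have [measurable]: "h' \<in> borel_measurable circle" by (rule measurable_circleI)
  have h'i: "integrable circle h'"
    using integrable_cong_AE[OF borel_measurable_integrable[OF hi] _ hh'] hi by simp
  have h'sym: "h' (2*pi - \<phi>) = h' \<phi>" for \<phi>
    by (simp add: h'_def k_def circle_density_reflect sin_diff)
  have gsym1: "g (cnj z) = cnj (g z)" if z: "cmod z < 1" for z
    using z herglotz_cong_AE[OF hi h'i hh'] herglotz_cnj[of h' z, OF h'sym] by (simp add: gh' exp_cnj)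
  show gsym: "g (cnj z) = cnj (g z)" if "cmod z < R" for z
    using real_symmetric_continuation[OF g _ gsym1 that] R by simp
  have gcis: "isCont g (cis \<theta>)" for \<theta>
    using holomorphic_on_imp_continuous_on[OF g] R by (simp add: continuous_on_eq_continuous_at)
  have gN: "cmod (N (cis \<theta>)) * cmod (g (cis \<theta>)) = 2 * \<bar>sin \<theta>\<bar>" for \<theta>
    using Ng[of "cis \<theta>"] \<rho> norm_one_minus_cis_sq[of \<theta>] by (simp flip: norm_mult)
  \<comment> \<open>Inside the disc the Poisson integral of h is ln |g|. Fatou's theorem and the
    continuity of g identify the two radial limits.\<close>
  have lng: "AE \<theta> in circle. h \<theta> = ln (cmod (g (cis \<theta>)))"
    using fatou_poisson[OF hi] AE_circle_not_singular
  proof eventually_elim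
    case (elim \<theta>)
    have g0: "g (cis \<theta>) \<noteq> 0" using gN[of \<theta>] elim by auto
    have "((\<lambda>r. complex_of_real r * cis \<theta>) \<longlongrightarrow> complex_of_real 1 * cis \<theta>) (at_left 1)" by (intro tendsto_intros)
    then have "((\<lambda>r. g (of_real r * cis \<theta>)) \<longlongrightarrow> g (cis \<theta>)) (at_left 1)"
      by (intro isCont_tendsto_compose[OF gcis]) simp
    then have l1: "((\<lambda>r. ln (cmod (g (of_real r * cis \<theta>)))) \<longlongrightarrow> ln (cmod (g (cis \<theta>)))) (at_left 1)"
      using g0 by (intro tendsto_intros) auto
    have ev: "\<forall>\<^sub>F r in at_left (1::real). poisson h (of_real r * cis \<theta>) = ln (cmod (g (of_real r * cis \<theta>)))"
      unfolding eventually_at_left_field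
      by (rule exI[of _ 0]) (auto simp: gh' norm_mult Re_herglotz hi)
    from elim have "((\<lambda>r. poisson h (of_real r * cis \<theta>)) \<longlongrightarrow> h \<theta>) (at_left 1)" by blast
    from Lim_transform_eventually[OF this ev] show ?case
      by (rule tendsto_unique[OF trivial_limit_at_left_real _ l1])
  qed
  define N2 where "N2 \<theta> = (cmod (N (cis \<theta>)))\<^sup>2 / 2" for \<theta>
  have alt: "AE \<theta> in circle. (k \<theta> \<noteq> 0 \<and> k \<theta> = N2 \<theta>) \<or> (k \<theta> = 0 \<and> cmod (g (cis \<theta>)) = 1)"
    using lng hh' AE_circle_not_singular
  proof eventually_elim
    case (elim \<theta>)
    have gp: "cmod (g (cis \<theta>)) > 0" using gN[of \<theta>] elim by auto
    have e: "ln (2 * (sin \<theta>)\<^sup>2 / k \<theta>) = 2 * ln (cmod (g (cis \<theta>)))" using elim by (simp add: h'_def)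
    show ?case
    proof (cases "k \<theta> = 0")
      case True
      then have "ln (cmod (g (cis \<theta>))) = 0" using e by simp
      then show ?thesis using gp True by simp
    next
      case False
      then have kp: "k \<theta> > 0" using k0[of \<theta>] by simp
      have "2 * ln (cmod (g (cis \<theta>))) = ln ((cmod (g (cis \<theta>)))\<^sup>2)" using gp by (simp add: ln_realpow)
      with e have "ln (2 * (sin \<theta>)\<^sup>2 / k \<theta>) = ln ((cmod (g (cis \<theta>)))\<^sup>2)" by simp
      then have "2 * (sin \<theta>)\<^sup>2 / k \<theta> = (cmod (g (cis \<theta>)))\<^sup>2"
        using kp gp elim by (subst (asm) ln_inj_iff) auto
      then have "2 * (sin \<theta>)\<^sup>2 = k \<theta> * (cmod (g (cis \<theta>)))\<^sup>2" using kp by (simp add: field_simps)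
      moreover have "4 * (sin \<theta>)\<^sup>2 = (cmod (N (cis \<theta>)))\<^sup>2 * (cmod (g (cis \<theta>)))\<^sup>2"
        using arg_cong[OF gN[of \<theta>], of "\<lambda>x. x\<^sup>2"] by (simp add: power_mult_distrib)
      ultimately have "(cmod (N (cis \<theta>)))\<^sup>2 * (cmod (g (cis \<theta>)))\<^sup>2 = (2 * k \<theta>) * (cmod (g (cis \<theta>)))\<^sup>2" by linarith
      then have "(cmod (N (cis \<theta>)))\<^sup>2 = 2 * k \<theta>" using gp by simp
      then show ?thesis using False by (simp add: N2_def)
    qed
  qed
  have "AE \<theta> in circle. k \<theta> = N2 \<theta>"
  proof (cases "AE \<theta> in circle. \<theta> \<notin> {\<theta>. cmod (g (cis \<theta>)) = 1}")
    case True
    with alt show ?thesis by eventually_elim auto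
  next
    case False
    define Z where "Z = cis ` ({\<theta>. cmod (g (cis \<theta>)) = 1} \<inter> {0..2*pi})"
    have fin: "infinite ({\<theta>. cmod (g (cis \<theta>)) = 1} \<inter> {0..2*pi})" using False by (rule infinite_circle_nonnull)
    have "infinite Z"
    proof
      assume "finite Z"
      moreover have "finite {\<theta> \<in> {0..2*pi}. cis \<theta> = w}" for w by (rule finite_cis_fibre)
      ultimately have "finite (\<Union>w\<in>Z. {\<theta> \<in> {0..2*pi}. cis \<theta> = w})" by blast
      moreover have "{\<theta>. cmod (g (cis \<theta>)) = 1} \<inter> {0..2*pi} \<subseteq> (\<Union>w\<in>Z. {\<theta> \<in> {0..2*pi}. cis \<theta> = w})"
        by (auto simp: Z_def)
      ultimately show False using fin finite_subset by blast
    qed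
    have g1: "cmod (g w) = 1" if "cmod w = 1" for w
    proof (rule unimodular_on_circle[OF R g _ \<open>infinite Z\<close>])
      show "g (cnj z) = cnj (g z)" if "cmod z < R" for z using that by (rule gsym)
    qed (use that in \<open>auto simp: Z_def\<close>)
    have N2': "N2 \<theta> = 2 * (sin \<theta>)\<^sup>2" for \<theta>
    proof -
      have "cmod (N (cis \<theta>)) = 2 * \<bar>sin \<theta>\<bar>" using gN[of \<theta>] g1[of "cis \<theta>"] by simp
      then show ?thesis by (simp add: N2_def power_mult_distrib)
    qed
    have N2: "N2 = (\<lambda>\<theta>. 2 * (sin \<theta>)\<^sup>2)" by (rule ext) (rule N2')
    have iN: "integrable circle N2" unfolding N2
      by (intro integrable_circle_continuous continuous_intros)
    \<comment> \<open>In this case \<open>alt\<close> gives k \<le> N2 almost everywhere, and both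
      have integral 2 pi, so the nonnegative difference vanishes almost everywhere.\<close>
    have le: "AE \<theta> in circle. 0 \<le> N2 \<theta> - k \<theta>"
      using alt by eventually_elim (auto simp: N2_def)
    have "(\<integral>\<theta>. N2 \<theta> - k \<theta> \<partial>circle) = 0"
      unfolding Bochner_Integration.integral_diff[OF iN ik]
      using mass integral_two_sin_sq_circle unfolding N2 k_def by simp
    then have "AE \<theta> in circle. N2 \<theta> - k \<theta> = 0"
      using integral_nonneg_eq_0_iff_AE[OF _ le] iN ik by auto
    then show ?thesis by eventually_elim simp
  qed
  then show "AE \<theta> in circle. circle_density f \<theta> = (cmod (N (cis \<theta>)))\<^sup>2 / 2"
    by (simp add: k_def N2_def)
qed

section \<open>Continuation of the stripped function and simplicity of its zeros\<close>

lemma divide_one_minus_sq: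
  fixes F :: "complex \<Rightarrow> complex"
  assumes F: "F holomorphic_on ball 0 \<sigma>" and \<sigma>: "\<sigma> > 1" and "F 1 = 0" "F (-1) = 0"
  obtains Q where "Q holomorphic_on ball 0 \<sigma>" "\<And>z. cmod z < \<sigma> \<Longrightarrow> (1 - z\<^sup>2) * Q z = F z"
proof -
  define F1 where "F1 z = (if z = 1 then deriv F 1 else (F z - F 1) / (z - 1))" for z
  have F1: "F1 holomorphic_on ball 0 \<sigma>" unfolding F1_def using F by (rule pole_lemma_open) simp
  have e1: "(z - 1) * F1 z = F z" for z using assms by (simp add: F1_def)
  have F1m: "F1 (-1) = 0" using e1[of "-1"] assms by simp
  define F2 where "F2 z = (if z = -1 then deriv F1 (-1) else (F1 z - F1 (-1)) / (z - (-1)))" for z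
  have F2: "F2 holomorphic_on ball 0 \<sigma>" unfolding F2_def using F1 by (rule pole_lemma_open) simp
  have e2: "(z - (-1)) * F2 z = F1 z" for z
  proof (cases "z = -1")
    case False
    then have "z - (-1) \<noteq> 0" by (metis eq_iff_diff_eq_0)
    then show ?thesis using False F1m unfolding F2_def by simp
  qed (simp add: F1m)
  show ?thesis
  proof
    show "(\<lambda>z. - F2 z) holomorphic_on ball 0 \<sigma>" using F2 by (intro holomorphic_intros)
    show "(1 - z\<^sup>2) * (- F2 z) = F z" for z
    proof -
      have "(1 - z\<^sup>2) * (- F2 z) = (z - 1) * ((z - (-1)) * F2 z)" by (simp add: power2_eq_square algebra_simps)
      then show ?thesis unfolding e2 e1 .
    qed
  qed
qed

text \<open>With N g = 1 - z^2 the boundary value of Re K is |N|^2/2, and K(z) + K(1/z) = N(z) N(1/z) near the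
  circle.  Multiplying by g(z) and dividing by 1 - z^2 continues Q = g K / (1 - z^2) to |z| < R, while
  multiplying by g(z) g(1/z) gives a Wronskian-type identity that forbids double zeros of Q.\<close>

lemma jost_stripping:
  fixes g N :: "complex \<Rightarrow> complex"
  assumes g: "g holomorphic_on ball 0 R" and \<rho>: "1 < \<rho>" "\<rho> \<le> R" and N: "N holomorphic_on ball 0 \<rho>"
    and Ng: "\<And>z. cmod z < \<rho> \<Longrightarrow> N z * g z = 1 - z\<^sup>2"
    and gsym: "\<And>z. cmod z < R \<Longrightarrow> g (cnj z) = cnj (g z)"
  defines "k \<equiv> \<lambda>\<phi>. (cmod (N (cis \<phi>)))\<^sup>2 / 2"
  obtains Q K \<sigma> where "1 < \<sigma>" "\<sigma> \<le> \<rho>" "K holomorphic_on ball 0 \<sigma>" "\<And>z. cmod z < 1 \<Longrightarrow> K z = herglotz k z"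
    "\<And>\<phi>. Re (K (cis \<phi>)) = k \<phi>" "Q holomorphic_on ball 0 R" "\<And>z. cmod z < \<sigma> \<Longrightarrow> K z = N z * Q z"
    "\<And>z. cmod z < \<sigma> \<Longrightarrow> (1 - z\<^sup>2) * Q z = g z * K z"
    "\<And>z. z \<in> cball 0 1 - {1,-1} \<Longrightarrow> Q z \<noteq> 0"
    "Q 1 = 0 \<longrightarrow> deriv Q 1 \<noteq> 0" "Q (-1) = 0 \<longrightarrow> deriv Q (-1) \<noteq> 0"
    "\<And>z. cmod z < R \<Longrightarrow> Q (cnj z) = cnj (Q z)"
proof -
  have sq1: "1 - z\<^sup>2 \<noteq> 0" if "z \<noteq> 1" "z \<noteq> -1" for z :: complex using that by (auto simp: power2_eq_1_iff)
  have sq1': "1 - z\<^sup>2 \<noteq> 0" if "cmod z \<noteq> 1" for z :: complex using that by (intro sq1) auto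
  have gnz: "g z \<noteq> 0" "N z \<noteq> 0" if "cmod z < 1" for z
    using Ng[of z] sq1'[of z] that \<rho> by auto
  have Nsym: "N (cnj z) = cnj (N z)" if "cmod z < \<rho>" for z
  proof (rule real_symmetric_continuation[OF N _ _ that])
    fix z :: complex assume z: "cmod z < 1"
    have "N (cnj z) * g (cnj z) = cnj (N z * g z)" using Ng[of z] Ng[of "cnj z"] z \<rho> by simp
    then have "N (cnj z) * cnj (g z) = cnj (N z) * cnj (g z)" using gsym[of z] z \<rho> by simp
    then show "N (cnj z) = cnj (N z)" using gnz[OF z] by simp
  qed (use \<rho> in auto)
  obtain K \<sigma> where \<sigma>: "1 < \<sigma>" "\<sigma> \<le> \<rho>" and K: "K holomorphic_on ball 0 \<sigma>" and KH': "\<And>z. cmod z < 1 \<Longrightarrow> K z = herglotz (\<lambda>\<phi>. (cmod (N (cis \<phi>)))\<^sup>2 / 2) z"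
    and rel: "\<And>z. 1/\<sigma> < cmod z \<Longrightarrow> cmod z < \<sigma> \<Longrightarrow> K z + K (inverse z) = N z * N (inverse z)"
    and ReK': "\<And>\<phi>. Re (K (cis \<phi>)) = (cmod (N (cis \<phi>)))\<^sup>2 / 2"
    by (rule herglotz_extension[OF N \<rho>(1)]) (rule Nsym, assumption, blast)
  have KH: "K z = herglotz k z" if "cmod z < 1" for z using KH'[OF that] unfolding k_def .
  have ReK: "Re (K (cis \<phi>)) = k \<phi>" for \<phi> using ReK' by (simp add: k_def)
  have gK: "(\<lambda>z. g z * K z) holomorphic_on ball 0 \<sigma>"
    using K \<sigma> \<rho> by (intro holomorphic_intros holomorphic_on_subset[OF g]) auto
  \<comment> \<open>At 1 and -1 a point equals its inverse, so the functional equation reads 2 K(a)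
    = N(a)^2, and g(a) N(a) = 1 - a^2 = 0. This permits the division by 1 - z^2.\<close>
  have gK0: "g a * K a = 0" if a: "a = 1 \<or> a = -1" for a
  proof -
    have "2 * K a = N a * N a" using rel[of a] a \<sigma> by auto
    then have "2 * (g a * K a) = N a * (N a * g a)" by (simp add: algebra_simps)
    also have "N a * g a = 0" using Ng[of a] a \<rho> by auto
    finally show ?thesis by simp
  qed
  obtain Q1 where Q1: "Q1 holomorphic_on ball 0 \<sigma>" and Q1e: "\<And>z. cmod z < \<sigma> \<Longrightarrow> (1 - z\<^sup>2) * Q1 z = g z * K z"
    using divide_one_minus_sq[OF gK \<sigma>(1)] gK0 by blast
  have KNQ: "K z = N z * Q1 z" if "cmod z < \<sigma>" for z
  proof (rule analytic_continuation_open[of "ball 0 1" "ball 0 \<sigma>" K "\<lambda>z. N z * Q1 z"])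
    show "(\<lambda>z. N z * Q1 z) holomorphic_on ball 0 \<sigma>"
      using Q1 \<sigma> by (intro holomorphic_intros holomorphic_on_subset[OF N]) auto
    fix w :: complex assume "w \<in> ball 0 1"
    then have w: "cmod w < 1" by simp
    have "g w * K w = (N w * g w) * Q1 w" using Q1e[of w] Ng[of w] w \<sigma> by simp
    then show "K w = N w * Q1 w" using gnz[OF w] by (simp add: mult_ac)
  qed (use K \<sigma> that in auto)
  \<comment> \<open>Outside the closed disc K(z) is replaced by N(z) N(1/z) - K(1/z), and g N = 1 -
    z^2 simplifies the first term. Only values of N and K inside the disc occur, so the formula
    reaches as far as g does.\<close>
  define Q2 where "Q2 z = N (inverse z) - g z * K (inverse z) / (1 - z\<^sup>2)" for z
  have out: "cmod (inverse z) < 1" "z \<noteq> 0" if "cmod z > 1" for z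
    using that by (auto simp: norm_inverse inverse_less_1_iff)
  have Q2: "Q2 holomorphic_on {z. 1 < cmod z \<and> cmod z < R}"
    unfolding Q2_def using out \<sigma> \<rho> sq1'
    by (intro holomorphic_intros holomorphic_on_subset[OF g] holomorphic_on_compose_gen[OF _ N, unfolded o_def]
         holomorphic_on_compose_gen[OF _ K, unfolded o_def]) (force simp del: norm_inverse)+
  have Q12: "Q1 z = Q2 z" if z: "1 < cmod z" "cmod z < \<sigma>" for z
  proof -
    have n: "1 - z\<^sup>2 \<noteq> 0" using sq1'[of z] z by simp
    have "1/\<sigma> < cmod z" using z \<sigma> by (simp add: field_simps less_1_mult)
    then have "K (inverse z) = N z * N (inverse z) - K z" using rel[of z] z by (simp add: algebra_simps)
    then have "g z * K (inverse z) = g z * (N z * N (inverse z) - K z)" by simp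
    also have "\<dots> = (N z * g z) * N (inverse z) - g z * K z" by (simp add: algebra_simps)
    also have "\<dots> = (1 - z\<^sup>2) * N (inverse z) - (1 - z\<^sup>2) * Q1 z" using Q1e[of z] Ng[of z] z \<sigma> by simp
    also have "\<dots> = (1 - z\<^sup>2) * (N (inverse z) - Q1 z)" by (rule right_diff_distrib[symmetric])
    finally show ?thesis unfolding Q2_def using n by simp
  qed
  define Q where "Q z = (if cmod z < \<sigma> then Q1 z else Q2 z)" for z
  have Qh: "Q holomorphic_on ball 0 R"
  proof -
    have "Q holomorphic_on ball 0 \<sigma>" using Q1 by (rule holomorphic_transform) (simp add: Q_def)
    moreover have "Q holomorphic_on {z. 1 < cmod z \<and> cmod z < R}"
      using Q2 by (rule holomorphic_transform) (simp add: Q_def Q12)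
    moreover have "open {z::complex. 1 < cmod z \<and> cmod z < R}"
      by (intro open_Collect_conj open_Collect_less continuous_intros)
    ultimately have "Q holomorphic_on ball 0 \<sigma> \<union> {z. 1 < cmod z \<and> cmod z < R}"
      by (intro holomorphic_on_Un) auto
    then show ?thesis by (rule holomorphic_on_subset) (use \<sigma> in auto)
  qed
  have Qe: "(1 - z\<^sup>2) * Q z = g z * K z" and KQ: "K z = N z * Q z" if "cmod z < \<sigma>" for z
    using Q1e[OF that] KNQ[OF that] that by (simp_all add: Q_def)
  have cN: "continuous_on UNIV (\<lambda>\<phi>. N (cis \<phi>))"
    using holomorphic_on_imp_continuous_on[OF N]
    by (rule continuous_on_compose2) (use \<rho> in \<open>auto intro!: continuous_intros\<close>)
  have ck: "continuous_on {0..2*pi} k"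
    unfolding k_def by (intro continuous_intros continuous_on_subset[OF cN]) auto
  have ik: "integrable circle k" using ck by (rule integrable_circle_continuous)
  have kpos: "k \<phi> > 0" if "sin \<phi> \<noteq> 0" for \<phi>
  proof -
    have "N (cis \<phi>) \<noteq> 0" using Ng[of "cis \<phi>"] \<rho> norm_one_minus_cis_sq[of \<phi>] that by auto
    then show ?thesis by (simp add: k_def)
  qed
  \<comment> \<open>Re K is the Poisson integral of a density that is positive almost
    everywhere.\<close>
  have Knz: "K z \<noteq> 0" if z: "cmod z < 1" for z
  proof
    assume "K z = 0"
    then have p: "poisson k z = 0" using KH[OF z] Re_herglotz[OF z ik] by simp
    have nn: "AE \<phi> in circle. 0 \<le> poisson_kernel z \<phi> * k \<phi>"
      by (intro AE_I2 mult_nonneg_nonneg poisson_kernel_nonneg z) (simp add: k_def)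
    have ip: "integrable circle (\<lambda>\<phi>. poisson_kernel z \<phi> * k \<phi>)"
      by (intro integrable_circle_mult_real continuous_on_poisson_kernel z ik)
    have "AE \<phi> in circle. poisson_kernel z \<phi> * k \<phi> = 0"
      using p integral_nonneg_eq_0_iff_AE[OF ip nn] by (simp add: poisson_def)
    then have "AE \<phi> in circle. False"
      using AE_circle_not_singular
    proof eventually_elim
      case (elim \<phi>)
      have "(cmod z)\<^sup>2 < 1" using z by (simp add: power_less_one_iff)
      then have "poisson_kernel z \<phi> > 0"
        unfolding poisson_kernel_def using cis_neq[OF z, of \<phi>] by (intro divide_pos_pos) auto
      then show ?case using elim kpos[of \<phi>] by simp
    qed
    then have "emeasure circle (space circle) = 0" by (simp only: eventually_False ae_filter_eq_bot_iff)
    then show False by (simp add: emeasure_restrict_space space_restrict_space)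
  qed
  have Qnz: "Q z \<noteq> 0" if z: "z \<in> cball 0 1 - {1,-1}" for z
  proof -
    have "K z \<noteq> 0"
    proof (cases "cmod z < 1")
      case False
      then have "cmod z = 1" using z by simp
      then obtain \<phi> where \<phi>: "z = cis \<phi>" by (metis cis_Arg norm_zero sgn_eq zero_neq_one div_by_1 of_real_1)
      have "cmod (1 - (cis \<phi>)\<^sup>2) \<noteq> 0" using sq1[of z] z \<phi> by auto
      then have "sin \<phi> \<noteq> 0" using norm_one_minus_cis_sq[of \<phi>] by auto
      then show ?thesis using kpos[of \<phi>] ReK[of \<phi>] \<phi> by auto
    qed (rule Knz)
    then show ?thesis using KQ[of z] z \<sigma> by auto
  qed
  \<comment> \<open>If Q had a double zero at a, so would Q(1/z), since 1/a = a. Then the left side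
    of the identity for Q(z) and Q(1/z), divided by z - a, would tend to 0, while its right side
    tends to 2 a / a^2.\<close>
  have simple: "deriv Q a \<noteq> 0" if a: "a = 1 \<or> a = -1" and Qa: "Q a = 0" for a
  proof
    assume d0: "deriv Q a = 0"
    have aa: "inverse a = a" "a\<^sup>2 = 1" "a \<noteq> 0" "cmod a = 1" using a by auto
    have aR: "a \<in> ball 0 R" using aa \<sigma> \<rho> by simp
    have dQ: "(Q has_field_derivative 0) (at a)" using holomorphic_derivI[OF Qh _ aR] d0 by simp
    have dinv: "(inverse has_field_derivative - (inverse a * 1 * inverse a)) (at a)"
      by (rule DERIV_inverse'[OF DERIV_ident aa(3)])
    have dQi: "((\<lambda>z. Q (inverse z)) has_field_derivative 0 * - (inverse a * 1 * inverse a)) (at a)"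
      by (rule DERIV_chain2[OF _ dinv]) (use dQ aa in simp)
    have l1: "((\<lambda>z. Q z / (z - a)) \<longlongrightarrow> 0) (at a)" using dQ Qa by (simp add: has_field_derivative_iff)
    have l2: "((\<lambda>z. Q (inverse z) / (z - a)) \<longlongrightarrow> 0) (at a)" using dQi Qa aa by (simp add: has_field_derivative_iff)
    have gc: "(g \<longlongrightarrow> g a) (at a)"
      using holomorphic_on_imp_continuous_on[OF g] aR by (simp add: continuous_on_eq_continuous_at isCont_def)
    have ginv: "((\<lambda>z. g (inverse z)) \<longlongrightarrow> g a) (at a)"
    proof -
      have "isCont g (inverse a)" using gc aa by (simp add: isCont_def)
      moreover have "(inverse \<longlongrightarrow> inverse a) (at a)" using aa by (intro tendsto_intros)
      ultimately have "((\<lambda>z. g (inverse z)) \<longlongrightarrow> g (inverse a)) (at a)" by (rule isCont_tendsto_compose)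
      then show ?thesis by (simp add: aa)
    qed
    have lim: "((\<lambda>z. Q z / (z - a) * g (inverse z) - (inverse z)\<^sup>2 * (Q (inverse z) / (z - a)) * g z) \<longlongrightarrow> 0 * g a - (inverse a)\<^sup>2 * 0 * g a) (at a)"
      using aa by (intro tendsto_intros l1 l2 gc ginv) auto
    have lim2: "((\<lambda>z. (z + a) * (inverse z)\<^sup>2) \<longlongrightarrow> (a + a) * (inverse a)\<^sup>2) (at a)"
      using aa by (intro tendsto_intros) auto
    have "\<forall>\<^sub>F z in at a. z \<noteq> a \<and> z \<noteq> - a \<and> 1/\<sigma> < cmod z \<and> cmod z < \<sigma>"
    proof (intro eventually_conj)
      show "\<forall>\<^sub>F z in at a. z \<noteq> a" by (simp add: eventually_at_filter)
      have nl: "(cmod \<longlongrightarrow> cmod a) (at a)" by (intro tendsto_intros)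
      show "\<forall>\<^sub>F z in at a. 1/\<sigma> < cmod z" using order_tendstoD(1)[OF nl] aa \<sigma> by simp
      show "\<forall>\<^sub>F z in at a. cmod z < \<sigma>" using order_tendstoD(2)[OF nl] aa \<sigma> by simp
      have "\<forall>\<^sub>F z in nhds a. z \<noteq> - a" using aa by (intro t1_space_nhds) auto
      then show "\<forall>\<^sub>F z in at a. z \<noteq> - a" by (simp add: eventually_at_filter eventually_mono)
    qed
    then have "\<forall>\<^sub>F z in at a. Q z / (z - a) * g (inverse z) - (inverse z)\<^sup>2 * (Q (inverse z) / (z - a)) * g z = (z + a) * (inverse z)\<^sup>2"
    proof eventually_elim
      case (elim z)
      have z0: "z \<noteq> 0" using elim \<sigma> by (auto simp: divide_less_0_iff)
      have zi: "cmod (inverse z) < \<sigma>"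
      proof -
        have "0 < cmod z" using z0 by simp
        then have "inverse (cmod z) < \<sigma>" using elim \<sigma> by (simp add: field_simps)
        then show ?thesis by (simp only: norm_inverse)
      qed
      have n: "1 - z\<^sup>2 \<noteq> 0" using sq1[of z] elim a by auto
      have i: "1 - (inverse z)\<^sup>2 = - (inverse z)\<^sup>2 * (1 - z\<^sup>2)" using z0 by (simp add: field_simps)
      have "g z * g (inverse z) * (K z + K (inverse z)) = (N z * g z) * (N (inverse z) * g (inverse z))"
        using rel[of z] elim by (simp add: mult_ac)
      also have "\<dots> = (1 - z\<^sup>2) * (1 - (inverse z)\<^sup>2)"
        using Ng[of z] Ng[of "inverse z"] elim zi \<sigma> by simp
      finally have "(g z * K z) * g (inverse z) + (g (inverse z) * K (inverse z)) * g z = (1 - z\<^sup>2) * (1 - (inverse z)\<^sup>2)"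
        by (simp add: algebra_simps)
      then have "((1 - z\<^sup>2) * Q z) * g (inverse z) + ((1 - (inverse z)\<^sup>2) * Q (inverse z)) * g z = (1 - z\<^sup>2) * (1 - (inverse z)\<^sup>2)"
        using Qe[of z] Qe[of "inverse z"] elim zi by simp
      then have "(1 - z\<^sup>2) * (Q z * g (inverse z) - (inverse z)\<^sup>2 * Q (inverse z) * g z) = (1 - z\<^sup>2) * (- (inverse z)\<^sup>2 * (1 - z\<^sup>2))"
        unfolding i by (simp add: algebra_simps)
      then have e: "Q z * g (inverse z) - (inverse z)\<^sup>2 * Q (inverse z) * g z = - (inverse z)\<^sup>2 * (1 - z\<^sup>2)"
        using n by (metis mult_left_cancel)
      have "Q z / (z - a) * g (inverse z) - (inverse z)\<^sup>2 * (Q (inverse z) / (z - a)) * g z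
        = (Q z * g (inverse z) - (inverse z)\<^sup>2 * Q (inverse z) * g z) / (z - a)"
        by (simp add: diff_divide_distrib)
      also have "\<dots> = (- (inverse z)\<^sup>2 * (1 - z\<^sup>2)) / (z - a)" by (simp only: e)
      also have "- (inverse z)\<^sup>2 * (1 - z\<^sup>2) = ((z + a) * (inverse z)\<^sup>2) * (z - a)"
        using aa(2) by (simp add: power2_eq_square algebra_simps)
      finally show ?case using elim by simp
    qed
    from Lim_transform_eventually[OF lim this] have "((\<lambda>z. (z + a) * (inverse z)\<^sup>2) \<longlongrightarrow> 0) (at a)" by simp
    from tendsto_unique[OF _ this lim2] have "(a + a) * (inverse a)\<^sup>2 = 0" by simp
    then show False using a by auto
  qed
  have ksym: "k (2*pi - \<phi>) = k \<phi>" for \<phi>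
    using Nsym[of "cis \<phi>"] \<rho> by (simp add: k_def cis_reflect)
  have Qsym: "Q (cnj z) = cnj (Q z)" if "cmod z < R" for z
  proof (rule real_symmetric_continuation[OF Qh _ _ that])
    fix z :: complex assume z: "cmod z < 1"
    have "N (cnj z) * Q (cnj z) = cnj (N z * Q z)"
      using KQ[of z] KQ[of "cnj z"] z \<sigma> herglotz_cnj[of k z, OF ksym] by (simp add: KH flip: KQ)
    then have "cnj (N z) * Q (cnj z) = cnj (N z) * cnj (Q z)" using Nsym[of z] z \<rho> by simp
    then show "Q (cnj z) = cnj (Q z)" using gnz[OF z] by simp
  qed (use \<rho> in auto)
  show ?thesis
    by (rule that[OF \<sigma> K KH ReK Qh KQ Qe Qnz _ _ Qsym]) (use simple in auto)
qed

section \<open>Construction of the stripped spectral measure and its Jost function\<close>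

lemma eventually_joukowski_large: "\<forall>\<^sub>F z in at (0::complex). z \<noteq> 0 \<and> cmod z < 1 \<and> c < cmod (z + inverse z)"
proof -
  define d where "d = 1 / (\<bar>c\<bar> + 2)"
  have d: "0 < d" "d \<le> 1" by (simp_all add: d_def add_pos_pos divide_le_eq)
  have "c < cmod (z + inverse z)" if "z \<noteq> 0" "cmod z < d" for z
  proof -
    have z1: "cmod z < 1" and z2: "cmod z < 1 / (\<bar>c\<bar> + 2)" using that d(2) by (auto simp: d_def[symmetric])
    have zp: "cmod z > 0" using that by simp
    have "\<bar>c\<bar> + 2 < inverse (cmod z)" using z2 zp by (simp add: field_simps)
    moreover have "inverse (cmod z) - cmod z \<le> cmod (z + inverse z)"
      using norm_triangle_ineq2[of "inverse z" "- z"] by (simp add: norm_inverse add.commute)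
    ultimately show ?thesis using z1 by linarith
  qed
  then show ?thesis unfolding eventually_at using d by (intro exI[of _ d]) auto
qed

text \<open>The density solves 2 pi f(2 cos phi) |sin phi| = |N|^2 / 2 with phi = arccos (x/2);
  angles above pi are reached by the symmetry of N. At the ends of [-2,2] the quotient is singular,
  and f is set to 0 there.\<close>

lemma two_cos_density:
  fixes N :: "complex \<Rightarrow> complex"
  assumes N: "N holomorphic_on ball 0 \<rho>" and \<rho>: "\<rho> > 1" and sym: "\<And>z. cmod z < \<rho> \<Longrightarrow> N (cnj z) = cnj (N z)"
  obtains f where "f \<in> borel_measurable borel" "\<And>x. f x \<ge> 0" "\<And>x. x \<notin> {-2..2} \<Longrightarrow> f x = 0"
    "(\<integral>\<^sup>+x. ennreal (f x) \<partial>lborel) < \<infinity>"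
    "\<And>\<phi>. \<phi> \<in> {0..2*pi} \<Longrightarrow> sin \<phi> \<noteq> 0 \<Longrightarrow> circle_density f \<phi> = (cmod (N (cis \<phi>)))\<^sup>2 / 2"
proof -
  define F where "F x = (cmod (N (cis (arccos (x/2)))))\<^sup>2 / (4 * pi * sqrt (1 - (x/2)\<^sup>2))" for x
  define f where "f x = indicator {-2<..<2} x *\<^sub>R F x" for x
  have cN: "continuous_on A (\<lambda>\<phi>. N (cis \<phi>))" for A
    using holomorphic_on_imp_continuous_on[OF N]
    by (rule continuous_on_compose2) (use \<rho> in \<open>auto intro!: continuous_intros\<close>)
  have cF: "continuous_on {-2<..<2} F"
  proof -
    have sq: "(x/2)\<^sup>2 < 1" if "x \<in> {-2<..<2}" for x :: real
      using that by (auto simp: abs_square_less_1 abs_less_iff)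
    have "continuous_on {-2<..<2} (\<lambda>x. N (cis (arccos (x/2))))"
      by (rule continuous_on_compose2[OF cN[of UNIV]]) (auto intro!: continuous_intros)
    then show ?thesis unfolding F_def using sq by (intro continuous_intros) fastforce+
  qed
  have fm: "f \<in> borel_measurable borel" unfolding f_def[abs_def]
    by (rule borel_measurable_continuous_on_indicator[OF _ cF]) simp
  have f0: "f x \<ge> 0" for x
  proof (cases "x \<in> {-2<..<2}")
    case True
    then have "(x/2)\<^sup>2 \<le> 1" by (auto simp: abs_square_le_1 abs_le_iff)
    then show ?thesis using True by (simp add: f_def F_def)
  qed (simp add: f_def)
  have fs: "f x = 0" if "x \<notin> {-2..2}" for x using that by (auto simp: f_def)
  have cd: "circle_density f \<phi> = (cmod (N (cis \<phi>)))\<^sup>2 / 2" if \<phi>: "\<phi> \<in> {0..2*pi}" "sin \<phi> \<noteq> 0" for \<phi>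
  proof -
    have s: "(sin \<phi>)\<^sup>2 > 0" using that by simp
    then have "(cos \<phi>)\<^sup>2 < 1" using sin_cos_squared_add[of \<phi>] by linarith
    then have "\<bar>cos \<phi>\<bar> < 1" by (simp add: abs_square_less_1)
    then have i: "2 * cos \<phi> \<in> {-2<..<2}" by auto
    have sq: "sqrt (1 - (cos \<phi>)\<^sup>2) = \<bar>sin \<phi>\<bar>" by (simp add: sin_squared_eq[symmetric])
    have "cmod (N (cis (arccos (cos \<phi>)))) = cmod (N (cis \<phi>))"
    proof (cases "\<phi> \<le> pi")
      case True then show ?thesis using \<phi> by (simp add: arccos_cos)
    next
      case False
      have "arccos (cos \<phi>) = arccos (cos (2*pi - \<phi>))" by (simp add: cos_diff)
      also have "\<dots> = 2*pi - \<phi>" using \<phi> False by (intro arccos_cos) auto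
      finally show ?thesis using sym[of "cis \<phi>"] \<rho> by (simp add: cis_reflect)
    qed
    then have "f (2 * cos \<phi>) = (cmod (N (cis \<phi>)))\<^sup>2 / (4 * pi * \<bar>sin \<phi>\<bar>)"
      using i sq by (simp add: f_def F_def)
    then show ?thesis using that by (simp add: circle_density_def)
  qed
  have k1: "integrable circle (\<lambda>\<phi>. (cmod (N (cis \<phi>)))\<^sup>2 / 2)"
    by (intro integrable_circle_continuous continuous_intros cN) auto
  have "(\<integral>\<^sup>+\<phi>. ennreal (circle_density f \<phi>) \<partial>circle) = (\<integral>\<^sup>+\<phi>. ennreal ((cmod (N (cis \<phi>)))\<^sup>2 / 2) \<partial>circle)"
  proof (rule nn_integral_cong_AE)
    show "AE \<phi> in circle. ennreal (circle_density f \<phi>) = ennreal ((cmod (N (cis \<phi>)))\<^sup>2 / 2)"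
      using AE_circle_not_singular by eventually_elim (simp add: cd)
  qed
  also have "\<dots> = ennreal (\<integral>\<phi>. (cmod (N (cis \<phi>)))\<^sup>2 / 2 \<partial>circle)"
    using k1 by (intro nn_integral_eq_integral) auto
  finally have "(\<integral>\<^sup>+\<phi>. ennreal (circle_density f \<phi>) \<partial>circle) < \<infinity>" by simp
  moreover have "(\<integral>\<^sup>+\<phi>. ennreal (circle_density f \<phi>) \<partial>circle) = ennreal (2*pi) * (\<integral>\<^sup>+x. ennreal (f x) \<partial>lborel)"
    by (rule nn_integral_circle_density) (use fm f0 fs in auto)
  ultimately have "ennreal (2*pi) * (\<integral>\<^sup>+x. ennreal (f x) \<partial>lborel) < \<infinity>" by simp
  then have "(\<integral>\<^sup>+x. ennreal (f x) \<partial>lborel) < \<infinity>" by (auto simp: ennreal_mult_less_top)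
  then show ?thesis using that fm f0 fs cd by blast
qed

text \<open>Here Im M is |N|^2 / (4 sin theta) on the circle, so N U = 1 - z^2 turns sin theta / Im
  M into |U|^2. By \<open>outer_representation\<close> U is then the exponential of the required
  integral.\<close>

lemma jost_function_density:
  fixes U N H :: "complex \<Rightarrow> complex"
  assumes f: "f \<in> borel_measurable borel" "\<And>x. f x \<ge> 0" "\<And>x. x \<notin> {-2..2} \<Longrightarrow> f x = 0"
    and fin: "(\<integral>\<^sup>+x. ennreal (f x) \<partial>lborel) < \<infinity>"
    and \<rho>: "\<rho> > 1" and U: "U holomorphic_on ball 0 \<rho>" and N: "N holomorphic_on ball 0 \<rho>"
    and NU: "\<And>z. cmod z < \<rho> \<Longrightarrow> N z * U z = 1 - z\<^sup>2"
    and c: "U 0 = complex_of_real c" "c > 0"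
    and H: "H holomorphic_on ball 0 \<sigma>" "\<sigma> > 1" "\<And>z. cmod z < 1 \<Longrightarrow> herglotz (circle_density f) z = H z"
      "\<And>\<phi>. sin \<phi> \<noteq> 0 \<Longrightarrow> Re (H (cis \<phi>)) = (cmod (N (cis \<phi>)))\<^sup>2 / 2"
    and sp: "spectral_measure a b (density lborel (\<lambda>x. ennreal (f x)))"
  shows "jost_function a b U"
proof -
  define \<gamma> where "\<gamma> = density lborel (\<lambda>x. ennreal (f x))"
  have M: "M_fun \<gamma> z = z / (1 - z\<^sup>2) * H z" if "cmod z < 1" "z \<noteq> 0" for z
    using M_fun_herglotz[of f z] f fin that H(3)[of z] by (simp add: \<gamma>_def)
  have st: "standing_form \<gamma>" unfolding standing_form_def
    by (rule exI[of _ f], rule exI[of _ "{}"], rule exI[of _ "\<lambda>_. 0"])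
       (use f in \<open>auto simp: \<gamma>_def emeasure_density\<close>)
  have jz: "jost_zeros \<gamma> = {}"
    using emeasure_density_singleton[OF f(1)] by (simp add: jost_zeros_def \<gamma>_def)
  have bd: "ln (sin \<theta> / ImM_bdry \<gamma> \<theta>) = 2 * ln (cmod (U (cis \<theta>)))" if s: "sin \<theta> \<noteq> 0" for \<theta>
  proof -
    have "isCont H (cis \<theta>)"
      using holomorphic_on_imp_continuous_on[OF H(1)] H(2) by (simp add: continuous_on_eq_continuous_at)
    moreover have "((\<lambda>r. complex_of_real r * cis \<theta>) \<longlongrightarrow> complex_of_real 1 * cis \<theta>) (at_left 1)"
      by (intro tendsto_intros)
    ultimately have "((\<lambda>r. H (of_real r * cis \<theta>)) \<longlongrightarrow> H (cis \<theta>)) (at_left 1)"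
      by (intro isCont_tendsto_compose[of _ H]) auto
    then have "ImM_bdry \<gamma> \<theta> = Re (H (cis \<theta>)) / (2 * sin \<theta>)"
      by (rule radial_boundary_Im[OF _ s M])
    then have I: "ImM_bdry \<gamma> \<theta> = (cmod (N (cis \<theta>)))\<^sup>2 / (4 * sin \<theta>)" using H(4)[OF s] by simp
    have NU': "cmod (N (cis \<theta>)) * cmod (U (cis \<theta>)) = 2 * \<bar>sin \<theta>\<bar>"
      using NU[of "cis \<theta>"] \<rho> norm_one_minus_cis_sq[of \<theta>] by (simp flip: norm_mult)
    then have n0: "cmod (N (cis \<theta>)) \<noteq> 0" "cmod (U (cis \<theta>)) \<noteq> 0" using s by auto
    have "(cmod (N (cis \<theta>)))\<^sup>2 * (cmod (U (cis \<theta>)))\<^sup>2 = 4 * (sin \<theta>)\<^sup>2"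
      using arg_cong[OF NU', of "\<lambda>x. x\<^sup>2"] by (simp add: power_mult_distrib)
    then have "4 * (sin \<theta>)\<^sup>2 / (cmod (N (cis \<theta>)))\<^sup>2 = (cmod (U (cis \<theta>)))\<^sup>2"
      using n0 by (simp add: divide_eq_eq mult_ac)
    moreover have "sin \<theta> / ImM_bdry \<gamma> \<theta> = 4 * (sin \<theta>)\<^sup>2 / (cmod (N (cis \<theta>)))\<^sup>2"
      unfolding I using n0 s by (simp add: power2_eq_square)
    ultimately show ?thesis using n0 by (simp add: ln_realpow)
  qed
  have rep1: "integrable circle (\<lambda>\<phi>. ln (cmod (U (cis \<phi>))))"
    by (rule outer_representation[OF U N \<rho> _ c]) (rule NU)
  have rep2: "U z = exp (herglotz (\<lambda>\<phi>. ln (cmod (U (cis \<phi>)))) z)" if "cmod z < 1" for z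
    by (rule outer_representation[OF U N \<rho> _ c]) (rule NU that, assumption?)+
  let ?X = "{0, pi, 2*pi}"
  have bd': "ln (sin \<theta> / ImM_bdry \<gamma> \<theta>) = 2 * ln (cmod (U (cis \<theta>)))" if "\<theta> \<in> space circle" "\<theta> \<notin> ?X" for \<theta>
  proof (rule bd)
    show "sin \<theta> \<noteq> 0"
    proof (cases "\<theta> < pi")
      case True
      then show ?thesis using that sin_gt_zero[of \<theta>] by (auto simp: space_restrict_space)
    next
      case False
      then show ?thesis using that sin_lt_zero[of \<theta>] by (auto simp: space_restrict_space)
    qed
  qed
  \<comment> \<open>Equality off a countable null set transfers integrability and integrals without
    a separate measurability argument for \<open>ImM_bdry\<close>.\<close>
  have X: "countable ?X" "\<And>x. x \<in> ?X \<Longrightarrow> emeasure circle {x} = 0" "\<And>x. x \<in> ?X \<Longrightarrow> {x} \<in> sets circle"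
    by (auto simp: emeasure_restrict_space sets_restrict_space_iff)
  have "integrable circle (\<lambda>\<theta>. 2 * ln (cmod (U (cis \<theta>))))" using rep1 by simp
  then have i: "integrable circle (\<lambda>\<theta>. ln (sin \<theta> / ImM_bdry \<gamma> \<theta>))"
    using integrable_discrete_difference[OF X, of "\<lambda>\<theta>. ln (sin \<theta> / ImM_bdry \<gamma> \<theta>)" "\<lambda>\<theta>. 2 * ln (cmod (U (cis \<theta>)))"] bd' by simp
  have Uz: "U z = exp (set_lebesgue_integral lborel {0..2*pi} (\<lambda>\<theta>. (cis \<theta> + z) / (cis \<theta> - z) *
      complex_of_real (ln (sin \<theta> / ImM_bdry \<gamma> \<theta>) / (4 * pi))))" if z: "cmod z < 1" for z
  proof -
    have "set_lebesgue_integral lborel {0..2*pi} (\<lambda>\<theta>. (cis \<theta> + z) / (cis \<theta> - z) *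
        complex_of_real (ln (sin \<theta> / ImM_bdry \<gamma> \<theta>) / (4 * pi)))
      = (\<integral>\<theta>. (cis \<theta> + z) / (cis \<theta> - z) * complex_of_real (ln (sin \<theta> / ImM_bdry \<gamma> \<theta>) / (4 * pi)) \<partial>circle)"
      by (rule integral_circle_eq[symmetric])
    also have "\<dots> = (\<integral>\<theta>. (cis \<theta> + z) / (cis \<theta> - z) * complex_of_real (2 * ln (cmod (U (cis \<theta>))) / (4 * pi)) \<partial>circle)"
      by (rule integral_discrete_difference[OF X]) (use bd' in auto)
    also have "\<dots> = (\<integral>\<theta>. (cis \<theta> + z) / (cis \<theta> - z) * complex_of_real (ln (cmod (U (cis \<theta>)))) / (2 * pi) \<partial>circle)"
      by (intro Bochner_Integration.integral_cong) auto
    also have "\<dots> = herglotz (\<lambda>\<theta>. ln (cmod (U (cis \<theta>)))) z"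
      unfolding herglotz_def by (rule integral_divide_zero)
    finally show ?thesis using rep2[OF z] by simp
  qed
  show ?thesis unfolding jost_function_def
    using sp st i Uz jz unfolding \<gamma>_def[symmetric] integrable_circle_iff
    by (intro exI[of _ \<gamma>]) simp
qed

text \<open>The work lies in producing a measure with prescribed moments: the moment series lives
  near z = 0, the density on the circle, and the function \<open>L\<close> links the two.\<close>

lemma good_jost_stripped:
  assumes R: "R > 1" and J: "jacobi a b" and jf: "jost_function a b u" and good: "good_jost R u"
  shows "\<exists>un. jost_function (strip 1 a) (strip 1 b) un \<and> good_jost R un"
proof -
  obtain \<gamma> where sp: "spectral_measure a b \<gamma>" and st: "standing_form \<gamma>"
    and hi0: "set_integrable lborel {0..2*pi} (\<lambda>\<theta>. ln (sin \<theta> / ImM_bdry \<gamma> \<theta>))"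
    and uz: "\<And>z. z \<in> ball 0 1 \<Longrightarrow> u z = (\<Prod>\<zeta>\<in>jost_zeros \<gamma>. (z - \<zeta>) / (1 - cnj \<zeta> * z)) *
        exp (set_lebesgue_integral lborel {0..2*pi}
               (\<lambda>\<theta>. (cis \<theta> + z) / (cis \<theta> - z) * complex_of_real (ln (sin \<theta> / ImM_bdry \<gamma> \<theta>) / (4 * pi))))"
    using jf unfolding jost_function_def by blast
  obtain g where g: "g holomorphic_on ball 0 R" and gu: "\<And>z. z \<in> ball 0 1 \<Longrightarrow> g z = u z"
    and gnz: "\<And>z. z \<in> cball 0 1 - {1,-1} \<Longrightarrow> g z \<noteq> 0"
    and g1: "g 1 = 0 \<longrightarrow> deriv g 1 \<noteq> 0" and g2: "g (-1) = 0 \<longrightarrow> deriv g (-1) \<noteq> 0"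
    using good unfolding good_jost_def by blast
  have sets: "sets \<gamma> = sets borel" and fm: "finite_measure \<gamma>" using sp by (auto simp: spectral_measure_def)
  obtain f where f: "f \<in> borel_measurable borel" "\<And>x. f x \<ge> 0" "\<And>x. x \<notin> {-2..2} \<Longrightarrow> f x = 0"
    and \<gamma>: "\<gamma> = density lborel (\<lambda>x. ennreal (f x))" and jz: "jost_zeros \<gamma> = {}"
  proof (rule standing_form_absolutely_continuous[OF sets st])
    fix z :: complex assume z: "cmod z < 1"
    then have "z \<noteq> 1" "z \<noteq> -1" by auto
    then have "u z \<noteq> 0" using gnz[of z] gu[of z] z by auto
    then show "(\<Prod>\<zeta>\<in>jost_zeros \<gamma>. (z - \<zeta>) / (1 - cnj \<zeta> * z)) \<noteq> 0" using uz[of z] z by auto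
  qed blast
  have fin: "(\<integral>\<^sup>+x. ennreal (f x) \<partial>lborel) < \<infinity>"
    using finite_measure.emeasure_finite[OF fm, of "space \<gamma>"] f(1) by (simp add: \<gamma> emeasure_density less_top)
  define k where "k = circle_density f"
  have ik: "integrable circle k"
    unfolding k_def by (rule integrable_circle_density) (use f fin in auto)
  have M: "M_fun \<gamma> z = z / (1 - z\<^sup>2) * herglotz k z" if "cmod z < 1" "z \<noteq> 0" for z
    unfolding \<gamma> k_def by (rule M_fun_herglotz) (use f fin that in auto)
  define S where "S E = (\<Sum>j. complex_of_real (jmoment a b j) / E ^ Suc j)" for E
  define T where "T E = (\<Sum>j. complex_of_real (jmoment (strip 1 a) (strip 1 b) j) / E ^ Suc j)" for E
  obtain K0 where K0: "\<And>E::complex. cmod E > K0 \<Longrightarrow> (\<lambda>j. - complex_of_real (jmoment a b j) / E ^ Suc j) sums m_fun \<gamma> E"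
    using sp unfolding spectral_measure_def m_fun_def by blast
  obtain K1 where K1: "K1 > 0" and sumS: "\<And>E. cmod E > K1 \<Longrightarrow> summable (\<lambda>j. complex_of_real (jmoment a b j) / E ^ Suc j)"
    and sumT: "\<And>E. cmod E > K1 \<Longrightarrow> summable (\<lambda>j. complex_of_real (jmoment (strip 1 a) (strip 1 b) j) / E ^ Suc j)"
    and ST: "\<And>E. cmod E > K1 \<Longrightarrow> S E * (E - complex_of_real (b 1) - complex_of_real ((a 1)\<^sup>2) * T E) = 1"
    unfolding S_def T_def by (rule stieltjes_coefficient_stripping[OF J]) blast
  \<comment> \<open>Beyond this radius all the series in play converge, and E stays off [-2,2], so
    that E = z + 1/z has a solution in the disc.\<close>
  define Kc where "Kc = max K0 (max K1 2)"
  have sq0: "1 - z\<^sup>2 \<noteq> 0" if "cmod z < 1" for z :: complex using that by (auto simp: power2_eq_1_iff)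
  have HS: "herglotz k z = (inverse z - z) * S (z + inverse z)" if z: "z \<noteq> 0" "cmod z < 1" and E: "Kc < cmod (z + inverse z)" for z
  proof -
    have "(\<lambda>j. - (- complex_of_real (jmoment a b j) / (z + inverse z) ^ Suc j)) sums (- m_fun \<gamma> (z + inverse z))"
      using E by (intro sums_minus K0) (simp add: Kc_def)
    then have "S (z + inverse z) = M_fun \<gamma> z" unfolding S_def M_fun_def by (simp add: sums_iff)
    then have "S (z + inverse z) = z / (1 - z\<^sup>2) * herglotz k z" using M z by simp
    moreover have "(inverse z - z) * (z / (1 - z\<^sup>2)) = 1"
    proof -
      have "(inverse z - z) * z = 1 - z\<^sup>2" using z by (simp add: algebra_simps power2_eq_square)
      then show ?thesis using sq0[OF z(2)] by simp
    qed
    ultimately show ?thesis by (metis mult.assoc mult.left_neutral)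
  qed
  \<comment> \<open>The zeroth moment is 1. This fixes the total mass required by
    \<open>spectral_density_boundary\<close> and later the value of U at 0.\<close>
  have hk0: "herglotz k 0 = 1"
  proof -
    have "((\<lambda>z. (inverse z - z) * S (z + inverse z)) \<longlongrightarrow> complex_of_real (jmoment a b 0)) (at 0)"
      unfolding S_def by (rule joukowski_moment_limit[OF K1 sumS])
    moreover have "\<forall>\<^sub>F z in at 0. (inverse z - z) * S (z + inverse z) = herglotz k z"
      using eventually_joukowski_large[of Kc] by eventually_elim (simp add: HS)
    ultimately have "(herglotz k \<longlongrightarrow> complex_of_real (jmoment a b 0)) (at 0)"
      by (rule Lim_transform_eventually)
    moreover have "(herglotz k \<longlongrightarrow> herglotz k 0) (at 0)"
      using holomorphic_on_imp_continuous_on[OF holomorphic_herglotz[OF ik]]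
      by (simp add: continuous_on_eq_continuous_at isCont_def)
    ultimately show ?thesis using tendsto_unique[of "at (0::complex)"] by fastforce
  qed
  then have mass: "(\<integral>\<phi>. circle_density f \<phi> \<partial>circle) = 2 * pi"
    unfolding herglotz_0 k_def[symmetric] by (metis (no_types) divide_eq_1_iff of_real_eq_1_iff)
  define h where "h \<theta> = ln (sin \<theta> / ImM_bdry \<gamma> \<theta>) / 2" for \<theta>
  have hi: "integrable circle (\<lambda>\<theta>. ln (sin \<theta> / ImM_bdry \<gamma> \<theta>))" using hi0 by (simp add: integrable_circle_iff)
  have gh: "g z = exp (herglotz h z)" if z: "cmod z < 1" for z
  proof -
    have "set_lebesgue_integral lborel {0..2*pi} (\<lambda>\<theta>. (cis \<theta> + z) / (cis \<theta> - z) *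
        complex_of_real (ln (sin \<theta> / ImM_bdry \<gamma> \<theta>) / (4 * pi)))
      = (\<integral>\<theta>. (cis \<theta> + z) / (cis \<theta> - z) * complex_of_real (ln (sin \<theta> / ImM_bdry \<gamma> \<theta>) / (4 * pi)) \<partial>circle)"
      by (rule integral_circle_eq[symmetric])
    also have "\<dots> = (\<integral>\<theta>. (cis \<theta> + z) / (cis \<theta> - z) * complex_of_real (h \<theta>) / (2 * pi) \<partial>circle)"
      by (intro Bochner_Integration.integral_cong) (auto simp: h_def)
    also have "\<dots> = herglotz h z" unfolding herglotz_def by (rule integral_divide_zero)
    finally show ?thesis using gu[of z] uz[of z] z jz by simp
  qed
  obtain \<rho> N where \<rho>: "1 < \<rho>" "\<rho> \<le> R" and N: "N holomorphic_on ball 0 \<rho>" and Ng: "\<And>z. cmod z < \<rho> \<Longrightarrow> N z * g z = 1 - z\<^sup>2"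
    by (rule reciprocal_factor[OF R g _ g1 g2]) (use gnz in blast)+
  have gh2: "g z = exp (herglotz (\<lambda>\<theta>. ln (sin \<theta> / ImM_bdry (density lborel (\<lambda>x. ennreal (f x))) \<theta>) / 2) z)" if "cmod z < 1" for z
    using gh[OF that] unfolding h_def \<gamma> .
  have gsym: "g (cnj z) = cnj (g z)" if "cmod z < R" for z
    by (rule spectral_density_boundary(1)[OF f(1) f(2) _ fin mass hi[unfolded \<gamma>] R g _ \<rho>(1) N _ that])
       (use f(3) gh2 Ng in auto)
  have dens: "AE \<theta> in circle. circle_density f \<theta> = (cmod (N (cis \<theta>)))\<^sup>2 / 2"
    by (rule spectral_density_boundary(2)[OF f(1) f(2) _ fin mass hi[unfolded \<gamma>] R g _ \<rho>(1) N])
       (use f(3) gh2 Ng in auto)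
  obtain Q K \<sigma> where \<sigma>: "1 < \<sigma>" "\<sigma> \<le> \<rho>" and K: "K holomorphic_on ball 0 \<sigma>" and KH: "\<And>z. cmod z < 1 \<Longrightarrow> K z = herglotz (\<lambda>\<phi>. (cmod (N (cis \<phi>)))\<^sup>2 / 2) z"
    and ReK: "\<And>\<phi>. Re (K (cis \<phi>)) = (cmod (N (cis \<phi>)))\<^sup>2 / 2" and Q: "Q holomorphic_on ball 0 R" and KQ: "\<And>z. cmod z < \<sigma> \<Longrightarrow> K z = N z * Q z"
    and Qe: "\<And>z. cmod z < \<sigma> \<Longrightarrow> (1 - z\<^sup>2) * Q z = g z * K z"
    and Qnz: "\<And>z. z \<in> cball 0 1 - {1,-1} \<Longrightarrow> Q z \<noteq> 0"
    and Q1: "Q 1 = 0 \<longrightarrow> deriv Q 1 \<noteq> 0" and Q2: "Q (-1) = 0 \<longrightarrow> deriv Q (-1) \<noteq> 0"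
    and Qsym: "\<And>z. cmod z < R \<Longrightarrow> Q (cnj z) = cnj (Q z)"
    by (rule jost_stripping[OF g \<rho> N]) (rule Ng gsym, assumption | blast)+
  have Kk: "K z = herglotz k z" if "cmod z < 1" for z
  proof -
    have "continuous_on {0..2*pi} (\<lambda>\<phi>. N (cis \<phi>))"
      using holomorphic_on_imp_continuous_on[OF N]
      by (rule continuous_on_compose2) (use \<rho> in \<open>auto intro!: continuous_intros\<close>)
    then have "integrable circle (\<lambda>\<phi>. (cmod (N (cis \<phi>)))\<^sup>2 / 2)"
      by (intro integrable_circle_continuous continuous_intros) auto
    from herglotz_cong_AE[OF ik this dens[folded k_def] that] KH[OF that] show ?thesis by simp
  qed
  define A where "A = complex_of_real (a 1)"
  define B where "B = complex_of_real (b 1)"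
  have a1: "a 1 > 0" using J by (simp add: jacobi_def)
  then have A0: "A \<noteq> 0" by (simp add: A_def)
  \<comment> \<open>The factor a_1 is forced by |U|^2 Im M_1 = sin theta on the circle, as the
    computation of \<open>ReK2\<close> shows.\<close>
  define U where "U z = A * Q z" for z
  have U: "U holomorphic_on ball 0 R" unfolding U_def using Q by (intro holomorphic_intros)
  have dU: "deriv U z = A * deriv Q z" if "cmod z < R" for z
    unfolding U_def[abs_def] using Q that by (intro deriv_cmult) (auto simp: holomorphic_on_imp_differentiable_at)
  have Unz: "U z \<noteq> 0" if "z \<in> cball 0 1 - {1,-1}" for z using Qnz[OF that] A0 by (simp add: U_def)
  have U1: "U 1 = 0 \<longrightarrow> deriv U 1 \<noteq> 0" and U2: "U (-1) = 0 \<longrightarrow> deriv U (-1) \<noteq> 0"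
    using Q1 Q2 A0 R dU[of 1] dU[of "-1"] by (auto simp: U_def)
  have Ugood: "good_jost R U" unfolding good_jost_def
    by (rule exI[of _ U]) (use U Unz U1 U2 in blast)
  obtain \<rho>1 N1 where \<rho>1: "1 < \<rho>1" "\<rho>1 \<le> R" and N1: "N1 holomorphic_on ball 0 \<rho>1" and N1U: "\<And>z. cmod z < \<rho>1 \<Longrightarrow> N1 z * U z = 1 - z\<^sup>2"
    by (rule reciprocal_factor[OF R U _ U1 U2]) (use Unz in blast)+
  have in_disc: "z \<in> cball 0 1 - {1,-1}" if "cmod z < 1" for z :: complex using that by auto
  have N1sym: "N1 (cnj z) = cnj (N1 z)" if "cmod z < \<rho>1" for z
  proof (rule real_symmetric_continuation[OF N1 _ _ that])
    fix z :: complex assume z: "cmod z < 1"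
    have Us: "U (cnj z) = cnj (U z)" using Qsym[of z] z R by (simp add: U_def A_def)
    have "N1 (cnj z) * U (cnj z) = cnj (N1 z * U z)" using N1U[of z] N1U[of "cnj z"] z \<rho>1 by simp
    then have "N1 (cnj z) * cnj (U z) = cnj (N1 z) * cnj (U z)" by (simp add: Us)
    then show "N1 (cnj z) = cnj (N1 z)" using Unz[OF in_disc[OF z]] by simp
  qed (use \<rho>1 in auto)
  define \<tau> where "\<tau> = min \<sigma> \<rho>1"
  have \<tau>: "1 < \<tau>" "\<tau> \<le> \<sigma>" "\<tau> \<le> \<rho>1" "\<tau> \<le> \<rho>" "\<tau> \<le> R" using \<sigma> \<rho> \<rho>1 by (auto simp: \<tau>_def)
  \<comment> \<open>Solving M (z + 1/z - b_1 - a_1^2 M_1) = 1 for (1/z - z) M_1 produces the term (1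
    - z^2)^2 / K. It equals A g N1, because (1 - z^2) / K = g / Q and N1 = (1 - z^2) / U with U = A
    Q. In this form nothing is divided by K or Q, so 1 and -1 are regular points.\<close>
  define L where "L z = ((1 - z\<^sup>2) * (1 + z\<^sup>2 - B * z) - A * g z * N1 z) / (A\<^sup>2 * z\<^sup>2)" for z
  have LT: "L z = (inverse z - z) * T (z + inverse z)" if z: "z \<noteq> 0" "cmod z < 1" and E: "Kc < cmod (z + inverse z)" for z
  proof -
    let ?E = "z + inverse z"
    have st: "S ?E * (?E - B - A\<^sup>2 * T ?E) = 1" using ST[of ?E] E by (simp add: Kc_def A_def B_def)
    have Kz: "K z = (inverse z - z) * S ?E" using HS[OF z E] Kk[OF z(2)] by simp
    have zi: "z * (inverse z - z) = 1 - z\<^sup>2" and zE: "z * ?E = 1 + z\<^sup>2"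
      using z by (simp_all add: algebra_simps power2_eq_square)
    have "K z * (1 + z\<^sup>2 - B * z - A\<^sup>2 * (z * T ?E)) = (z * (inverse z - z)) * (S ?E * (?E - B - A\<^sup>2 * T ?E))"
      unfolding Kz zE[symmetric] by (simp add: algebra_simps)
    then have e1: "K z * (1 + z\<^sup>2 - B * z - A\<^sup>2 * (z * T ?E)) = 1 - z\<^sup>2" unfolding st zi by simp
    have z\<sigma>: "cmod z < \<sigma>" "cmod z < \<rho>1" using z \<sigma> \<rho>1 by auto
    have Qz: "Q z \<noteq> 0" using Qnz[OF in_disc[OF z(2)]] .
    have "(1 - z\<^sup>2) * Q z * (1 + z\<^sup>2 - B * z - A\<^sup>2 * (z * T ?E)) = g z * (1 - z\<^sup>2)"
      unfolding Qe[OF z\<sigma>(1)] using e1 by (simp add: mult.assoc)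
    then have "(1 - z\<^sup>2) * (Q z * (1 + z\<^sup>2 - B * z - A\<^sup>2 * (z * T ?E))) = (1 - z\<^sup>2) * g z" by (simp only: mult_ac)
    then have "Q z * (1 + z\<^sup>2 - B * z - A\<^sup>2 * (z * T ?E)) = g z" using sq0[OF z(2)] by simp
    then have "A * g z * N1 z = (N1 z * U z) * (1 + z\<^sup>2 - B * z - A\<^sup>2 * (z * T ?E))"
      unfolding U_def by (simp add: mult_ac)
    then have "A * g z * N1 z = (1 - z\<^sup>2) * (1 + z\<^sup>2 - B * z) - (1 - z\<^sup>2) * (A\<^sup>2 * (z * T ?E))"
      unfolding N1U[OF z\<sigma>(2)] by (simp only: right_diff_distrib)
    then have "L z = (1 - z\<^sup>2) * (A\<^sup>2 * (z * T ?E)) / (A\<^sup>2 * z\<^sup>2)" unfolding L_def by simp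
    also have "\<dots> = (1 - z\<^sup>2) * T ?E / z" using A0 z by (simp add: power2_eq_square)
    also have "(1 - z\<^sup>2) = z * (inverse z - z)" by (rule zi[symmetric])
    finally show ?thesis using z by simp
  qed
  \<comment> \<open>The apparent double pole of \<open>L\<close> at 0 is removable, since
    \<open>L\<close> agrees near 0 with the moment expression; the value 1 is the zeroth
    moment.\<close>
  define K2 where "K2 z = (if z = 0 then 1 else L z)" for z
  have K2h: "K2 holomorphic_on ball 0 \<tau>"
  proof (rule no_isolated_singularity'[where K="{0}"])
    have "((\<lambda>z. (inverse z - z) * T (z + inverse z)) \<longlongrightarrow> complex_of_real (jmoment (strip 1 a) (strip 1 b) 0)) (at 0)"
      unfolding T_def by (rule joukowski_moment_limit[OF K1 sumT])
    moreover have "\<forall>\<^sub>F z in at 0. (inverse z - z) * T (z + inverse z) = K2 z"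
      using eventually_joukowski_large[of Kc] by eventually_elim (simp add: LT K2_def)
    ultimately have "(K2 \<longlongrightarrow> complex_of_real (jmoment (strip 1 a) (strip 1 b) 0)) (at 0)"
      by (rule Lim_transform_eventually)
    then have "(K2 \<longlongrightarrow> K2 0) (at 0)" by (simp add: K2_def)
    then show "(K2 \<longlongrightarrow> K2 z) (at z within ball 0 \<tau>)" if "z \<in> {0}" for z
      using that by (auto intro: tendsto_within_subset)
    have "L holomorphic_on ball 0 \<tau> - {0}"
      unfolding L_def using A0 \<tau>
      by (intro holomorphic_intros holomorphic_on_subset[OF g] holomorphic_on_subset[OF N1]) auto
    then show "K2 holomorphic_on ball 0 \<tau> - {0}" by (rule holomorphic_transform) (simp add: K2_def)
  qed auto
  \<comment> \<open>On the circle 1 - zeta^2 = -2 i sin phi zeta and 1 + zeta^2 - B zeta = (2 cos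
    phi - b_1) zeta, so the first term of \<open>L\<close> is imaginary. The rest is 4 sin^2 phi /
    (a_1^2 K), and Re (1/K) = Re K / |K|^2 with Re K = |N|^2 / 2 and |K| = |N| |Q|.\<close>
  have ReK2: "Re (K2 (cis \<phi>)) = (cmod (N1 (cis \<phi>)))\<^sup>2 / 2" if s: "sin \<phi> \<noteq> 0" for \<phi>
  proof -
    define \<zeta> where "\<zeta> = cis \<phi>"
    define x where "x = sin \<phi>"
    have \<zeta>: "cmod \<zeta> = 1" "\<zeta> \<noteq> 0" by (auto simp: \<zeta>_def)
    have \<zeta>b: "cmod \<zeta> < \<sigma>" "cmod \<zeta> < \<rho>" "cmod \<zeta> < \<rho>1" using \<zeta> \<sigma> \<rho> \<rho>1 by auto
    have cs: "(cos \<phi>)\<^sup>2 + (sin \<phi>)\<^sup>2 = 1" by simp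
    have e1: "1 - \<zeta>\<^sup>2 = - (2 * \<i> * complex_of_real x) * \<zeta>"
      using cs by (simp add: \<zeta>_def x_def complex_eq_iff power2_eq_square algebra_simps)
    have e2: "1 + \<zeta>\<^sup>2 - B * \<zeta> = complex_of_real (2 * cos \<phi> - b 1) * \<zeta>"
      using cs by (simp add: \<zeta>_def B_def complex_eq_iff power2_eq_square algebra_simps)
    have nz: "1 - \<zeta>\<^sup>2 \<noteq> 0" using e1 s \<zeta> by (simp add: x_def)
    have Nz: "N \<zeta> \<noteq> 0" using Ng[OF \<zeta>b(2)] nz by auto
    have Uz: "U \<zeta> \<noteq> 0" using N1U[OF \<zeta>b(3)] nz by auto
    then have Qz: "Q \<zeta> \<noteq> 0" by (auto simp: U_def)
    have Kz: "K \<zeta> = N \<zeta> * Q \<zeta>" by (rule KQ[OF \<zeta>b(1)])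
    then have K0: "K \<zeta> \<noteq> 0" using Nz Qz by simp
    have "(g \<zeta> * N1 \<zeta>) * (A * K \<zeta>) = (N \<zeta> * g \<zeta>) * (N1 \<zeta> * U \<zeta>)"
      unfolding Kz U_def by (simp add: mult_ac)
    also have "\<dots> = (1 - \<zeta>\<^sup>2) * (1 - \<zeta>\<^sup>2)" using Ng[OF \<zeta>b(2)] N1U[OF \<zeta>b(3)] by simp
    also have "\<dots> = - complex_of_real (4 * x\<^sup>2) * \<zeta>\<^sup>2" unfolding e1 by (simp add: power2_eq_square algebra_simps)
    finally have "g \<zeta> * N1 \<zeta> = - complex_of_real (4 * x\<^sup>2) * \<zeta>\<^sup>2 / (A * K \<zeta>)"
      using A0 K0 by (subst nonzero_eq_divide_eq) auto
    then have e3: "A * g \<zeta> * N1 \<zeta> / (A\<^sup>2 * \<zeta>\<^sup>2) = - (complex_of_real (4 * x\<^sup>2 / (a 1)\<^sup>2) / K \<zeta>)"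
      using A0 \<zeta> by (simp add: mult.assoc power2_eq_square A_def)
    have e4: "(1 - \<zeta>\<^sup>2) * (1 + \<zeta>\<^sup>2 - B * \<zeta>) / (A\<^sup>2 * \<zeta>\<^sup>2) = complex_of_real (- 2 * x * (2 * cos \<phi> - b 1) / (a 1)\<^sup>2) * \<i>"
      unfolding e1 e2 using A0 \<zeta> by (simp add: power2_eq_square A_def)
    have "L \<zeta> = complex_of_real (- 2 * x * (2 * cos \<phi> - b 1) / (a 1)\<^sup>2) * \<i> + complex_of_real (4 * x\<^sup>2 / (a 1)\<^sup>2) / K \<zeta>"
      unfolding L_def diff_divide_distrib e3 e4 by simp
    then have "Re (L \<zeta>) = Re (complex_of_real (4 * x\<^sup>2 / (a 1)\<^sup>2) / K \<zeta>)"
      by (simp only: plus_complex.sel times_complex.sel Re_complex_of_real Im_complex_of_real imaginary_unit.sel mult_zero_left mult_zero_right diff_zero add_0_left mult_1_right)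
    also have "\<dots> = 4 * x\<^sup>2 / (a 1)\<^sup>2 * Re (K \<zeta>) / (cmod (K \<zeta>))\<^sup>2"
    proof -
      have "Re (complex_of_real y / w) = y * Re w / (cmod w)\<^sup>2" for y w by (simp add: Re_divide cmod_power2)
      then show ?thesis .
    qed
    also have "\<dots> = 4 * x\<^sup>2 / (a 1)\<^sup>2 * ((cmod (N \<zeta>))\<^sup>2 / 2) / (cmod (N \<zeta>) * cmod (Q \<zeta>))\<^sup>2"
      using ReK[of \<phi>] Kz by (simp add: \<zeta>_def norm_mult)
    also have "\<dots> = 2 * x\<^sup>2 / (cmod (U \<zeta>))\<^sup>2"
      using Nz a1 by (simp add: U_def A_def norm_mult power_mult_distrib)
    also have "\<dots> = (cmod (N1 \<zeta>))\<^sup>2 / 2"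
    proof -
      have "cmod (N1 \<zeta>) * cmod (U \<zeta>) = 2 * \<bar>x\<bar>"
        using N1U[OF \<zeta>b(3)] norm_one_minus_cis_sq[of \<phi>] by (simp add: \<zeta>_def x_def flip: norm_mult)
      from arg_cong[OF this, of "\<lambda>x. x\<^sup>2"] have "(cmod (N1 \<zeta>))\<^sup>2 * (cmod (U \<zeta>))\<^sup>2 = 4 * x\<^sup>2"
        by (simp add: power_mult_distrib)
      then show ?thesis using Uz by (simp add: divide_simps)
    qed
    finally show ?thesis using \<zeta> by (simp add: K2_def \<zeta>_def)
  qed
  obtain f1 where f1: "f1 \<in> borel_measurable borel" "\<And>x. f1 x \<ge> 0" "\<And>x. x \<notin> {-2..2} \<Longrightarrow> f1 x = 0"
    and fin1: "(\<integral>\<^sup>+x. ennreal (f1 x) \<partial>lborel) < \<infinity>"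
    and cd1: "\<And>\<phi>. \<phi> \<in> {0..2*pi} \<Longrightarrow> sin \<phi> \<noteq> 0 \<Longrightarrow> circle_density f1 \<phi> = (cmod (N1 (cis \<phi>)))\<^sup>2 / 2"
    by (rule two_cos_density[OF N1 \<rho>1(1)]) (rule N1sym, assumption, blast)
  have ik1: "integrable circle (circle_density f1)"
    by (rule integrable_circle_density) (use f1 fin1 in auto)
  have H1: "herglotz (circle_density f1) z = K2 z" if z: "cmod z < 1" for z
  proof -
    have "continuous_on {0..2*pi} (\<lambda>\<phi>. K2 (cis \<phi>))"
      using holomorphic_on_imp_continuous_on[OF K2h]
      by (rule continuous_on_compose2) (use \<tau> in \<open>auto intro!: continuous_intros\<close>)
    then have "integrable circle (\<lambda>\<phi>. Re (K2 (cis \<phi>)))"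
      by (intro integrable_circle_continuous continuous_intros)
    moreover have "AE \<phi> in circle. circle_density f1 \<phi> = Re (K2 (cis \<phi>))"
      using AE_circle_not_singular by eventually_elim (simp add: cd1 ReK2)
    ultimately have "herglotz (circle_density f1) z = herglotz (\<lambda>\<phi>. Re (K2 (cis \<phi>))) z"
      by (rule herglotz_cong_AE[OF ik1 _ _ z])
    also have "\<dots> = K2 z - \<i> * Im (K2 0)" by (rule herglotz_Re[OF K2h \<tau>(1) z])
    finally show ?thesis by (simp add: K2_def)
  qed
  define \<gamma>1 where "\<gamma>1 = density lborel (\<lambda>x. ennreal (f1 x))"
  have sp1: "spectral_measure (strip 1 a) (strip 1 b) \<gamma>1"
    unfolding spectral_measure_def
  proof (intro conjI exI allI impI)
    show "sets \<gamma>1 = sets borel" by (simp add: \<gamma>1_def)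
    show "finite_measure \<gamma>1" using fin1 f1(1) by (intro finite_measureI) (simp add: \<gamma>1_def emeasure_density)
    fix E :: complex assume E: "Kc < cmod E"
    have "E \<noteq> complex_of_real x" if "x \<in> {-2..2}" for x using E that by (auto simp: Kc_def)
    then obtain z where z: "z \<noteq> 0" "cmod z < 1" "z + inverse z = E" using joukowski_surj by metis
    have "M_fun \<gamma>1 z = z / (1 - z\<^sup>2) * herglotz (circle_density f1) z"
      unfolding \<gamma>1_def by (rule M_fun_herglotz) (use f1 fin1 z in auto)
    also have "\<dots> = z / (1 - z\<^sup>2) * ((inverse z - z) * T E)" using H1[OF z(2)] LT[OF z(1,2)] z E by (simp add: K2_def)
    also have "\<dots> = T E"
    proof -
      have "z * (inverse z - z) = 1 - z\<^sup>2" using z by (simp add: algebra_simps power2_eq_square)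
      moreover have "z / (1 - z\<^sup>2) * ((inverse z - z) * T E) = z * (inverse z - z) / (1 - z\<^sup>2) * T E" by simp
      ultimately show ?thesis using sq0[OF z(2)] by simp
    qed
    finally have "m_fun \<gamma>1 E = - T E" unfolding M_fun_def z(3) by (simp add: minus_equation_iff)
    moreover have "(\<lambda>j. - (complex_of_real (jmoment (strip 1 a) (strip 1 b) j) / E ^ Suc j)) sums (- T E)"
      unfolding T_def using E by (intro sums_minus summable_sums sumT) (simp add: Kc_def)
    ultimately show "(\<lambda>j. - complex_of_real (jmoment (strip 1 a) (strip 1 b) j) / E ^ Suc j) sums
       (integral\<^sup>L \<gamma>1 (\<lambda>x. 1 / (complex_of_real x - E)))" unfolding m_fun_def by simp
  qed
  have K0: "K 0 = 1" using Kk[of 0] hk0 by simp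
  \<comment> \<open>Positivity at 0 selects the right unimodular constant: K 0 = 1 gives U 0 = a_1
    g(0), and g(0) is the exponential of a real mean.\<close>
  have "U 0 = A * g 0" using Qe[of 0] K0 \<sigma> by (simp add: U_def)
  also have "g 0 = complex_of_real (exp ((\<integral>\<phi>. h \<phi> \<partial>circle) / (2*pi)))"
  proof -
    have "g 0 = exp (herglotz h 0)" by (rule gh) simp
    then show ?thesis unfolding herglotz_0 exp_of_real .
  qed
  finally have U0: "U 0 = complex_of_real (a 1 * exp ((\<integral>\<phi>. h \<phi> \<partial>circle) / (2*pi)))" by (simp add: A_def)
  have "jost_function (strip 1 a) (strip 1 b) U"
  proof (rule jost_function_density[where U=U and f=f1 and N=N1 and H=K2, OF f1(1,2) _ fin1 \<rho>1(1) _ N1 _ U0 _ K2h \<tau>(1)])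
    show "U holomorphic_on ball 0 \<rho>1" using U \<rho>1 by (auto intro: holomorphic_on_subset)
    show "spectral_measure (strip 1 a) (strip 1 b) (density lborel (\<lambda>x. ennreal (f1 x)))" using sp1 by (simp add: \<gamma>1_def)
  qed (use f1(3) N1U a1 H1 ReK2 in auto)
  with Ugood show ?thesis by blast
qed

theorem theorem2p1:
  fixes a b :: "nat \<Rightarrow> real" and u :: "complex \<Rightarrow> complex" and R :: real
  assumes "R > 1"
    and "jacobi a b"
    and "jost_function a b u"
    and "good_jost R u"
  shows "\<forall>n\<ge>1. \<exists>un. jost_function (strip n a) (strip n b) un \<and> good_jost R un"
proof (intro allI impI)
  fix n :: nat assume "n \<ge> 1"
  then show "\<exists>un. jost_function (strip n a) (strip n b) un \<and> good_jost R un"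
  proof (induction n rule: dec_induct)
    case base
    show ?case using good_jost_stripped[OF assms] .
  next
    case (step n)
    then obtain un where un: "jost_function (strip n a) (strip n b) un" "good_jost R un" by blast
    from good_jost_stripped[OF assms(1) jacobi_strip[OF assms(2)] un] show ?case by (simp add: strip_strip)
  qed
qed

end
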